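(* Let $[0,1)^7+T$ be a cube tiling of $\mathbb{R}^7$ with $r^+(T)\geq 6$. Then the tiling $[0,1)^7+T$ contains a twin pair (i.e. Keller's conjecture is true for cube tilings $[0,1)^7+T$ of $\mathbb{R}^7$ for which $r^+(T)\ge 6$).
   Context: A cube tiling of $\mathbb{R}^d$ is a family of pairwise disjoint cubes $[0,1)^d+T=\{[0,1)^d+t:t\in T\}$, $T\subset\mathbb{R}^d$, with $\bigcup_{t\in T}([0,1)^d+t)=\mathbb{R}^d$. Two cubes $[0,1)^d+t$, $[0,1)^d+s$ form a twin pair if there is $j\in[d]=\{1,\dots,d\}$ with $|t_j-s_j|=1$ and $t_i=s_i$ for every $i\in[d]\setminus\{j\}$. For $x\in\mathbb{R}^d$ and $i\in[d]$, $L(T,x,i)$ is the set of all $i$th coordinates $t_i$ of vectors $t\in T$ such that $([0,1)^d+t)\cap([0,1]^d+x)\neq\emptyset$ and $t_i\le x_i$. (It is known that $1\le|L(T,x,i)|\le 2^{d-1}$.) Put $r^+(T)=\max_{x\in\mathbb{R}^d}\max_{1\le i\le d}|L(T,x,i)|$. *)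

theory Defs
  imports "HOL-Analysis.Analysis"
begin

definition unit_cube :: "(real ^ 'n) set" where
  "unit_cube = {y. \<forall>i. 0 \<le> y $ i \<and> y $ i < 1}"

definition closed_unit_cube :: "(real ^ 'n) set" where
  "closed_unit_cube = {y. \<forall>i. 0 \<le> y $ i \<and> y $ i \<le> 1}"

definition cube_at :: "real ^ 'n \<Rightarrow> (real ^ 'n) set" where
  "cube_at t = (\<lambda>y. y + t) ` unit_cube"

definition closed_cube_at :: "real ^ 'n \<Rightarrow> (real ^ 'n) set" where
  "closed_cube_at x = (\<lambda>y. y + x) ` closed_unit_cube"

definition cube_tiling :: "(real ^ 'n) set \<Rightarrow> bool" where
  "cube_tiling T \<longleftrightarrow> disjoint_family_on cube_at T \<and> (\<Union>t\<in>T. cube_at t) = UNIV"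

definition twin_pair :: "real ^ 'n \<Rightarrow> real ^ 'n \<Rightarrow> bool" where
  "twin_pair t s \<longleftrightarrow> (\<exists>j. \<bar>t $ j - s $ j\<bar> = 1 \<and> (\<forall>i. i \<noteq> j \<longrightarrow> t $ i = s $ i))"

definition L_set :: "(real ^ 'n) set \<Rightarrow> real ^ 'n \<Rightarrow> 'n \<Rightarrow> real set" where
  "L_set T x i = {t $ i | t. t \<in> T \<and> cube_at t \<inter> closed_cube_at x \<noteq> {} \<and> t $ i \<le> x $ i}"

text \<open>For a cube tiling every \<open>L_set T x i\<close> has between 1 and \<open>2 ^ (d - 1)\<close> elements, so
  the outer maximum below is taken over a finite set of naturals. For arbitrary \<open>T\<close> that
  set may be infinite, in which case \<open>Max\<close> is unspecified; \<open>r_plus\<close> is only meant to be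
  used for tilings.\<close>

definition r_plus :: "(real ^ 'n) set \<Rightarrow> nat" where
  "r_plus T = (MAX x. MAX i. card (L_set T x i))"

end

theory Submission
  imports Defs
begin

text \<open>
  Near a cube \<open>[0,1]\<^sup>d + x\<close> a tiling is encoded by words: the trace of a touching cube on the \<open>i\<close>-th edge is one
  of two complementary letters determined by \<open>t\<^sub>i\<close> modulo 1. Since the traces for different residues are affinely
  independent, touching cubes remain disjoint, and still cover everything, when these letters are interpreted as
  independent halves. Consequently, for each \<open>t\<^sub>i\<close> in \<open>L(T,x,i)\<close>, the cubes with \<open>i\<close>-th coordinate \<open>t\<^sub>i\<close> and those
  with \<open>t\<^sub>i + 1\<close> give, after deletion of the \<open>i\<close>-th letter, codes \<open>V\<close> and \<open>W\<close> covering the same points. Without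
  twin pairs in \<open>T\<close> they are disjoint and have no twin pairs either. We show that then \<open>V\<close> has at least 11 words.
  In dimension 7 there are 64 touching cubes with \<open>t\<^sub>i \<le> x\<^sub>i\<close>, and six letters would need 66.

  For the lower bound suppose that there are at most 10 words, and use induction on the number of coordinates. A box
  covered by a twin-free code not containing it meets at least five words of it. Counting with this
  bound shows that in every coordinate exactly two pairs of complementary letters occur and that every letter occurs
  two to four times in \<open>V\<close> and in \<open>W\<close>. Hence at most seven words of \<open>W\<close> meet a given \<open>v \<in> V\<close>. They partition
  the box of \<open>v\<close> using all coordinates, which is only possible with five words in dimension 3 or seven words in
  dimension 4. In the first case every other word of \<open>W\<close> has a twin; in the second case \<open>V\<close> and \<open>W\<close> have ten words,
  and counting the complementary pairs of letters between \<open>V\<close> and \<open>W\<close> gives both at most 90 and at least 96.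
\<close>

section \<open>Words and boxes\<close>

text \<open>A letter \<open>(k, b)\<close> is a half of an abstract interval; the two letters with the same key \<open>k\<close> are
  complementary, and letters with different keys are independent: a point of the interval is an arbitrary
  assignment of truth values to the keys. Words are only relevant on the finite set \<open>I\<close> of coordinates; a coordinate
  is removed by shrinking \<open>I\<close>, without changing the words.\<close>

definition opp :: "'k \<times> bool \<Rightarrow> 'k \<times> bool" where
  "opp l = (fst l, \<not> snd l)"

definition holds :: "('k \<Rightarrow> bool) \<Rightarrow> 'k \<times> bool \<Rightarrow> bool" where
  "holds f l \<longleftrightarrow> f (fst l) = snd l"

definition inbox :: "'i set \<Rightarrow> ('i \<Rightarrow> 'k \<Rightarrow> bool) \<Rightarrow> ('i \<Rightarrow> 'k \<times> bool) \<Rightarrow> bool" where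
  "inbox I p v \<longleftrightarrow> (\<forall>i\<in>I. holds (p i) (v i))"

definition cov :: "'i set \<Rightarrow> ('i \<Rightarrow> 'k \<times> bool) set \<Rightarrow> ('i \<Rightarrow> 'k \<Rightarrow> bool) \<Rightarrow> bool" where
  "cov I V p \<longleftrightarrow> (\<exists>v\<in>V. inbox I p v)"

definition dich :: "'i set \<Rightarrow> ('i \<Rightarrow> 'k \<times> bool) \<Rightarrow> ('i \<Rightarrow> 'k \<times> bool) \<Rightarrow> bool" where
  "dich I v w \<longleftrightarrow> (\<exists>i\<in>I. w i = opp (v i))"

definition twin :: "'i set \<Rightarrow> ('i \<Rightarrow> 'k \<times> bool) \<Rightarrow> ('i \<Rightarrow> 'k \<times> bool) \<Rightarrow> bool" where
  "twin I v w \<longleftrightarrow> (\<exists>i\<in>I. w i = opp (v i) \<and> (\<forall>j\<in>I - {i}. w j = v j))"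

definition eqon :: "'i set \<Rightarrow> ('i \<Rightarrow> 'k \<times> bool) \<Rightarrow> ('i \<Rightarrow> 'k \<times> bool) \<Rightarrow> bool" where
  "eqon I v w \<longleftrightarrow> (\<forall>i\<in>I. w i = v i)"

definition code :: "'i set \<Rightarrow> ('i \<Rightarrow> 'k \<times> bool) set \<Rightarrow> bool" where
  "code I V \<longleftrightarrow> finite V \<and> (\<forall>v\<in>V. \<forall>w\<in>V. v \<noteq> w \<longrightarrow> dich I v w)"

definition twinfree :: "'i set \<Rightarrow> ('i \<Rightarrow> 'k \<times> bool) set \<Rightarrow> bool" where
  "twinfree I V \<longleftrightarrow> (\<forall>v\<in>V. \<forall>w\<in>V. \<not> twin I v w)"

lemma opp_opp [simp]: "opp (opp l) = l"
  by (simp add: opp_def)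

lemma fst_opp [simp]: "fst (opp l) = fst l"
  by (simp add: opp_def)

lemma opp_neq [simp]: "opp l \<noteq> l" "l \<noteq> opp l"
  by (auto simp: opp_def prod_eq_iff)

lemma opp_inj [simp]: "opp l = opp m \<longleftrightarrow> l = m"
  by (auto simp: opp_def prod_eq_iff)

lemma opp_swap: "l = opp m \<longleftrightarrow> m = opp l"
  by (auto simp: opp_def prod_eq_iff)

lemma same_key: "fst l = fst m \<longleftrightarrow> l = m \<or> l = opp m"
  by (auto simp: opp_def prod_eq_iff)

lemma holds_opp [simp]: "holds f (opp l) \<longleftrightarrow> \<not> holds f l"
  by (auto simp: holds_def opp_def)

lemma holds_exists1: "\<exists>f. holds f l"
  by (rule exI[of _ "\<lambda>k. snd l"]) (simp add: holds_def)

text \<open>Letters with different keys are independent. If \<open>n\<close> shares its key with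
  \<open>l\<close> or \<open>m\<close>, it is the complement of that letter and fails
  automatically.\<close>

lemma holds_exists:
  assumes "m \<noteq> opp l" "n \<noteq> l" "n \<noteq> m"
  shows "\<exists>f. holds f l \<and> holds f m \<and> \<not> holds f n"
  using assms
  by (intro exI[of _ "\<lambda>k. if k = fst l then snd l else if k = fst m then snd m else \<not> snd n"])
    (auto simp: holds_def opp_def prod_eq_iff)

lemma holds_exists2:
  assumes "m \<noteq> opp l"
  shows "\<exists>f. holds f l \<and> holds f m"
  using assms
  by (intro exI[of _ "\<lambda>k. if k = fst l then snd l else snd m"])
    (auto simp: holds_def opp_def prod_eq_iff)

lemma holds_exists3:
  assumes "m \<noteq> l" "n \<noteq> l" "n \<noteq> opp m"
  shows "\<exists>f. holds f l \<and> \<not> holds f m \<and> \<not> holds f n"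
  using assms
  by (intro exI[of _ "\<lambda>k. if k = fst l then snd l else if k = fst m then \<not> snd m else \<not> snd n"])
    (auto simp: holds_def opp_def prod_eq_iff)

lemma dich_sym: "dich I v w \<longleftrightarrow> dich I w v"
  unfolding dich_def using opp_swap by metis

lemma eqon_sym: "eqon I v w \<longleftrightarrow> eqon I w v"
  unfolding eqon_def by metis

lemma dich_irrefl [simp]: "\<not> dich I v v"
  by (simp add: dich_def)

lemma eqon_dich_cong: "eqon I v w \<Longrightarrow> dich I v u \<longleftrightarrow> dich I w u"
  by (auto simp: eqon_def dich_def)

lemma dich_disjoint: "dich I v w \<Longrightarrow> inbox I p v \<Longrightarrow> inbox I p w \<Longrightarrow> False"
  by (auto simp: dich_def inbox_def)

lemma inbox_meet: "inbox I p v \<Longrightarrow> inbox I p w \<Longrightarrow> \<not> dich I v w"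
  using dich_disjoint by blast

lemma inbox_upd: "i \<notin> I \<Longrightarrow> inbox I (p(i := f)) v = inbox I p v"
  by (auto simp: inbox_def)

lemma inbox_remove: "i \<in> I \<Longrightarrow> inbox I p v \<longleftrightarrow> holds (p i) (v i) \<and> inbox (I - {i}) p v"
  by (auto simp: inbox_def)

lemma dich_mono: "dich J v w \<Longrightarrow> J \<subseteq> I \<Longrightarrow> dich I v w"
  by (auto simp: dich_def)

lemma dich_remove: "dich I v w \<Longrightarrow> w i \<noteq> opp (v i) \<Longrightarrow> dich (I - {i}) v w"
  by (auto simp: dich_def)

lemma twin_insert: "twin (I - {i}) v w \<Longrightarrow> v i = w i \<Longrightarrow> twin I v w"
  unfolding twin_def by fastforce

lemma twin_opp: "i \<in> I \<Longrightarrow> eqon (I - {i}) v w \<Longrightarrow> w i = opp (v i) \<Longrightarrow> twin I v w"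
  unfolding twin_def eqon_def by blast

lemma eqon_insert: "eqon (I - {i}) v w \<Longrightarrow> v i = w i \<Longrightarrow> eqon I v w"
  unfolding eqon_def by (metis Diff_iff singletonD)

lemma inbox_exists: "\<exists>p. inbox I p v"
proof -
  have "\<forall>i. \<exists>f. holds f (v i)" using holds_exists1 by blast
  then obtain p where "\<forall>i. holds (p i) (v i)" by metis
  then show ?thesis unfolding inbox_def by blast
qed

lemma meet_point: "\<not> dich I v w \<Longrightarrow> \<exists>p. inbox I p v \<and> inbox I p w"
proof -
  assume a: "\<not> dich I v w"
  have "\<forall>i. \<exists>f. i \<in> I \<longrightarrow> holds f (v i) \<and> holds f (w i)"
    using a holds_exists2 unfolding dich_def by metis
  then obtain p where "\<forall>i. i \<in> I \<longrightarrow> holds (p i) (v i) \<and> holds (p i) (w i)" by metis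
  then show ?thesis unfolding inbox_def by blast
qed

lemma meet_point_avoid:
  assumes m: "\<not> dich I v w" and j: "j \<in> I" "x j \<noteq> v j" "x j \<noteq> w j"
  shows "\<exists>p. inbox I p v \<and> inbox I p w \<and> \<not> inbox I p x"
proof -
  obtain p where p: "inbox I p v" "inbox I p w" using meet_point[OF m] by blast
  have "w j \<noteq> opp (v j)" using m j by (auto simp: dich_def)
  then obtain f where f: "holds f (v j)" "holds f (w j)" "\<not> holds f (x j)"
    using holds_exists j by metis
  have "inbox I (p(j := f)) v" "inbox I (p(j := f)) w" "\<not> inbox I (p(j := f)) x"
    using p f j by (auto simp: inbox_def)
  then show ?thesis by blast
qed

lemma code_subset: "code I V \<Longrightarrow> W \<subseteq> V \<Longrightarrow> code I W"
  unfolding code_def by (meson finite_subset subsetD)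

lemma twinfree_subset: "twinfree I V \<Longrightarrow> W \<subseteq> V \<Longrightarrow> twinfree I W"
  unfolding twinfree_def by blast

lemma code_finite: "code I V \<Longrightarrow> finite V"
  by (simp add: code_def)

lemma codeD: "code I V \<Longrightarrow> v \<in> V \<Longrightarrow> w \<in> V \<Longrightarrow> v \<noteq> w \<Longrightarrow> dich I v w"
  by (simp add: code_def)

lemma code_remove: "code I V \<Longrightarrow> \<forall>v\<in>V. \<forall>w\<in>V. w i \<noteq> opp (v i) \<Longrightarrow> code (I - {i}) V"
  unfolding code_def using dich_remove by metis

lemma code_fiber:
  assumes "code I V" "X \<subseteq> V" "\<And>v. v \<in> X \<Longrightarrow> v j = l"
  shows "code (I - {j}) X"
proof (rule code_remove[OF code_subset[OF assms(1,2)]], intro ballI)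
  fix v w assume "v \<in> X" "w \<in> X"
  then have "v j = l" "w j = l" using assms(3) by blast+
  then show "w j \<noteq> opp (v j)" by simp
qed

lemma twinfree_fiber:
  assumes "twinfree I V" "X \<subseteq> V" "\<And>v. v \<in> X \<Longrightarrow> v j = l"
  shows "twinfree (I - {j}) X"
  unfolding twinfree_def
proof (intro ballI)
  fix v w assume vw: "v \<in> X" "w \<in> X"
  then have "v j = w j" using assms(3) by metis
  then show "\<not> twin (I - {j}) v w"
    using twin_insert[of I j v w] assms(1,2) vw unfolding twinfree_def by blast
qed

section \<open>Covering a box by a twin-free code\<close>

text \<open>Wherever \<open>x j\<close> differs from \<open>v j\<close>, every word of
  \<open>Y\<close> must carry \<open>x j\<close>, since otherwise some point of the boxes of
  \<open>y\<close> and \<open>v\<close> would lie outside the box of \<open>x\<close>. Hence the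
  part of the box of \<open>x\<close> inside that of \<open>v\<close> decides the whole box.\<close>

lemma single_cover:
  assumes Y: "\<forall>y\<in>Y. \<not> dich I y v" and x: "\<not> dich I x v"
    and eq: "\<And>p. inbox I p v \<Longrightarrow> inbox I p x \<longleftrightarrow> cov I Y p"
  shows "\<And>p. inbox I p x \<Longrightarrow> cov I Y p"
proof -
  have yx: "y j = x j" if "y \<in> Y" "j \<in> I" "x j \<noteq> v j" for y j
  proof (rule ccontr)
    assume "y j \<noteq> x j"
    then have "\<exists>p. inbox I p y \<and> inbox I p v \<and> \<not> inbox I p x"
      by (intro meet_point_avoid[of I y v j x]) (use that Y in auto)
    then obtain p where "inbox I p y" "inbox I p v" "\<not> inbox I p x" by blast
    then show False using eq[of p] that unfolding cov_def by blast
  qed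
  fix p assume p: "inbox I p x"
  obtain q where q: "inbox I q x" "inbox I q v" using meet_point[OF x] by blast
  \<comment> \<open>Coordinates come from \<open>p\<close> where the letters of \<open>x\<close> and
    \<open>v\<close> agree and from \<open>q\<close> elsewhere, which puts \<open>r\<close> into
    both boxes.\<close>
  define r where "r = (\<lambda>j. if x j = v j then p j else q j)"
  have "inbox I r x" "inbox I r v" using p q unfolding r_def inbox_def by auto
  then obtain y where y: "y \<in> Y" "inbox I r y" using eq unfolding cov_def by blast
  have "inbox I p y" unfolding inbox_def
  proof
    fix j assume j: "j \<in> I"
    show "holds (p j) (y j)"
    proof (cases "x j = v j")
      case True then show ?thesis using y(2) j unfolding r_def inbox_def by force
    next
      case False then show ?thesis using yx[OF y(1) j False] p j unfolding inbox_def by auto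
    qed
  qed
  then show "cov I Y p" using y unfolding cov_def by blast
qed

text \<open>Flipping the truth value of the letter \<open>b\<close> at a point leaves the box of \<open>x\<close> unchanged, because the
  \<open>j\<close>-th letter of \<open>x\<close> has another key.\<close>

lemma fiber_pair1:
  assumes I: "j \<in> I" and c: "code I Y" and covx: "\<And>p. inbox I p x \<Longrightarrow> cov I Y p"
    and b: "b \<noteq> x j" "b \<noteq> opp (x j)" and q: "inbox (I - {j}) q x"
    and h: "cov (I - {j}) {y \<in> Y. \<not> dich I x y \<and> y j = b} q"
  shows "cov (I - {j}) {y \<in> Y. \<not> dich I x y \<and> y j = opp b} q"
proof -
  obtain y where y: "y \<in> Y" "y j = b" "inbox (I - {j}) q y" using h unfolding cov_def by auto
  have "opp b \<noteq> opp (x j)" using b by simp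
  then obtain f where f: "holds f (x j)" "holds f (opp b)" using holds_exists2 by metis
  let ?p = "q(j := f)"
  have px: "inbox I ?p x" using I q f by (simp add: inbox_remove[OF I] inbox_upd)
  then obtain z where z: "z \<in> Y" "inbox I ?p z" using covx unfolding cov_def by blast
  have zq: "inbox (I - {j}) q z" "holds f (z j)" using z(2) by (auto simp: inbox_remove[OF I] inbox_upd)
  have "z \<noteq> y" using zq(2) f(2) y(2) by auto
  then have "dich I y z" using c y z by (simp add: code_def)
  then have "z j = opp (y j)" using dich_remove[of I y z j] dich_disjoint[of "I - {j}" y z q] y zq by blast
  moreover have "\<not> dich I x z" using inbox_meet px z(2) by blast
  ultimately show ?thesis using z y zq unfolding cov_def by auto
qed

lemma fiber_pair:
  assumes I: "j \<in> I" and c: "code I Y" and covx: "\<And>p. inbox I p x \<Longrightarrow> cov I Y p"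
    and b: "b \<noteq> x j" "b \<noteq> opp (x j)" and q: "inbox (I - {j}) q x"
  shows "cov (I - {j}) {y \<in> Y. \<not> dich I x y \<and> y j = b} q
    \<longleftrightarrow> cov (I - {j}) {y \<in> Y. \<not> dich I x y \<and> y j = opp b} q"
proof
  show "cov (I - {j}) {y \<in> Y. \<not> dich I x y \<and> y j = opp b} q"
    if "cov (I - {j}) {y \<in> Y. \<not> dich I x y \<and> y j = b} q"
    by (rule fiber_pair1[OF I c covx b q that])
  have "opp b \<noteq> x j" "opp b \<noteq> opp (x j)" using b opp_swap[of "x j" b] by auto
  from fiber_pair1[OF I c covx this q]
  show "cov (I - {j}) {y \<in> Y. \<not> dich I x y \<and> y j = b} q"
    if "cov (I - {j}) {y \<in> Y. \<not> dich I x y \<and> y j = opp b} q"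
    using that by simp
qed

text \<open>The bound for covers enters as the hypothesis \<open>F\<close>, so that the lemma can
  serve inside the induction proving that bound and again afterwards. If one code is a single word,
  \<open>single_cover\<close> turns the other into a cover of its box.\<close>

lemma pair_sizes_aux:
  fixes X Y :: "('i \<Rightarrow> 'k \<times> bool) set"
  assumes F: "\<And>(Y :: ('i \<Rightarrow> 'k \<times> bool) set) x. code I Y \<Longrightarrow> twinfree I Y \<Longrightarrow>
      (\<And>p. inbox I p x \<Longrightarrow> cov I Y p) \<Longrightarrow> (\<And>y. y \<in> Y \<Longrightarrow> \<not> eqon I x y) \<Longrightarrow> 5 \<le> card Y"
    and X: "code I X" "twinfree I X" "\<And>y. y \<in> X \<Longrightarrow> \<not> dich I y v"
    and Y: "code I Y" "twinfree I Y" "\<And>y. y \<in> Y \<Longrightarrow> \<not> dich I y v"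
    and ne: "X \<noteq> {}" and d: "\<And>x y. x \<in> X \<Longrightarrow> y \<in> Y \<Longrightarrow> \<not> eqon I x y"
    and eq: "\<And>p. inbox I p v \<Longrightarrow> cov I X p \<longleftrightarrow> cov I Y p"
  shows "1 \<le> card X \<and> 1 \<le> card Y \<and> (card X = 1 \<longrightarrow> 5 \<le> card Y) \<and> (card Y = 1 \<longrightarrow> 5 \<le> card X)"
proof -
  have fin: "finite X" "finite Y" using X Y code_finite by auto
  obtain x where x: "x \<in> X" using ne by blast
  then obtain p where p: "inbox I p x" "inbox I p v" using meet_point X by blast
  then have "cov I Y p" using eq x unfolding cov_def by blast
  then have ne2: "Y \<noteq> {}" unfolding cov_def by blast
  have *: "5 \<le> card Y'" if c1: "card X' = 1" and a: "code I Y'" "twinfree I Y'" "\<forall>y\<in>Y'. \<not> dich I y v"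
    "\<forall>y\<in>X'. \<not> dich I y v" "\<forall>x\<in>X'. \<forall>y\<in>Y'. \<not> eqon I x y"
    "\<forall>p. inbox I p v \<longrightarrow> cov I X' p = cov I Y' p" for X' Y' :: "('i \<Rightarrow> 'k \<times> bool) set"
  proof -
    obtain x where x: "X' = {x}" using c1 card_1_singletonE by blast
    have "cov I Y' p" if "inbox I p x" for p
      by (rule single_cover[of Y' I v x, OF _ _ _ that]) (use a x in \<open>auto simp: cov_def\<close>)
    then show ?thesis using F[of Y' x] a x by blast
  qed
  have "card X \<ge> 1" "card Y \<ge> 1" using ne ne2 fin by (auto simp: Suc_le_eq card_gt_0_iff)
  moreover have "card X = 1 \<longrightarrow> 5 \<le> card Y" using *[of X Y] X Y d eq by auto
  moreover have "card Y = 1 \<longrightarrow> 5 \<le> card X"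
  proof
    assume 1: "card Y = 1"
    have "\<forall>x\<in>Y. \<forall>y\<in>X. \<not> eqon I x y" using d eqon_sym by blast
    then show "5 \<le> card X" using *[of Y X, OF 1] X Y eq by auto
  qed
  ultimately show ?thesis by blast
qed

text \<open>Induction on the number of coordinates. A word meeting the box with a letter other than
  \<open>x j\<close> forces a word with the complementary letter, and the two fibers cover the same
  points of the box without coordinate \<open>j\<close>. Fewer than five words leave only two plus
  two, and then one fiber of two words covers the smaller box.\<close>

lemma cover_ge_5:
  assumes "finite I" "code I Y" "twinfree I Y" "\<And>p. inbox I p x \<Longrightarrow> cov I Y p"
    "\<And>y. y \<in> Y \<Longrightarrow> \<not> eqon I x y"
  shows "5 \<le> card Y"
  using assms
proof (induction "card I" arbitrary: I Y x rule: less_induct)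
  case less
  note c = less.prems(2) and t = less.prems(3) and covx = less.prems(4) and ne = less.prems(5)
  obtain p where "inbox I p x" using inbox_exists by blast
  then obtain y where y: "y \<in> Y" "inbox I p y" using covx unfolding cov_def by blast
  have yx: "\<not> dich I x y" using inbox_meet \<open>inbox I p x\<close> y(2) by blast
  obtain j where j: "j \<in> I" "y j \<noteq> x j" using ne[OF y(1)] unfolding eqon_def by metis
  have b: "y j \<noteq> opp (x j)" using yx j by (auto simp: dich_def)
  define X where "X = {z \<in> Y. \<not> dich I x z \<and> z j = y j}"
  define Z where "Z = {z \<in> Y. \<not> dich I x z \<and> z j = opp (y j)}"
  let ?J = "I - {j}"
  have J: "finite ?J" "card ?J < card I" using less.prems(1) j card_Diff1_less[of I j] by auto
  have F: "5 \<le> card Y'" if "code ?J Y'" "twinfree ?J Y'" "\<And>p. inbox ?J p x' \<Longrightarrow> cov ?J Y' p"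
    "\<And>y. y \<in> Y' \<Longrightarrow> \<not> eqon ?J x' y" for Y' and x' :: "'a \<Rightarrow> 'b \<times> bool"
    using less.hyps[OF J(2) J(1) that] .
  have eq: "cov ?J X q \<longleftrightarrow> cov ?J Z q" if "inbox ?J q x" for q
    unfolding X_def Z_def by (rule fiber_pair[OF j(1) c covx j(2) b that])
  have fin: "finite Y" using c code_finite by blast
  have cX: "code ?J X" "twinfree ?J X" "code ?J Z" "twinfree ?J Z"
    using code_fiber[OF c, of X j] twinfree_fiber[OF t, of X j] code_fiber[OF c, of Z j]
      twinfree_fiber[OF t, of Z j]
    unfolding X_def Z_def by blast+
  have mX: "\<not> dich ?J z x" if "z \<in> X \<or> z \<in> Z" for z
    using that dich_mono[of ?J x z I] dich_sym[of ?J x z] unfolding X_def Z_def by auto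
  have sizes: "1 \<le> card X \<and> 1 \<le> card Z \<and> (card X = 1 \<longrightarrow> 5 \<le> card Z) \<and> (card Z = 1 \<longrightarrow> 5 \<le> card X)"
  proof (rule pair_sizes_aux[of ?J X x Z, OF F])
    show "X \<noteq> {}" using y yx unfolding X_def by blast
    fix u w assume "u \<in> X" "w \<in> Z"
    then have uw: "u \<in> Y" "w \<in> Y" "w j = opp (u j)" unfolding X_def Z_def by auto
    show "\<not> eqon ?J u w" using twin_opp[OF j(1), of u w] t uw unfolding twinfree_def by blast
  qed (use cX mX eq in auto)
  have sub: "X \<union> Z \<subseteq> Y" "X \<inter> Z = {}" unfolding X_def Z_def by auto
  have finXZ: "finite X" "finite Z" unfolding X_def Z_def using fin by auto
  have cXZ: "card X + card Z \<le> card Y"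
    using card_mono[OF fin sub(1)] card_Un_disjoint[OF finXZ sub(2)] by linarith
  show ?case
  proof (rule ccontr)
    assume n: "\<not> 5 \<le> card Y"
    then have 2: "card X = 2" "card Z = 2" using sizes cXZ by linarith+
    then have "card (X \<union> Z) = 4" using card_Un_disjoint[OF finXZ sub(2)] by linarith
    moreover have "card (X \<union> Z) \<le> card Y" using card_mono[OF fin sub(1)] .
    ultimately have "card (X \<union> Z) = card Y" using n by linarith
    then have YXZ: "Y = X \<union> Z" using card_subset_eq[OF fin sub(1)] by simp
    have cX': "cov ?J X q" if q: "inbox ?J q x" for q
    proof -
      obtain f where f: "holds f (x j)" using holds_exists1 by blast
      have "inbox I (q(j := f)) x" using j q f by (simp add: inbox_remove[OF j(1)] inbox_upd)
      then obtain z where z: "z \<in> Y" "inbox I (q(j := f)) z" using covx unfolding cov_def by blast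
      have "inbox ?J q z" using z(2) by (auto simp: inbox_remove[OF j(1)] inbox_upd)
      then have "cov ?J X q \<or> cov ?J Z q" using z YXZ unfolding cov_def by blast
      then show ?thesis using eq[OF q] by blast
    qed
    \<comment> \<open>If one word of \<open>X\<close> filled the box, the second word of
      \<open>X\<close>, being disjoint from it, could not meet the box.\<close>
    have "\<not> eqon ?J x z" if z: "z \<in> X" for z
    proof
      assume e: "eqon ?J x z"
      obtain z' where z': "z' \<in> X" "z' \<noteq> z" using 2(1) z
        unfolding card_2_iff by blast
      then have "dich ?J z z'" using codeD[OF cX(1) z z'(1)] by simp
      then have "dich ?J x z'" using eqon_dich_cong[OF e] by blast
      then show False using mX[of z'] z' dich_sym[of ?J x z'] by simp
    qed
    then have "5 \<le> card X" using F[OF cX(1,2), of x] cX' by blast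
    then show False using 2 by linarith
  qed
qed

lemma pair_sizes:
  assumes "finite I"
    and "code I X" "twinfree I X" "\<And>y. y \<in> X \<Longrightarrow> \<not> dich I y v"
    and "code I Y" "twinfree I Y" "\<And>y. y \<in> Y \<Longrightarrow> \<not> dich I y v"
    and "X \<noteq> {}" and "\<And>x y. x \<in> X \<Longrightarrow> y \<in> Y \<Longrightarrow> \<not> eqon I x y"
    and "\<And>p. inbox I p v \<Longrightarrow> cov I X p \<longleftrightarrow> cov I Y p"
  shows "1 \<le> card X \<and> 1 \<le> card Y \<and> (card X = 1 \<longrightarrow> 5 \<le> card Y) \<and> (card Y = 1 \<longrightarrow> 5 \<le> card X)"
proof (rule pair_sizes_aux[of I X v Y])
  fix Z :: "('a \<Rightarrow> 'b \<times> bool) set" and x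
  assume "code I Z" "twinfree I Z" "\<And>p. inbox I p x \<Longrightarrow> cov I Z p" "\<And>y. y \<in> Z \<Longrightarrow> \<not> eqon I x y"
  then show "5 \<le> card Z" by (rule cover_ge_5[OF assms(1)])
qed fact+

section \<open>Equivalent codes\<close>

lemma fiber_sizes:
  assumes fin: "finite I" and j: "j \<in> I" and c: "code I Y" and t: "twinfree I Y"
    and covx: "\<And>p. inbox I p x \<Longrightarrow> cov I Y p"
    and y: "y \<in> Y" "\<not> dich I x y" "y j = b" and b: "b \<noteq> x j"
  defines "X \<equiv> {y \<in> Y. \<not> dich I x y \<and> y j = b}" and "Z \<equiv> {y \<in> Y. \<not> dich I x y \<and> y j = opp b}"
  shows "1 \<le> card X \<and> 1 \<le> card Z \<and> (card X = 1 \<longrightarrow> 5 \<le> card Z) \<and> (card Z = 1 \<longrightarrow> 5 \<le> card X)"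
    and "inbox (I - {j}) q x \<Longrightarrow> cov (I - {j}) X q \<longleftrightarrow> cov (I - {j}) Z q"
proof -
  let ?J = "I - {j}"
  have b': "b \<noteq> opp (x j)" using y j by (auto simp: dich_def)
  have eq: "cov ?J X q \<longleftrightarrow> cov ?J Z q" if "inbox ?J q x" for q
    unfolding X_def Z_def by (rule fiber_pair[OF j c covx b b' that])
  then show "inbox ?J q x \<Longrightarrow> cov ?J X q \<longleftrightarrow> cov ?J Z q" .
  have cX: "code ?J X" "twinfree ?J X" "code ?J Z" "twinfree ?J Z"
    using code_fiber[OF c, of X j] twinfree_fiber[OF t, of X j] code_fiber[OF c, of Z j]
      twinfree_fiber[OF t, of Z j]
    unfolding X_def Z_def by blast+
  have mX: "\<not> dich ?J z x" if "z \<in> X \<or> z \<in> Z" for z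
    using that dich_mono[of ?J x z I] dich_sym[of ?J x z] unfolding X_def Z_def by auto
  show "1 \<le> card X \<and> 1 \<le> card Z \<and> (card X = 1 \<longrightarrow> 5 \<le> card Z) \<and> (card Z = 1 \<longrightarrow> 5 \<le> card X)"
  proof (rule pair_sizes[of ?J X x Z])
    show "X \<noteq> {}" using y unfolding X_def by blast
    fix u w assume "u \<in> X" "w \<in> Z"
    then have uw: "u \<in> Y" "w \<in> Y" "w j = opp (u j)" unfolding X_def Z_def by auto
    show "\<not> eqon ?J u w" using twin_opp[OF j, of u w] t uw unfolding twinfree_def by blast
  qed (use cX mX eq fin in auto)
qed

lemma extend_point:
  assumes "j \<in> I" "inbox (I - {j}) q x"
  shows "\<exists>p. inbox I p x \<and> (\<forall>y. inbox I p y \<longrightarrow> inbox (I - {j}) q y)"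
proof -
  obtain f where f: "holds f (x j)" using holds_exists1 by blast
  have "inbox I (q(j := f)) x \<and> (\<forall>y. inbox I (q(j := f)) y \<longrightarrow> inbox (I - {j}) q y)"
    using assms f by (simp add: inbox_remove[OF assms(1)] inbox_upd)
  then show ?thesis by blast
qed

text \<open>If only one pair of complementary letters occurs at \<open>j\<close>, both fibers cover
  the box without \<open>j\<close>. At most one of them contains a copy of \<open>x\<close>, since
  two copies would be twins, so the other has five words. Two pairs already give at least four words
  each.\<close>

lemma cover_no_star:
  assumes fin: "finite I" and j: "j \<in> I" and c: "code I Y" and t: "twinfree I Y"
    and covx: "\<And>p. inbox I p x \<Longrightarrow> cov I Y p"
    and m: "\<And>y. y \<in> Y \<Longrightarrow> \<not> dich I x y" and ns: "\<And>y. y \<in> Y \<Longrightarrow> y j \<noteq> x j"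
  shows "6 \<le> card Y"
proof -
  let ?J = "I - {j}"
  have finY: "finite Y" using c code_finite by blast
  obtain p where "inbox I p x" using inbox_exists by blast
  then obtain y where y: "y \<in> Y" using covx unfolding cov_def by blast
  define F where "F b = {z \<in> Y. \<not> dich I x z \<and> z j = b}" for b
  have sz: "1 \<le> card (F (y j)) \<and> 1 \<le> card (F (opp (y j))) \<and> (card (F (y j)) = 1 \<longrightarrow> 5 \<le> card (F (opp (y j))))
     \<and> (card (F (opp (y j))) = 1 \<longrightarrow> 5 \<le> card (F (y j)))" if y: "y \<in> Y" for y
    unfolding F_def by (rule fiber_sizes(1)[OF fin j c t covx y m[OF y] refl ns[OF y]])
  have finF: "finite (F b)" for b unfolding F_def using finY by simp
  have dF: "F b \<inter> F b' = {}" if "b \<noteq> b'" for b b' using that unfolding F_def by auto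
  have sF: "F b \<subseteq> Y" for b unfolding F_def by auto
  let ?X = "F (y j)" and ?Z = "F (opp (y j))"
  have cXZ: "card (?X \<union> ?Z) = card ?X + card ?Z" by (rule card_Un_disjoint[OF finF finF dF]) simp
  show ?thesis
  proof (cases "Y = ?X \<union> ?Z")
    case True
    have eq: "cov ?J ?X q \<longleftrightarrow> cov ?J ?Z q" if "inbox ?J q x" for q
      unfolding F_def by (rule fiber_sizes(2)[OF fin j c t covx y m[OF y] refl ns[OF y] that])
    have both: "cov ?J ?X q \<and> cov ?J ?Z q" if q: "inbox ?J q x" for q
    proof -
      obtain p where p: "inbox I p x" "\<And>y. inbox I p y \<Longrightarrow> inbox ?J q y"
        using extend_point[OF j q] by blast
      obtain z where "z \<in> Y" "inbox I p z" using covx[OF p(1)] unfolding cov_def by blast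
      then have "cov ?J ?X q \<or> cov ?J ?Z q" using p(2) True unfolding cov_def by blast
      then show ?thesis using eq[OF q] by blast
    qed
    have cF: "code ?J (F b)" "twinfree ?J (F b)" for b
      using code_fiber[OF c sF] twinfree_fiber[OF t sF] unfolding F_def by blast+
    have 5: "5 \<le> card (F b)" if "\<And>q. inbox ?J q x \<Longrightarrow> cov ?J (F b) q" "\<And>z. z \<in> F b \<Longrightarrow> \<not> eqon ?J x z" for b
      using cover_ge_5[OF _ cF that] fin by simp
    have "(\<forall>z\<in>?X. \<not> eqon ?J x z) \<or> (\<forall>z\<in>?Z. \<not> eqon ?J x z)"
    proof (rule ccontr)
      assume "\<not> ?thesis"
      then obtain u w where uw: "u \<in> ?X" "w \<in> ?Z" "eqon ?J x u" "eqon ?J x w" by blast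
      then have "eqon ?J u w" unfolding eqon_def by simp
      moreover have "u \<in> Y" "w \<in> Y" "w j = opp (u j)" using uw unfolding F_def by auto
      ultimately show False using twin_opp[OF j, of u w] t unfolding twinfree_def by blast
    qed
    then have "5 \<le> card ?X \<or> 5 \<le> card ?Z" using 5 both by blast
    then have "6 \<le> card ?X + card ?Z" using sz[OF y] by linarith
    then show ?thesis using cXZ True by simp
  next
    case False
    then obtain u where u: "u \<in> Y" "u \<notin> ?X \<union> ?Z" using sF by blast
    then have uj: "u j \<noteq> y j" "u j \<noteq> opp (y j)" "opp (u j) \<noteq> y j" "opp (u j) \<noteq> opp (y j)"
      using m opp_swap[of "u j" "y j"] unfolding F_def by auto
    let ?X' = "F (u j)" and ?Z' = "F (opp (u j))"
    have c': "card (?X' \<union> ?Z') = card ?X' + card ?Z'" by (rule card_Un_disjoint[OF finF finF dF]) simp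
    have "card ((?X \<union> ?Z) \<union> (?X' \<union> ?Z')) = card (?X \<union> ?Z) + card (?X' \<union> ?Z')"
      by (rule card_Un_disjoint) (use finF dF uj in \<open>auto simp: F_def\<close>)
    moreover have "card ((?X \<union> ?Z) \<union> (?X' \<union> ?Z')) \<le> card Y" by (rule card_mono[OF finY]) (use sF in auto)
    ultimately show ?thesis using cXZ c' sz[OF y] sz[OF u(1)] by linarith
  qed
qed

text \<open>Each word contains exactly one of the points whose truth values do not depend on the key.\<close>

lemma card_code:
  assumes "code I V"
  shows "card V = card {S. S \<subseteq> I \<and> cov I V (\<lambda>i k. i \<in> S)}"
proof -
  let ?f = "\<lambda>v. {i \<in> I. snd (v i)}"
  have "inj_on ?f V"
  proof (rule inj_onI, rule ccontr)
    fix v w assume vw: "v \<in> V" "w \<in> V" "?f v = ?f w" "v \<noteq> w"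
    then obtain i where i: "i \<in> I" "w i = opp (v i)" using assms unfolding code_def dich_def by blast
    then have "snd (w i) = snd (v i)" using vw(3) by blast
    then show False using i by (simp add: opp_def)
  qed
  moreover have "?f ` V = {S. S \<subseteq> I \<and> cov I V (\<lambda>i k. i \<in> S)}"
    unfolding cov_def inbox_def holds_def by (auto simp: image_iff)
  ultimately show ?thesis using card_image[of ?f V] by simp
qed

lemma card_eq_of_cov: "code I V \<Longrightarrow> code I W \<Longrightarrow> (\<And>p. cov I V p \<longleftrightarrow> cov I W p) \<Longrightarrow> card V = card W"
  by (simp add: card_code)

text \<open>Each word accounts for one sample point of \<open>card_code\<close>. On the sample
  points the hypotheses say that A minus D equals C minus B and D minus A equals B minus C.\<close>

lemma card_exchange:
  fixes A B C D :: "('i \<Rightarrow> 'k \<times> bool) set"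
  assumes "finite I" "code I A" "code I B" "code I C" "code I D"
    and 1: "\<And>p. cov I A p \<and> \<not> cov I D p \<longleftrightarrow> cov I C p \<and> \<not> cov I B p"
    and 2: "\<And>p. cov I D p \<and> \<not> cov I A p \<longleftrightarrow> cov I B p \<and> \<not> cov I C p"
  shows "card A + card B = card C + card D"
proof -
  define S where "S V = {S. S \<subseteq> I \<and> cov I V (\<lambda>i k. i \<in> S)}" for V :: "('i \<Rightarrow> 'k \<times> bool) set"
  have fin: "finite (S V)" for V unfolding S_def using assms(1) by simp
  have "S A - S D = S C - S B" "S D - S A = S B - S C" unfolding S_def using 1 2 by auto
  then have "card (S A) + card (S B) = card (S C) + card (S D)"
    using card_Int_Diff[OF fin, of A "S D"] card_Int_Diff[OF fin, of D "S A"]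
      card_Int_Diff[OF fin, of B "S C"] card_Int_Diff[OF fin, of C "S B"]
    by (simp add: Int_commute)
  then show ?thesis
    using card_code[OF assms(2)] card_code[OF assms(3)] card_code[OF assms(4)] card_code[OF assms(5)]
    unfolding S_def by linarith
qed

definition fib :: "('i \<Rightarrow> 'k \<times> bool) set \<Rightarrow> 'i \<Rightarrow> 'k \<times> bool \<Rightarrow> ('i \<Rightarrow> 'k \<times> bool) set" where
  "fib V i l = {v \<in> V. v i = l}"

text \<open>Not symmetric in \<open>V\<close> and \<open>W\<close>: meeting an independent letter of
  \<open>W\<close> yields lower bounds for the fibers of \<open>V\<close>.\<close>

definition hit :: "'i set \<Rightarrow> ('i \<Rightarrow> 'k \<times> bool) set \<Rightarrow> ('i \<Rightarrow> 'k \<times> bool) set \<Rightarrow> 'i \<Rightarrow> 'k \<times> bool \<Rightarrow> bool" where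
  "hit I V W i l \<longleftrightarrow> (\<exists>v\<in>V. \<exists>w\<in>W. \<not> dich I v w \<and> v i = l \<and> fst (w i) \<noteq> fst l)"

locale equiv_codes =
  fixes I :: "'i set" and V W :: "('i \<Rightarrow> 'k \<times> bool) set"
  assumes finI: "finite I"
    and codeV: "code I V" and tfV: "twinfree I V"
    and codeW: "code I W" and tfW: "twinfree I W"
    and disj: "\<And>v w. v \<in> V \<Longrightarrow> w \<in> W \<Longrightarrow> \<not> eqon I v w"
    and cov_eq: "\<And>p. cov I V p \<longleftrightarrow> cov I W p"
begin

lemma swap: "equiv_codes I W V"
proof
  fix w v assume "w \<in> W" "v \<in> V"
  then show "\<not> eqon I w v" using disj eqon_sym[of I w v] by blast
qed (simp_all add: finI codeV tfV codeW tfW cov_eq)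

lemma finV: "finite V" and finW: "finite W"
  using codeV codeW code_finite by auto

lemma finite_fib [simp]: "finite (fib V i l)" "finite (fib W i l)"
  unfolding fib_def using finV finW by auto

lemma code_fib: "code (I - {i}) (fib V i l)" "twinfree (I - {i}) (fib V i l)"
    "code (I - {i}) (fib W i l)" "twinfree (I - {i}) (fib W i l)"
  by (rule code_fiber[OF codeV] twinfree_fiber[OF tfV] code_fiber[OF codeW] twinfree_fiber[OF tfW],
      (auto simp: fib_def)[2])+

lemma card_V_W: "card V = card W"
  using card_eq_of_cov[OF codeV codeW cov_eq] .

text \<open>On the line through \<open>q\<close> in direction \<open>i\<close>, the part covered by
  \<open>V\<close> is exactly the half \<open>l\<close>. The same half is covered by
  \<open>W\<close>, and a letter contained in it can only be \<open>l\<close>.\<close>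

lemma exchange_imp:
  assumes i: "i \<in> I" and a: "cov (I - {i}) (fib V i l) q" and n: "\<not> cov (I - {i}) (fib V i (opp l)) q"
  shows "cov (I - {i}) (fib W i l) q \<and> \<not> cov (I - {i}) (fib W i (opp l)) q"
proof -
  obtain v where v: "v \<in> V" "v i = l" "inbox (I - {i}) q v" using a unfolding cov_def fib_def by blast
  have V: "cov I V (q(i := f)) \<longleftrightarrow> holds f l" for f
  proof
    assume "holds f l"
    then have "inbox I (q(i := f)) v" using v i by (simp add: inbox_remove[OF i] inbox_upd)
    then show "cov I V (q(i := f))" using v unfolding cov_def by blast
  next
    assume "cov I V (q(i := f))"
    then obtain u where u: "u \<in> V" "holds f (u i)" "inbox (I - {i}) q u"
      unfolding cov_def by (auto simp: inbox_remove[OF i] inbox_upd)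
    show "holds f l"
    proof (cases "u = v")
      case False
      then have "dich I v u" using codeD[OF codeV v(1) u(1)] by simp
      then have "u i = opp (v i)" using dich_remove[of I v u i] dich_disjoint[OF _ v(3) u(3)] by blast
      then have "cov (I - {i}) (fib V i (opp l)) q" using u v unfolding cov_def fib_def by auto
      then show ?thesis using n by blast
    qed (use u v in simp)
  qed
  have W: "cov I W (q(i := f)) \<longleftrightarrow> holds f l" for f using V cov_eq by simp
  have Wc: "cov I W (q(i := f))" if "w \<in> W" "inbox (I - {i}) q w" "holds f (w i)" for w f
    using that unfolding cov_def by (auto simp: inbox_remove[OF i] inbox_upd)
  obtain f where f: "holds f l" using holds_exists1 by blast
  then obtain w where w: "w \<in> W" "inbox (I - {i}) q w"
    using W[of f] unfolding cov_def by (auto simp: inbox_remove[OF i] inbox_upd)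
  have "w i = l"
  proof (rule ccontr)
    assume "w i \<noteq> l"
    then obtain g where "holds g (w i)" "holds g (opp l)" using holds_exists2[of "w i" "opp l"] by auto
    then show False using Wc[OF w] W by simp
  qed
  then have "cov (I - {i}) (fib W i l) q" using w unfolding cov_def fib_def by blast
  moreover have "\<not> cov (I - {i}) (fib W i (opp l)) q"
  proof
    assume "cov (I - {i}) (fib W i (opp l)) q"
    then obtain u where u: "u \<in> W" "u i = opp l" "inbox (I - {i}) q u" unfolding cov_def fib_def by blast
    obtain g where "holds g (opp l)" using holds_exists1 by blast
    then show False using Wc[OF u(1,3)] u(2) W[of g] by simp
  qed
  ultimately show ?thesis by blast
qed

lemma exchange:
  assumes i: "i \<in> I"
  shows "cov (I - {i}) (fib V i l) q \<and> \<not> cov (I - {i}) (fib V i (opp l)) q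
    \<longleftrightarrow> cov (I - {i}) (fib W i l) q \<and> \<not> cov (I - {i}) (fib W i (opp l)) q"
  using exchange_imp[OF i, of l q] equiv_codes.exchange_imp[OF swap i, of l q] by blast

lemma card_fib:
  assumes i: "i \<in> I"
  shows "card (fib V i l) + card (fib W i (opp l)) = card (fib W i l) + card (fib V i (opp l))"
proof (rule card_exchange[of "I - {i}"])
  fix p
  show "cov (I - {i}) (fib V i (opp l)) p \<and> \<not> cov (I - {i}) (fib V i l) p
    \<longleftrightarrow> cov (I - {i}) (fib W i (opp l)) p \<and> \<not> cov (I - {i}) (fib W i l) p"
    using exchange[OF i, of "opp l" p] by simp
qed (use exchange[OF i] code_fib finI in auto)

text \<open>Without independent letters of \<open>W\<close> meeting the fiber, a point over
  \<open>q\<close> satisfying \<open>l\<close> can only lie in a word of \<open>W\<close> with the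
  letter \<open>l\<close>, because \<open>opp l\<close> fails there.\<close>

lemma not_hit_cov:
  assumes i: "i \<in> I" and "\<not> hit I V W i l" and "cov (I - {i}) (fib V i l) q"
  shows "cov (I - {i}) (fib W i l) q"
proof -
  obtain v where v: "v \<in> V" "v i = l" "inbox (I - {i}) q v" using assms unfolding cov_def fib_def by blast
  obtain f where f: "holds f l" using holds_exists1 by blast
  have p: "inbox I (q(i := f)) v" using v f by (simp add: inbox_remove[OF i] inbox_upd)
  then obtain w where w: "w \<in> W" "inbox I (q(i := f)) w" using v cov_eq unfolding cov_def by blast
  then have "\<not> dich I v w" using inbox_meet p by blast
  then have "fst (w i) = fst l" using assms v w unfolding hit_def by blast
  moreover have "holds f (w i)" "inbox (I - {i}) q w" using w by (auto simp: inbox_remove[OF i] inbox_upd)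
  ultimately have "w i = l" using f same_key[of "w i" l] by auto
  then show ?thesis using w \<open>inbox (I - {i}) q w\<close> unfolding cov_def fib_def by blast
qed

lemma hit_other: "hit I V W i l \<Longrightarrow> \<exists>m. fst m \<noteq> fst l \<and> hit I W V i m"
  unfolding hit_def using dich_sym by metis

lemma cov_V_box: "w \<in> W \<Longrightarrow> inbox I p w \<Longrightarrow> cov I V p" "v \<in> V \<Longrightarrow> inbox I p v \<Longrightarrow> cov I W p"
  using cov_eq unfolding cov_def by blast+

text \<open>The box of the word \<open>w\<close> that is met is covered by \<open>V\<close>, and its
  letter at \<open>i\<close> is independent of \<open>l\<close>. So \<open>fiber_sizes\<close>
  applies to those words of the two fibers that meet \<open>w\<close>.\<close>

lemma hit_sizes:
  assumes i: "i \<in> I" and h: "hit I V W i l"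
  shows "1 \<le> card (fib V i l)" "1 \<le> card (fib V i (opp l))"
    "card (fib V i l) = 1 \<Longrightarrow> 5 \<le> card (fib V i (opp l))"
    "card (fib V i (opp l)) = 1 \<Longrightarrow> 5 \<le> card (fib V i l)"
    "hit I V W i (opp l)"
proof -
  obtain v w where vw: "v \<in> V" "w \<in> W" "\<not> dich I v w" "v i = l" "fst (w i) \<noteq> fst l"
    using h unfolding hit_def by blast
  define X where "X = {y \<in> V. \<not> dich I w y \<and> y i = l}"
  define Z where "Z = {y \<in> V. \<not> dich I w y \<and> y i = opp l}"
  have s: "1 \<le> card X \<and> 1 \<le> card Z \<and> (card X = 1 \<longrightarrow> 5 \<le> card Z) \<and> (card Z = 1 \<longrightarrow> 5 \<le> card X)"
    unfolding X_def Z_def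
    by (rule fiber_sizes(1)[OF finI i codeV tfV _ vw(1)]) (use vw cov_V_box dich_sym[of I w v] in auto)
  have "card X \<le> card (fib V i l)" "card Z \<le> card (fib V i (opp l))"
    by (auto intro!: card_mono simp: X_def Z_def fib_def finV)
  then show "1 \<le> card (fib V i l)" "1 \<le> card (fib V i (opp l))"
    "card (fib V i l) = 1 \<Longrightarrow> 5 \<le> card (fib V i (opp l))"
    "card (fib V i (opp l)) = 1 \<Longrightarrow> 5 \<le> card (fib V i l)" using s by auto
  have "Z \<noteq> {}" using s by auto
  then obtain z where "z \<in> V" "\<not> dich I z w" "z i = opp l" using dich_sym[of I w] unfolding Z_def by auto
  then show "hit I V W i (opp l)" using vw unfolding hit_def by auto
qed

text \<open>Inside the box of \<open>w\<close>, the word \<open>a\<close> is matched by the words of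
  the complementary fiber meeting \<open>w\<close>, of which there are at least five. A fiber of at
  most five words consists of just these.\<close>

lemma hit_single:
  assumes i: "i \<in> I" and h: "hit I V W i l" and s: "fib V i l = {a}"
  shows "\<And>q. inbox (I - {i}) q a \<Longrightarrow> cov (I - {i}) (fib V i (opp l)) q"
    and "\<And>d. card (fib V i (opp l)) \<le> 5 \<Longrightarrow> d \<in> fib V i (opp l) \<Longrightarrow> \<not> dich (I - {i}) a d"
proof -
  obtain v w where vw: "v \<in> V" "w \<in> W" "\<not> dich I v w" "v i = l" "fst (w i) \<noteq> fst l"
    using h unfolding hit_def by blast
  have va: "v = a" using vw s unfolding fib_def by blast
  let ?J = "I - {i}"
  define X where "X = {y \<in> V. \<not> dich I w y \<and> y i = l}"
  define Z where "Z = {y \<in> V. \<not> dich I w y \<and> y i = opp l}"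
  have wv: "\<not> dich I w v" "l \<noteq> w i" "\<And>p. inbox I p w \<Longrightarrow> cov I V p" using vw cov_V_box dich_sym[of I w v] by auto
  have Xa: "X = {a}" using s vw va wv unfolding X_def fib_def by blast
  have sz: "card X = 1 \<longrightarrow> 5 \<le> card Z"
    unfolding X_def Z_def using fiber_sizes(1)[OF finI i codeV tfV wv(3) vw(1) wv(1) vw(4) wv(2)] by blast
  have eq: "cov ?J X q \<longleftrightarrow> cov ?J Z q" if "inbox ?J q w" for q
    unfolding X_def Z_def using fiber_sizes(2)[OF finI i codeV tfV wv(3) vw(1) wv(1) vw(4) wv(2) that] .
  have Zw: "\<not> dich ?J z w" if "z \<in> Z" for z
    using that dich_mono[of ?J w z I] dich_sym[of ?J w z] unfolding Z_def by auto
  have aw: "\<not> dich ?J a w" using va vw(3) dich_mono[of ?J a w I] by auto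
  have eqa: "inbox ?J q a \<longleftrightarrow> cov ?J Z q" if "inbox ?J q w" for q
    using eq[OF that] Xa unfolding cov_def by blast
  have ZV: "Z \<subseteq> fib V i (opp l)" unfolding Z_def fib_def by blast
  show "cov ?J (fib V i (opp l)) q" if "inbox ?J q a" for q
    using single_cover[of Z ?J w a, OF _ aw eqa that] Zw ZV unfolding cov_def by blast
  show "\<not> dich ?J a d" if "card (fib V i (opp l)) \<le> 5" "d \<in> fib V i (opp l)" for d
  proof -
    have "5 \<le> card Z" using sz Xa by simp
    then have "Z = fib V i (opp l)" using card_subset_eq[OF finite_fib(1) ZV] card_mono[OF finite_fib(1) ZV] that(1)
      by linarith
    then have d: "d \<in> Z" using that by simp
    then obtain p where "inbox ?J p d" "inbox ?J p w" using meet_point Zw by blast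
    then show ?thesis using eqa d inbox_meet[of ?J p a d] unfolding cov_def by blast
  qed
qed

end

section \<open>The letters occurring in one coordinate\<close>

context equiv_codes
begin

text \<open>As \<open>l\<close> is not hit from the side of \<open>W\<close>, the word
  \<open>c\<close> is covered on the remaining coordinates by words of \<open>V\<close> with the
  same letter. None of them coincides with \<open>c\<close> there, because \<open>V\<close> and
  \<open>W\<close> share no word.\<close>

lemma fib_dominated_ge_5:
  assumes i: "i \<in> I" and c: "c \<in> fib W i l" and h: "\<not> hit I W V i l"
  shows "5 \<le> card {a \<in> fib V i l. \<not> dich (I - {i}) c a}"
    and "inbox (I - {i}) q c \<Longrightarrow> cov (I - {i}) (fib V i l) q"
proof -
  let ?A = "{a \<in> fib V i l. \<not> dich (I - {i}) c a}"
  show cv: "cov (I - {i}) (fib V i l) q" if "inbox (I - {i}) q c" for q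
    using equiv_codes.not_hit_cov[OF swap i h] c that unfolding cov_def by blast
  show "5 \<le> card ?A"
  proof (rule cover_ge_5[of "I - {i}" ?A c])
    fix y assume y: "y \<in> ?A"
    show "\<not> eqon (I - {i}) c y"
      using eqon_insert[of I i y c] eqon_sym[of "I - {i}" c y] disj[of y c] y c unfolding fib_def by auto
  next
    fix p assume p: "inbox (I - {i}) p c"
    then obtain a where "a \<in> fib V i l" "inbox (I - {i}) p a" using cv unfolding cov_def by blast
    then show "cov (I - {i}) ?A p" using inbox_meet[OF p] unfolding cov_def by blast
  qed (use finI code_subset[OF code_fib(1)[of i l]] twinfree_subset[OF code_fib(2)[of i l]] in auto)
qed

text \<open>With only five words in the fiber, all of them meet both \<open>c\<close> and the word
  \<open>d\<close> of the complementary fiber. Since \<open>c\<close> and \<open>d\<close> are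
  disjoint, they have complementary letters at some \<open>j\<close>, and a word meeting
  \<open>d\<close> cannot carry \<open>c j\<close>. Then \<open>cover_no_star\<close> asks for a
  sixth word.\<close>

lemma onesided_empty_ge_6:
  assumes i: "i \<in> I" and h: "hit I V W i l" "\<not> hit I W V i l"
    and C: "fib W i l \<noteq> {}" and B: "fib W i (opp l) = {}"
  shows "6 \<le> card (fib V i l)"
proof (rule ccontr)
  assume n: "\<not> 6 \<le> card (fib V i l)"
  let ?J = "I - {i}" and ?A = "fib V i l" and ?D = "fib V i (opp l)"
  have noB: "\<not> cov ?J (fib W i (opp l)) q" for q using B unfolding cov_def by simp
  have DA: "cov ?J ?A q" if "cov ?J ?D q" for q
    using exchange[OF i, of "opp l" q] noB that by auto
  have DC: "\<not> cov ?J ?D q" if "cov ?J (fib W i l) q" for q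
    using exchange[OF i, of l q] noB that by auto
  obtain c where c: "c \<in> fib W i l" using C by blast
  have "?D \<noteq> {}" using hit_sizes(2)[OF i h(1)] by auto
  then obtain d where d: "d \<in> ?D" by blast
  have cv: "cov ?J ?A q" if "inbox ?J q c" for q
    using fib_dominated_ge_5(2)[OF i c h(2) that] .
  have Ac: "{a \<in> ?A. \<not> dich ?J c a} = ?A"
    using fib_dominated_ge_5(1)[OF i c h(2)] n card_mono[of ?A "{a \<in> ?A. \<not> dich ?J c a}"]
    by (intro card_subset_eq) auto
  have "5 \<le> card {a \<in> ?A. \<not> dich ?J d a}"
  proof (rule cover_ge_5[of ?J _ d])
    fix y assume "y \<in> {a \<in> ?A. \<not> dich ?J d a}"
    then have y: "y \<in> V" "y i = l" "d \<in> V" "d i = opp l" using d unfolding fib_def by auto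
    show "\<not> eqon ?J d y"
      using twin_opp[OF i, of d y] tfV y unfolding twinfree_def by auto
  next
    fix p assume p: "inbox ?J p d"
    then have "cov ?J ?A p" using DA d unfolding cov_def by blast
    then obtain a where "a \<in> ?A" "inbox ?J p a" unfolding cov_def by blast
    then show "cov ?J {a \<in> ?A. \<not> dich ?J d a} p" using inbox_meet[OF p] unfolding cov_def by blast
  qed (use finI code_subset[OF code_fib(1)[of i l]] twinfree_subset[OF code_fib(2)[of i l]] in auto)
  then have Ad: "{a \<in> ?A. \<not> dich ?J d a} = ?A"
    using n card_mono[of ?A "{a \<in> ?A. \<not> dich ?J d a}"] by (intro card_subset_eq) auto
  have "dich ?J c d"
  proof (rule ccontr)
    assume "\<not> dich ?J c d"
    then obtain p where "inbox ?J p c" "inbox ?J p d" using meet_point by blast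
    then show False using DC c d unfolding cov_def by blast
  qed
  then obtain j where j: "j \<in> ?J" "d j = opp (c j)" unfolding dich_def by blast
  have "6 \<le> card ?A"
  proof (rule cover_no_star[of ?J j ?A c])
    show "y j \<noteq> c j" if y: "y \<in> ?A" for y
    proof -
      have "\<not> dich ?J d y" using Ad y by blast
      then have "y j \<noteq> opp (d j)" using j unfolding dich_def by blast
      then show ?thesis using j by simp
    qed
  qed (use finI j code_fib cv Ac in auto)
  then show False using n by simp
qed

text \<open>By \<open>card_fib\<close> the mixed sum is unchanged when \<open>V\<close> and
  \<open>W\<close>, or \<open>l\<close> and \<open>opp l\<close>, are exchanged.\<close>

lemma onesided_ge_6:
  assumes i: "i \<in> I" and h: "hit I V W i l" "\<not> hit I W V i l"
    and ne: "fib W i l \<noteq> {} \<or> fib W i (opp l) \<noteq> {}"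
  shows "6 \<le> card (fib V i l) + card (fib W i (opp l))"
proof -
  have h': "hit I V W i (opp l)" using hit_sizes(5)[OF i h(1)] .
  have hn: "\<not> hit I W V i (opp l)" using equiv_codes.hit_sizes(5)[OF swap i, of "opp l"] h(2) by auto
  have ge5: "5 \<le> card (fib V i m)" if "c \<in> fib W i m" "\<not> hit I W V i m" for c m
    using fib_dominated_ge_5(1)[OF i that] card_mono[of "fib V i m" "{a \<in> fib V i m. \<not> dich (I - {i}) c a}"]
    by auto
  consider "fib W i l \<noteq> {}" "fib W i (opp l) = {}" | "fib W i l = {}" "fib W i (opp l) \<noteq> {}"
    | "fib W i l \<noteq> {}" "fib W i (opp l) \<noteq> {}" using ne by blast
  then show ?thesis
  proof cases
    case 1 then show ?thesis using onesided_empty_ge_6[OF i h] by simp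
  next
    case 2 then show ?thesis using onesided_empty_ge_6[OF i h' hn] card_fib[OF i, of l] by simp
  next
    case 3
    then have "5 \<le> card (fib V i l)" using ge5 h(2) by blast
    moreover have "1 \<le> card (fib W i (opp l))" using 3 by (simp add: Suc_le_eq card_gt_0_iff)
    ultimately show ?thesis by simp
  qed
qed

text \<open>The exceptional size pattern (1,5,2,2): the words with letter \<open>opp l\<close> stick out of the box of \<open>a\<close>
  (resp. \<open>c\<close>) in directions in which they cannot be matched.\<close>

lemma exceptional_impossible:
  assumes i: "i \<in> I" and h: "hit I V W i l" "hit I W V i l"
    and a: "fib V i l = {a}" and c: "fib W i l = {c}"
    and D: "card (fib V i (opp l)) \<le> 5" and B: "card (fib W i (opp l)) \<le> 5"
    and few: "card {w \<in> W. fst (w i) \<noteq> fst l} \<le> 4"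
  shows False
proof -
  let ?J = "I - {i}"
  note swp = equiv_codes.hit_single[OF swap i h(2) c]
  have aV: "a \<in> V" "a i = l" and cW: "c \<in> W" "c i = l" using a c unfolding fib_def by auto
  have A: "cov ?J (fib V i l) q \<longleftrightarrow> inbox ?J q a" for q using a unfolding cov_def by simp
  have C: "cov ?J (fib W i l) q \<longleftrightarrow> inbox ?J q c" for q using c unfolding cov_def by simp
  have ex: "cov ?J (fib V i (opp l)) q \<and> \<not> inbox ?J q a \<longleftrightarrow> cov ?J (fib W i (opp l)) q \<and> \<not> inbox ?J q c" for q
    using exchange[OF i, of "opp l" q] A C by simp
  \<comment> \<open>If \<open>a\<close> missed \<open>c\<close>, the words of \<open>W\<close>
    meeting \<open>a\<close> would carry neither \<open>l\<close> nor \<open>opp l\<close> at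
    \<open>i\<close>. At least five are needed, and only four such words are available.\<close>
  have "\<not> dich I a c"
  proof
    assume ac: "dich I a c"
    let ?X = "{w \<in> W. \<not> dich I a w}"
    have "5 \<le> card ?X"
    proof (rule cover_ge_5[of I ?X a])
      fix p assume p: "inbox I p a"
      then obtain w where "w \<in> W" "inbox I p w" using cov_V_box(2)[OF aV(1)] unfolding cov_def by blast
      then show "cov I ?X p" using inbox_meet[OF p] unfolding cov_def by blast
    qed (use finI code_subset[OF codeW] twinfree_subset[OF tfW] disj[OF aV(1)] in auto)
    moreover have "?X \<subseteq> {w \<in> W. fst (w i) \<noteq> fst l}"
    proof
      fix w assume w: "w \<in> ?X"
      have "w i \<noteq> opp l" using w i aV unfolding dich_def by auto
      moreover have "w i \<noteq> l"
      proof
        assume "w i = l"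
        then have "w \<in> fib W i l" using w unfolding fib_def by simp
        then show False using w ac c by simp
      qed
      ultimately show "w \<in> {w \<in> W. fst (w i) \<noteq> fst l}" using w same_key[of "w i" l] by auto
    qed
    then have "card ?X \<le> 4" using few card_mono[of "{w \<in> W. fst (w i) \<noteq> fst l}" ?X] finW by auto
    ultimately show False by simp
  qed
  then have "\<not> dich ?J a c" using dich_mono[of ?J a c I] by blast
  then obtain q0 where q0: "inbox ?J q0 a" "inbox ?J q0 c" using meet_point by blast
  have "\<not> eqon I a c" using disj[OF aV(1) cW(1)] .
  then have "\<not> eqon ?J a c" using eqon_insert[of I i a c] aV cW by auto
  then obtain j1 where j1: "j1 \<in> ?J" "c j1 \<noteq> a j1" unfolding eqon_def by blast
  obtain d where d: "d \<in> fib V i (opp l)" "inbox ?J q0 d"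
    using hit_single(1)[OF i h(1) a q0(1)] unfolding cov_def by blast
  have dV: "d \<in> V" "d i = opp (a i)" using d aV unfolding fib_def by auto
  \<comment> \<open>A deviation of \<open>d\<close> from \<open>a\<close> here would give a point of
    \<open>d\<close> and \<open>c\<close> outside \<open>a\<close>, which \<open>ex\<close>
    forbids.\<close>
  have dH: "d j = a j" if j: "j \<in> ?J" "c j \<noteq> a j" for j
  proof (rule ccontr)
    assume dj: "d j \<noteq> a j"
    have "\<not> dich ?J d c" using inbox_meet d q0 by blast
    then obtain r where "inbox ?J r d" "inbox ?J r c" "\<not> inbox ?J r a"
      using meet_point_avoid[of ?J d c j a] j dj by auto
    then show False using ex[of r] d unfolding cov_def by blast
  qed
  have "\<not> eqon ?J a d" using twin_opp[OF i, of a d] tfV aV dV unfolding twinfree_def by blast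
  then obtain j0 where j0: "j0 \<in> ?J" "d j0 \<noteq> a j0" unfolding eqon_def by blast
  then have c0: "c j0 = a j0" using dH by blast
  have j01: "j0 \<noteq> j1" using c0 j1 by blast
  obtain f1 where f1: "holds f1 (a j1)" "\<not> holds f1 (c j1)"
    using holds_exists[of "a j1" "a j1" "c j1"] j1 by auto
  obtain f0 where f0: "holds f0 (d j0)" "\<not> holds f0 (a j0)"
    using holds_exists[of "d j0" "d j0" "a j0"] j0 by auto
  \<comment> \<open>Changing \<open>j1\<close> leaves \<open>c\<close> but respects
    \<open>a\<close>; changing \<open>j0\<close> leaves \<open>a\<close> but respects
    \<open>d\<close>. By \<open>ex\<close> the point then lies in a word \<open>b\<close> of
    \<open>W\<close>.\<close>
  let ?q = "q0(j1 := f1, j0 := f0)"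
  have qd: "inbox ?J ?q d" using d f0 f1 dH[OF j1] unfolding inbox_def by auto
  have qa: "\<not> inbox ?J ?q a" using f0 j0 unfolding inbox_def by auto
  obtain b where b: "b \<in> fib W i (opp l)" "inbox ?J ?q b"
    using ex[of ?q] qd qa d unfolding cov_def by blast
  have "\<not> dich ?J c b" using swp(2)[OF B b(1)] .
  then have "b j0 \<noteq> opp (c j0)" using j0 unfolding dich_def by blast
  then have "b j0 \<noteq> opp (a j0)" using c0 by simp
  then obtain f where f: "holds f (a j0)" "holds f (b j0)" using holds_exists2 by metis
  \<comment> \<open>Since \<open>b\<close> meets \<open>c\<close>, coordinate \<open>j0\<close> can
    be moved back into \<open>a\<close> without leaving \<open>b\<close>. The result lies in
    \<open>b\<close> and \<open>a\<close> but outside \<open>c\<close>, against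
    \<open>ex\<close>.\<close>
  let ?r = "?q(j0 := f)"
  have "\<forall>j\<in>?J. holds (?q j) (b j)" using b(2) unfolding inbox_def .
  then have "inbox ?J ?r b" using f(2) unfolding inbox_def by (metis fun_upd_apply)
  moreover have ra: "inbox ?J ?r a" using q0 f f1 unfolding inbox_def by auto
  moreover have "\<not> inbox ?J ?r c" using f1 j1 j01 unfolding inbox_def by (auto intro!: bexI[of _ j1])
  ultimately show False using ex[of ?r] b unfolding cov_def by blast
qed

end

section \<open>The letters of a smallest counterexample\<close>

locale small_equiv_codes = equiv_codes I V W for I :: "'i set" and V W :: "('i \<Rightarrow> 'k \<times> bool) set" +
  assumes nonempty: "V \<noteq> {}" and small: "card V \<le> 10"
    and IH: "\<And>i X Y. i \<in> I \<Longrightarrow> equiv_codes (I - {i}) X (Y :: ('i \<Rightarrow> 'k \<times> bool) set) \<Longrightarrow> X \<noteq> {} \<Longrightarrow> 11 \<le> card X"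
begin

lemma swap_small: "small_equiv_codes I W V"
proof -
  interpret s: equiv_codes I W V by (rule swap)
  show ?thesis
  proof
    show "W \<noteq> {}" using nonempty card_V_W finV by auto
    show "card W \<le> 10" using small card_V_W by simp
  qed (rule IH)
qed

lemma card_fib_le: "card (fib V i l) \<le> 10"
  using card_mono[of V "fib V i l"] finV small unfolding fib_def by auto

lemma no_equiv_V_W:
  assumes i: "i \<in> I" and ne: "fib V i l \<noteq> {}"
  shows "\<not> (\<forall>q. cov (I - {i}) (fib V i l) q \<longleftrightarrow> cov (I - {i}) (fib W i l) q)"
proof
  assume a: "\<forall>q. cov (I - {i}) (fib V i l) q \<longleftrightarrow> cov (I - {i}) (fib W i l) q"
  have "equiv_codes (I - {i}) (fib V i l) (fib W i l)"
  proof
    fix v w assume "v \<in> fib V i l" "w \<in> fib W i l"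
    then show "\<not> eqon (I - {i}) v w" using eqon_insert[of I i v w] disj[of v w] unfolding fib_def by auto
  qed (use finI code_fib a in auto)
  then show False using IH[OF i _ ne] card_fib_le[of i l] by fastforce
qed

lemma no_equiv_opp:
  assumes i: "i \<in> I" and ne: "fib V i l \<noteq> {}"
  shows "\<not> (\<forall>q. cov (I - {i}) (fib V i l) q \<longleftrightarrow> cov (I - {i}) (fib V i (opp l)) q)"
proof
  assume a: "\<forall>q. cov (I - {i}) (fib V i l) q \<longleftrightarrow> cov (I - {i}) (fib V i (opp l)) q"
  have "equiv_codes (I - {i}) (fib V i l) (fib V i (opp l))"
  proof
    fix v w assume "v \<in> fib V i l" "w \<in> fib V i (opp l)"
    then show "\<not> eqon (I - {i}) v w"
      using twin_opp[OF i, of v w] tfV unfolding fib_def twinfree_def by auto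
  qed (use finI code_fib a in auto)
  then show False using IH[OF i _ ne] card_fib_le[of i l] by fastforce
qed

text \<open>If \<open>W\<close> had neither letter, the two fibers of \<open>V\<close> would be
  equivalent codes without coordinate \<open>i\<close>, which the induction hypothesis
  excludes.\<close>

lemma onesided_count_ge_6:
  assumes i: "i \<in> I" and h: "hit I V W i l" "\<not> hit I W V i l"
  shows "6 \<le> card (fib V i l) + card (fib W i (opp l))"
proof (rule onesided_ge_6[OF assms])
  show "fib W i l \<noteq> {} \<or> fib W i (opp l) \<noteq> {}"
  proof (rule ccontr)
    assume "\<not> ?thesis"
    then have "\<not> cov (I - {i}) (fib W i l) q" "\<not> cov (I - {i}) (fib W i (opp l)) q" for q
      unfolding cov_def by auto
    then have "cov (I - {i}) (fib V i l) q \<longleftrightarrow> cov (I - {i}) (fib V i (opp l)) q" for q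
      using exchange[OF i, of l q] exchange[OF i, of "opp l" q] by auto
    moreover have "fib V i l \<noteq> {}" using hit_sizes(1)[OF i h(1)] by auto
    ultimately show False using no_equiv_opp[OF i] by blast
  qed
qed

lemma twosided_sizes:
  assumes i: "i \<in> I" and h: "hit I V W i l" "hit I W V i l"
  shows "1 \<le> card (fib V i l)" "1 \<le> card (fib V i (opp l))" "1 \<le> card (fib W i l)" "1 \<le> card (fib W i (opp l))"
    "card (fib V i l) = 1 \<Longrightarrow> 5 \<le> card (fib V i (opp l))"
    "card (fib V i (opp l)) = 1 \<Longrightarrow> 5 \<le> card (fib V i l)"
    "card (fib W i l) = 1 \<Longrightarrow> 5 \<le> card (fib W i (opp l))"
    "card (fib W i (opp l)) = 1 \<Longrightarrow> 5 \<le> card (fib W i l)"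
    "4 \<le> card (fib V i l) + card (fib V i (opp l))"
    "4 \<le> card (fib W i l) + card (fib W i (opp l))"
    "card (fib V i l) + card (fib W i (opp l)) = card (fib W i l) + card (fib V i (opp l))"
  using hit_sizes(1-4)[OF i h(1)] equiv_codes.hit_sizes(1-4)[OF swap i h(2)] card_fib[OF i, of l] by linarith+

text \<open>If this key were hit from neither side, \<open>V\<close> and \<open>W\<close> would have
  equivalent fibers for both of its letters, and the induction hypothesis leaves only empty
  ones.\<close>

lemma hit_cases:
  assumes i: "i \<in> I" and v: "v \<in> V \<union> W" "fst (v i) = fst l"
  shows "hit I V W i l \<or> hit I W V i l"
proof (rule ccontr)
  assume n: "\<not> ?thesis"
  then have n': "\<not> hit I V W i (opp l)" "\<not> hit I W V i (opp l)"
    using hit_sizes(5)[OF i, of "opp l"] equiv_codes.hit_sizes(5)[OF swap i, of "opp l"] by auto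
  have eq: "cov (I - {i}) (fib V i m) q \<longleftrightarrow> cov (I - {i}) (fib W i m) q"
    if "\<not> hit I V W i m" "\<not> hit I W V i m" for m q
    using not_hit_cov[OF i that(1)] equiv_codes.not_hit_cov[OF swap i that(2)] by blast
  have "fib V i m = {} \<and> fib W i m = {}" if "\<not> hit I V W i m" "\<not> hit I W V i m" for m
    using no_equiv_V_W[OF i, of m] small_equiv_codes.no_equiv_V_W[OF swap_small i, of m] eq[OF that] by blast
  then have "fib V i l = {}" "fib W i l = {}" "fib V i (opp l) = {}" "fib W i (opp l) = {}" using n n' by auto
  moreover have "v i = l \<or> v i = opp l" using v(2) same_key by metis
  ultimately show False using v(1) unfolding fib_def by blast
qed

lemma card_fibs_key:
  "card {v \<in> V. fst (v i) = fst l} = card (fib V i l) + card (fib V i (opp l))"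
proof -
  have "{v \<in> V. fst (v i) = fst l} = fib V i l \<union> fib V i (opp l)"
    unfolding fib_def by (auto simp: same_key[of _ l])
  moreover have "fib V i l \<inter> fib V i (opp l) = {}" unfolding fib_def by auto
  ultimately show ?thesis by (simp add: card_Un_disjoint)
qed

lemma card_keys2:
  assumes "fst l \<noteq> fst m"
  shows "card (fib V i l) + card (fib V i (opp l)) + card (fib V i m) + card (fib V i (opp m)) \<le> card V"
    and "(\<And>v. v \<in> V \<Longrightarrow> fst (v i) = fst l \<or> fst (v i) = fst m) \<Longrightarrow>
      card (fib V i l) + card (fib V i (opp l)) + card (fib V i m) + card (fib V i (opp m)) = card V"
proof -
  let ?K = "\<lambda>l. {v \<in> V. fst (v i) = fst l}"
  have u: "card (?K l \<union> ?K m) = card (?K l) + card (?K m)"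
    using finV assms by (intro card_Un_disjoint) auto
  have "card (?K l \<union> ?K m) \<le> card V" using finV by (intro card_mono) auto
  then show "card (fib V i l) + card (fib V i (opp l)) + card (fib V i m) + card (fib V i (opp m)) \<le> card V"
    using u card_fibs_key[of i l] card_fibs_key[of i m] by linarith
  assume "\<And>v. v \<in> V \<Longrightarrow> fst (v i) = fst l \<or> fst (v i) = fst m"
  then have "?K l \<union> ?K m = V" by auto
  then show "card (fib V i l) + card (fib V i (opp l)) + card (fib V i m) + card (fib V i (opp m)) = card V"
    using u card_fibs_key[of i l] card_fibs_key[of i m] by simp
qed

lemma card_keys3:
  assumes "fst l \<noteq> fst m" "fst n \<noteq> fst l" "fst n \<noteq> fst m"
  shows "card (fib V i l) + card (fib V i (opp l)) + card (fib V i m) + card (fib V i (opp m))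
    + (card (fib V i n) + card (fib V i (opp n))) \<le> card V"
proof -
  let ?K = "\<lambda>l. {v \<in> V. fst (v i) = fst l}"
  have u: "card (?K l \<union> ?K m) = card (?K l) + card (?K m)"
    using finV assms by (intro card_Un_disjoint) auto
  have u': "card (?K l \<union> ?K m \<union> ?K n) = card (?K l \<union> ?K m) + card (?K n)"
    using finV assms by (intro card_Un_disjoint) auto
  have "card (?K l \<union> ?K m \<union> ?K n) \<le> card V" using finV by (intro card_mono) auto
  then show ?thesis using u u' card_fibs_key[of i l] card_fibs_key[of i m] card_fibs_key[of i n] by linarith
qed

lemma ex_hit:
  assumes i: "i \<in> I"
  shows "\<exists>l. hit I V W i l"
proof -
  obtain v where v: "v \<in> V" using nonempty by blast
  then have "hit I V W i (v i) \<or> hit I W V i (v i)" using hit_cases[OF i, of v "v i"] by blast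
  then show ?thesis using equiv_codes.hit_other[OF swap] by blast
qed

text \<open>A key hit from both sides takes at least four words of each code; for a key hit from one
  side, both mixed sums are at least six.\<close>

lemma total_ge:
  assumes i: "i \<in> I" and h: "hit I V W i l \<or> hit I W V i l"
  shows "8 \<le> card (fib V i l) + card (fib V i (opp l)) + card (fib W i l) + card (fib W i (opp l))"
    "\<not> (hit I V W i l \<and> hit I W V i l) \<Longrightarrow>
      12 \<le> card (fib V i l) + card (fib V i (opp l)) + card (fib W i l) + card (fib W i (opp l))"
proof -
  show "12 \<le> card (fib V i l) + card (fib V i (opp l)) + card (fib W i l) + card (fib W i (opp l))"
    if "\<not> (hit I V W i l \<and> hit I W V i l)"
    using h that onesided_count_ge_6[OF i, of l] small_equiv_codes.onesided_count_ge_6[OF swap_small i, of l]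
      card_fib[OF i, of l] by linarith
  then show "8 \<le> card (fib V i l) + card (fib V i (opp l)) + card (fib W i l) + card (fib W i (opp l))"
    using twosided_sizes(9,10)[OF i, of l] by linarith
qed

text \<open>Together the codes have at most 20 words. Three keys would need three times eight, and
  two one-sided keys twice twelve. A two-sided key makes the other key two-sided as well.\<close>

lemma two_keys:
  assumes i: "i \<in> I"
  shows "\<exists>l m. fst l \<noteq> fst m \<and> hit I V W i l \<and> hit I W V i l \<and> hit I V W i m \<and> hit I W V i m
    \<and> (\<forall>v\<in>V \<union> W. fst (v i) = fst l \<or> fst (v i) = fst m)"
proof -
  interpret s: small_equiv_codes I W V by (rule swap_small)
  obtain l where l: "hit I V W i l" using ex_hit[OF i] by blast
  then obtain m where m: "fst m \<noteq> fst l" "hit I W V i m" using hit_other by blast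
  have N: "card V \<le> 10" "card W \<le> 10" using small s.small by auto
  have keys: "fst n = fst l \<or> fst n = fst m" if n: "hit I V W i n \<or> hit I W V i n" for n
  proof (rule ccontr)
    assume "\<not> ?thesis"
    then have n': "fst n \<noteq> fst l" "fst n \<noteq> fst m" by auto
    show False
      using card_keys3[of l m n i, OF m(1)[symmetric] n'] s.card_keys3[of l m n i, OF m(1)[symmetric] n'] N
        total_ge(1)[OF i, of l] total_ge(1)[OF i, of m] total_ge(1)[OF i n] l m(2) by linarith
  qed
  have all: "\<forall>v\<in>V \<union> W. fst (v i) = fst l \<or> fst (v i) = fst m"
  proof
    fix v assume "v \<in> V \<union> W"
    then show "fst (v i) = fst l \<or> fst (v i) = fst m" using keys[of "v i"] hit_cases[OF i, of v "v i"] by blast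
  qed
  note le = card_keys2(1)[of l m i, OF m(1)[symmetric]] s.card_keys2(1)[of l m i, OF m(1)[symmetric]]
  have two: "(hit I V W i l \<and> hit I W V i l) \<or> (hit I V W i m \<and> hit I W V i m)"
    using le N total_ge(2)[OF i, of l] total_ge(2)[OF i, of m] l m(2) by linarith
  have tr: "hit I V W i n'" if "hit I V W i n" "fst n = fst n'" for n n'
    using that hit_sizes(5)[OF i that(1)] same_key[of n' n] by auto
  have tr': "hit I W V i n'" if "hit I W V i n" "fst n = fst n'" for n n'
    using that s.hit_sizes(5)[OF i that(1)] same_key[of n' n] by auto
  have "hit I V W i l \<and> hit I W V i l \<and> hit I V W i m \<and> hit I W V i m"
  proof (cases "hit I V W i l \<and> hit I W V i l")
    case True
    then obtain n where "fst n \<noteq> fst l" "hit I V W i n" using s.hit_other by blast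
    then show ?thesis using True m keys[of n] tr[of n m] by auto
  next
    case False
    then have "hit I V W i m \<and> hit I W V i m" using two by blast
    then obtain n where "fst n \<noteq> fst m" "hit I W V i n" using hit_other by blast
    then show ?thesis using False l keys[of n] tr'[of n l] by auto
  qed
  then show ?thesis using all m(1) by (intro exI[of _ l] exI[of _ m]) auto
qed

end

section \<open>Partitions of a box into two or three boxes\<close>

lemma small_cover:
  assumes "finite J" "code J Y" "twinfree J Y" "\<And>p. inbox J p x \<Longrightarrow> cov J Y p" "card Y \<le> 4"
  shows "\<exists>y\<in>Y. eqon J x y"
proof (rule ccontr)
  assume "\<not> ?thesis"
  then have "5 \<le> card Y" by (intro cover_ge_5[OF assms(1-4)]) auto
  then show False using assms(5) by simp
qed

text \<open>The word \<open>y\<close> is one half of the box in direction \<open>e\<close>. The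
  remaining words are disjoint from it, hence carry \<open>opp (y e)\<close>, and cover the other
  half. By \<open>small_cover\<close> one of them fills that half and leaves no room for
  more.\<close>

lemma half_cover:
  assumes fin: "finite J" and c: "code J (insert y Y)" and yY: "y \<notin> Y" and t: "twinfree J Y" and 4: "card Y \<le> 4"
    and cv: "\<And>p. inbox J p v \<Longrightarrow> cov J (insert y Y) p" and m: "\<And>z. z \<in> insert y Y \<Longrightarrow> \<not> dich J v z"
    and e: "e \<in> J" "y e \<noteq> v e" and yv: "\<And>j. j \<in> J - {e} \<Longrightarrow> y j = v j"
  shows "\<exists>z. Y = {z} \<and> z e = opp (y e) \<and> (\<forall>j\<in>J - {e}. z j = v j)"
proof -
  let ?x = "v(e := opp (y e))"
  have ze: "z e = opp (y e)" if z: "z \<in> Y" for z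
  proof -
    have "dich J y z" using codeD[OF c, of y z] z yY by auto
    then obtain j where j: "j \<in> J" "z j = opp (y j)" unfolding dich_def by blast
    have "j = e"
    proof (rule ccontr)
      assume "j \<noteq> e"
      then have "z j = opp (v j)" using j yv[of j] by simp
      then show False using m[of z] z j unfolding dich_def by blast
    qed
    then show ?thesis using j by simp
  qed
  have "\<exists>z\<in>Y. eqon J ?x z"
  proof (rule small_cover[OF fin code_subset[OF c] t _ 4])
    fix p assume p: "inbox J p ?x"
    have "opp (y e) \<noteq> opp (v e)" using e by simp
    then obtain f where f: "holds f (v e)" "holds f (opp (y e))" using holds_exists2 by metis
    have "inbox J (p(e := f)) v" using p f unfolding inbox_def by (auto split: if_splits)
    then obtain z where z: "z \<in> insert y Y" "inbox J (p(e := f)) z" using cv unfolding cov_def by blast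
    have zY: "z \<in> Y" using z f(2) e(1) unfolding inbox_def by auto
    have pz: "\<And>j. j \<in> J \<Longrightarrow> holds ((p(e := f)) j) (z j)" using z(2) unfolding inbox_def by blast
    have "holds (p e) (z e)" using p e(1) ze[OF zY] unfolding inbox_def by auto
    then have "inbox J p z" using pz unfolding inbox_def by (metis fun_upd_apply)
    then show "cov J Y p" using zY unfolding cov_def by blast
  qed auto
  then obtain z where z: "z \<in> Y" "eqon J ?x z" by blast
  have "u = z" if u: "u \<in> Y" for u
  proof (rule ccontr)
    assume "u \<noteq> z"
    then have "dich J z u" using codeD[OF c, of z u] z u by auto
    then obtain j where j: "j \<in> J" "u j = opp (z j)" unfolding dich_def by blast
    have "j = e"
    proof (rule ccontr)
      assume "j \<noteq> e"
      then have "u j = opp (v j)" using j z unfolding eqon_def by simp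
      then show False using m[of u] u j unfolding dich_def by blast
    qed
    then show False using ze[OF u] ze[OF z(1)] j by simp
  qed
  then have "Y = {z}" using z by blast
  moreover have "\<forall>j\<in>J - {e}. z j = v j" using z unfolding eqon_def by auto
  ultimately show ?thesis using ze[OF z(1)] by blast
qed

text \<open>Refutes a cover by naming, for each coordinate \<open>j\<close>, the words
  \<open>B j\<close> to be avoided there, so that every word is avoided somewhere.\<close>

lemma uncovered_point:
  assumes "\<And>p. inbox J p v \<Longrightarrow> cov J T p"
    and "\<And>j. j \<in> J \<Longrightarrow> \<exists>f. holds f (v j) \<and> (\<forall>t\<in>B j. \<not> holds f (t j))"
    and "\<And>t. t \<in> T \<Longrightarrow> \<exists>j\<in>J. t \<in> B j"
  shows False
proof -
  have "\<forall>j. \<exists>f. j \<in> J \<longrightarrow> holds f (v j) \<and> (\<forall>t\<in>B j. \<not> holds f (t j))" using assms(2) by blast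
  then obtain p where p: "\<forall>j. j \<in> J \<longrightarrow> holds (p j) (v j) \<and> (\<forall>t\<in>B j. \<not> holds (p j) (t j))" by metis
  then have "inbox J p v" unfolding inbox_def by blast
  then obtain t where "t \<in> T" "inbox J p t" using assms(1) unfolding cov_def by blast
  then show False using assms(3) p unfolding inbox_def by blast
qed

lemma holds_avoid_iff: "(\<exists>f. holds f v \<and> \<not> holds f b) \<longleftrightarrow> v \<noteq> b"
  using holds_exists3[of b v b] by auto

lemma holds_both_iff: "(\<exists>f. holds f v \<and> holds f b) \<longleftrightarrow> v \<noteq> opp b"
  using holds_avoid_iff[of v "opp b"] by simp

lemma opp_letter:
  assumes "\<not> dich J v u" "j \<in> J" "u j = opp (t j)"
  shows "t j \<noteq> v j"
  using assms unfolding dich_def by metis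

text \<open>If \<open>p\<close> deviated from \<open>v\<close> outside \<open>e\<close>, a point
  could avoid \<open>p\<close> there and \<open>q\<close> at \<open>e\<close>; symmetrically for
  \<open>q\<close>.\<close>

lemma two_tile:
  assumes c: "code J {p, q}" and pq: "p \<noteq> q"
    and cv: "\<And>r. inbox J r v \<Longrightarrow> cov J {p, q} r" and m: "\<not> dich J v p" "\<not> dich J v q"
  shows "\<exists>e\<in>J. p e \<noteq> v e \<and> q e = opp (p e) \<and> (\<forall>j\<in>J - {e}. p j = v j \<and> q j = v j)"
proof -
  have "dich J p q" using codeD[OF c] pq by simp
  then obtain e where e: "e \<in> J" "q e = opp (p e)" unfolding dich_def by blast
  have "p e = opp (q e)" using e by simp
  then have ev: "p e \<noteq> v e" "q e \<noteq> v e" using opp_letter[of J v] m e by blast+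
  have pv: "p j = v j" if j: "j \<in> J - {e}" for j
  proof (rule ccontr)
    assume "p j \<noteq> v j"
    then show False
      using j e ev by (intro uncovered_point[OF cv, where B = "\<lambda>i. if i = j then {p} else if i = e then {q} else {}"])
        (auto simp: holds_exists1 holds_avoid_iff holds_both_iff)
  qed
  have qv: "q j = v j" if j: "j \<in> J - {e}" for j
  proof (rule ccontr)
    assume "q j \<noteq> v j"
    then show False
      using j e ev by (intro uncovered_point[OF cv, where B = "\<lambda>i. if i = j then {q} else if i = e then {p} else {}"])
        (auto simp: holds_exists1 holds_avoid_iff holds_both_iff)
  qed
  show ?thesis using e ev pv qv by blast
qed

text \<open>If \<open>r\<close> shares its letter at \<open>e\<close> with one of the two words, the
  other is half of the box and the remaining half is split in two. With yet another letter at
  \<open>e\<close>, both \<open>p\<close> and \<open>q\<close> would agree with \<open>v\<close>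
  elsewhere, and \<open>r\<close> could not be disjoint from \<open>p\<close>.\<close>

lemma three_tile_aux:
  assumes c: "code J {p, q, r}" and d: "p \<noteq> q" "p \<noteq> r" "q \<noteq> r"
    and cv: "\<And>u. inbox J u v \<Longrightarrow> cov J {p, q, r} u" and m: "\<not> dich J v p" "\<not> dich J v q" "\<not> dich J v r"
    and e: "e \<in> J" "q e = opp (p e)" "r e \<noteq> v e"
  shows "\<exists>R\<subseteq>J. card R \<le> 2 \<and> (\<forall>t\<in>{p, q, r}. \<forall>j\<in>J - R. t j = v j)"
proof -
  have "p e = opp (q e)" using e by simp
  then have ev: "p e \<noteq> v e" "q e \<noteq> v e" using opp_letter[of J v] m e by blast+
  have *: "\<exists>R\<subseteq>J. card R \<le> 2 \<and> (\<forall>t\<in>{p, q, r}. \<forall>j\<in>J - R. t j = v j)"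
    if re: "r e = p e" and c: "code J {p, q, r}" and d: "p \<noteq> q" "p \<noteq> r" "q \<noteq> r"
      and cv: "\<And>u. inbox J u v \<Longrightarrow> cov J {p, q, r} u" and m: "\<not> dich J v p" "\<not> dich J v q" "\<not> dich J v r"
      and e: "e \<in> J" "q e = opp (p e)" and ev: "p e \<noteq> v e" "q e \<noteq> v e" for p q r
  proof -
    have qv: "q j = v j" if j: "j \<in> J - {e}" for j
    proof (rule ccontr)
      assume "q j \<noteq> v j"
      then show False using j e ev re
        by (intro uncovered_point[OF cv, where B = "\<lambda>i. if i = j then {q} else if i = e then {p, r} else {}"])
          (auto simp: holds_exists1 holds_avoid_iff holds_both_iff)
    qed
    let ?K = "J - {e}"
    have "code ?K {p, r}" by (rule code_fiber[OF c, of "{p, r}" e "p e"]) (use re in auto)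
    moreover have "cov ?K {p, r} u" if u: "inbox ?K u v" for u
    proof -
      obtain f where f: "holds f (v e)" "\<not> holds f (q e)" using holds_avoid_iff[of "v e" "q e"] ev by metis
      have "inbox J (u(e := f)) v" using u f e by (simp add: inbox_remove[OF e(1)] inbox_upd)
      then obtain t where t: "t \<in> {p, q, r}" "inbox J (u(e := f)) t" using cv unfolding cov_def by blast
      have "holds f (t e)" "inbox ?K u t" using t(2) by (simp_all add: inbox_remove[OF e(1)] inbox_upd)
      moreover from this have "t \<noteq> q" using f by blast
      ultimately show ?thesis using t unfolding cov_def by blast
    qed
    moreover have "\<not> dich ?K v p" "\<not> dich ?K v r" using m dich_mono[of ?K v _ J] by blast+
    ultimately have "\<exists>g\<in>?K. p g \<noteq> v g \<and> r g = opp (p g) \<and> (\<forall>j\<in>?K - {g}. p j = v j \<and> r j = v j)"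
      using two_tile[of ?K p r v] d(2) by blast
    then obtain g where g: "g \<in> ?K" "\<forall>j\<in>?K - {g}. p j = v j \<and> r j = v j" by blast
    then have "{e, g} \<subseteq> J \<and> card {e, g} \<le> 2 \<and> (\<forall>t\<in>{p, q, r}. \<forall>j\<in>J - {e, g}. t j = v j)"
      using e qv by (auto simp: card_insert_if)
    then show ?thesis by blast
  qed
  consider "r e = p e" | "r e = q e" | "r e \<noteq> p e" "r e \<noteq> q e" by blast
  then show ?thesis
  proof cases
    case 1 then show ?thesis using *[of r p q] c d cv m e ev by blast
  next
    case 2
    have s: "{q, p, r} = {p, q, r}" by blast
    have pq: "p e = opp (q e)" using e by simp
    show ?thesis
      using *[of r q p, unfolded s, OF 2 c d(1)[symmetric] d(3,2) cv m(2,1,3) e(1) pq ev(2,1)] .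
  next
    case 3
    have pv: "p j = v j" if j: "j \<in> J - {e}" for j
    proof (rule ccontr)
      assume "p j \<noteq> v j"
      then show False using j e ev 3 holds_exists3[of "q e" "v e" "r e"]
        by (intro uncovered_point[OF cv, where B = "\<lambda>i. if i = j then {p} else if i = e then {q, r} else {}"])
          (auto simp: holds_exists1 holds_avoid_iff holds_both_iff)
    qed
    have qv: "q j = v j" if j: "j \<in> J - {e}" for j
    proof (rule ccontr)
      assume "q j \<noteq> v j"
      then show False using j e ev 3 holds_exists3[of "p e" "v e" "r e"]
        by (intro uncovered_point[OF cv, where B = "\<lambda>i. if i = j then {q} else if i = e then {p, r} else {}"])
          (auto simp: holds_exists1 holds_avoid_iff holds_both_iff)
    qed
    have "dich J p r" using codeD[OF c] d by simp
    then obtain j where j: "j \<in> J" "r j = opp (p j)" unfolding dich_def by blast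
    have "j \<noteq> e" using j e 3 by auto
    then have "r j = opp (v j)" using pv j by simp
    then show ?thesis using m j unfolding dich_def by blast
  qed
qed

text \<open>Otherwise each coordinate separating two of the words has the letter of \<open>v\<close>
  in the third. The three pairs are then separated in three different coordinates, and a point can
  avoid a different word in each.\<close>

lemma three_tile:
  assumes fin: "card T = 3" and c: "code J T"
    and cv: "\<And>u. inbox J u v \<Longrightarrow> cov J T u" and m: "\<And>t. t \<in> T \<Longrightarrow> \<not> dich J v t"
  shows "\<exists>R\<subseteq>J. card R \<le> 2 \<and> (\<forall>t\<in>T. \<forall>j\<in>J - R. t j = v j)"
proof (rule ccontr)
  assume n: "\<not> ?thesis"
  obtain p q r where T: "T = {p, q, r}" and d: "p \<noteq> q" "p \<noteq> r" "q \<noteq> r" using fin card_3_iff[of T] by blast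
  have star: "t3 e = v e" if "T = {t1, t2, t3}" "t1 \<noteq> t2" "t1 \<noteq> t3" "t2 \<noteq> t3" "e \<in> J" "t2 e = opp (t1 e)" for t1 t2 t3 e
    using three_tile_aux[of J t1 t2 t3 v e] that c cv m n by blast
  have opps: "\<exists>e\<in>J. t2 e = opp (t1 e)" if "t1 \<in> T" "t2 \<in> T" "t1 \<noteq> t2" for t1 t2
    using codeD[OF c that] unfolding dich_def .
  obtain e where e: "e \<in> J" "q e = opp (p e)" using opps[of p q] T d by blast
  obtain f where f: "f \<in> J" "r f = opp (p f)" using opps[of p r] T d by blast
  obtain g where g: "g \<in> J" "r g = opp (q g)" using opps[of q r] T d by blast
  have re: "r e = v e" using star[of p q r e] T d e by blast
  have qf: "q f = v f" using star[of p r q f] T d f by blast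
  have pg: "p g = v g" using star[of q r p g] T d g by blast
  have ne: "t j \<noteq> v j" if "t \<in> T" "u \<in> T" "j \<in> J" "u j = opp (t j)" for t u j
    using that m[of u] opp_letter[of J v u j t] by blast
  have pe: "p e \<noteq> v e" and rf: "r f \<noteq> v f" and qg: "q g \<noteq> v g"
    using ne[of p q e] ne[of r p f] ne[of q r g] T e f g by (auto simp: opp_swap[of "p f"])
  have pf: "p f \<noteq> v f" and qe: "q e \<noteq> v e" using ne[of p r f] ne[of q p e] T e f by (auto simp: opp_swap[of "p e"])
  have "e \<noteq> f" "f \<noteq> g" "e \<noteq> g" using re rf qf qg pg pe by auto
  then show False
    using e f g pe rf qg T
    by (intro uncovered_point[OF cv, where B = "\<lambda>i. if i = e then {p} else if i = f then {r} else if i = g then {q} else {}"])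
      (auto simp: holds_exists1 holds_avoid_iff holds_both_iff)
qed

section \<open>Partitions of a box into at most seven boxes\<close>

text \<open>\<open>P\<close> consists of the words of an equivalent code meeting the box of \<open>v\<close>. Inside this box, a word
  \<open>w\<close> is unrestricted in the coordinates with \<open>w j = v j\<close>, and by \<open>bin\<close> every other coordinate carries just one
  pair of complementary letters, so \<open>P\<close> amounts to a partition of a discrete cube into subcubes.\<close>

locale box_partition =
  fixes I :: "'i set" and v :: "'i \<Rightarrow> 'k \<times> bool" and P
  assumes finI: "finite I" and codeP: "code I P" and tfP: "twinfree I P"
    and cvP: "\<And>p. inbox I p v \<Longrightarrow> cov I P p"
    and meet: "\<And>w. w \<in> P \<Longrightarrow> \<not> dich I v w" and ne: "\<And>w. w \<in> P \<Longrightarrow> \<not> eqon I v w"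
    and act: "\<And>j. j \<in> I \<Longrightarrow> \<exists>w\<in>P. w j \<noteq> v j"
    and bin: "\<And>j w z. j \<in> I \<Longrightarrow> w \<in> P \<Longrightarrow> z \<in> P \<Longrightarrow> w j \<noteq> v j \<Longrightarrow> z j \<noteq> v j \<Longrightarrow> z j = w j \<or> z j = opp (w j)"
    and sz: "\<And>j w l. j \<in> I \<Longrightarrow> w \<in> P \<Longrightarrow> w j \<noteq> v j \<Longrightarrow> l = w j \<or> l = opp (w j) \<Longrightarrow>
      2 \<le> card (fib P j l) \<and> card (fib P j l) \<le> 4"
    and k7: "card P \<le> 7"
begin

lemma finP: "finite P"
  using codeP code_finite by blast

lemma not_opp: "w \<in> P \<Longrightarrow> j \<in> I \<Longrightarrow> w j \<noteq> opp (v j)"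
  using meet unfolding dich_def by blast

text \<open>A word of \<open>P\<close> differing from \<open>v\<close> in \<open>h\<close> letters covers the fraction \<open>2 ^ (- h)\<close> of the box of \<open>v\<close>, and
  seven words with \<open>h \<ge> 3\<close> cannot cover it.\<close>

lemma ex_close: "\<exists>s\<in>P. card {j \<in> I. s j \<noteq> v j} \<le> 2"
proof (rule ccontr)
  assume "\<not> ?thesis"
  then have h: "3 \<le> card {j \<in> I. s j \<noteq> v j}" if "s \<in> P" for s using that by fastforce
  \<comment> \<open>Sample points inside the box of \<open>v\<close>: the key of \<open>v i\<close>
    gets the value required by \<open>v\<close>, and every other key at \<open>i\<close> records
    whether \<open>i\<close> belongs to \<open>S\<close>.\<close>
  define pt where "pt S = (\<lambda>i k. if k = fst (v i) then snd (v i) else i \<in> S)" for S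
  have ptv: "inbox I (pt S) v" for S unfolding pt_def inbox_def holds_def by simp
  define C where "C w = {S. S \<subseteq> I \<and> inbox I (pt S) w}" for w
  obtain w0 where w0: "w0 \<in> P" using cvP[OF ptv] unfolding cov_def by blast
  have d3: "3 \<le> card I" using h[OF w0] card_mono[of I "{j \<in> I. w0 j \<noteq> v j}"] finI by auto
  have Cw: "card (C w) \<le> 2 ^ (card I - 3)" if w: "w \<in> P" for w
  proof -
    let ?H = "{j \<in> I. w j \<noteq> v j}"
    have H: "j \<in> S \<longleftrightarrow> snd (w j)" if "S \<in> C w" "j \<in> ?H" for S j
    proof -
      have "w j \<noteq> opp (v j)" using not_opp[OF w] that by blast
      then have "fst (w j) \<noteq> fst (v j)" using that same_key[of "w j" "v j"] by auto
      then show ?thesis using that unfolding C_def pt_def inbox_def holds_def by auto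
    qed
    have "inj_on (\<lambda>S. S - ?H) (C w)"
    proof (rule inj_onI)
      fix S S' assume S: "S \<in> C w" "S' \<in> C w" "S - ?H = S' - ?H"
      show "S = S'"
      proof (rule set_eqI)
        fix j
        show "j \<in> S \<longleftrightarrow> j \<in> S'"
        proof (cases "j \<in> ?H")
          case True then show ?thesis using H S by blast
        next
          case False then show ?thesis using S(3) by blast
        qed
      qed
    qed
    moreover have "(\<lambda>S. S - ?H) ` C w \<subseteq> Pow (I - ?H)" unfolding C_def by auto
    ultimately have "card (C w) \<le> card (Pow (I - ?H))" using finI by (intro card_inj_on_le) auto
    also have "\<dots> = 2 ^ (card I - card ?H)" using finI by (simp add: card_Pow card_Diff_subset)
    also have "\<dots> \<le> 2 ^ (card I - 3)" using h[OF w] by (intro power_increasing) auto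
    finally show ?thesis .
  qed
  have "Pow I \<subseteq> (\<Union>w\<in>P. C w)" using cvP[OF ptv] unfolding C_def cov_def by auto
  then have "card (Pow I) \<le> card (\<Union>w\<in>P. C w)"
    using finP finI unfolding C_def by (intro card_mono finite_UN_I) auto
  also have "\<dots> \<le> (\<Sum>w\<in>P. card (C w))" by (rule card_UN_le[OF finP])
  also have "\<dots> \<le> (\<Sum>w\<in>P. 2 ^ (card I - 3))" by (rule sum_mono[OF Cw])
  also have "\<dots> \<le> 7 * 2 ^ (card I - 3)" using k7 by simp
  also have "\<dots> < 2 ^ 3 * 2 ^ (card I - 3)" by simp
  also have "\<dots> = 2 ^ card I" using d3 by (metis le_add_diff_inverse power_add)
  finally show False using finI by (simp add: card_Pow)
qed

text \<open>A word differing from \<open>v\<close> in just one letter would be the only word with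
  that letter, whereas \<open>sz\<close> demands at least two.\<close>

lemma ex_two: "\<exists>s\<in>P. \<exists>i1\<in>I. \<exists>i2\<in>I. i1 \<noteq> i2 \<and> s i1 \<noteq> v i1 \<and> s i2 \<noteq> v i2 \<and> (\<forall>j\<in>I - {i1} - {i2}. s j = v j)"
proof -
  obtain s where s: "s \<in> P" "card {j \<in> I. s j \<noteq> v j} \<le> 2" using ex_close by blast
  let ?H = "{j \<in> I. s j \<noteq> v j}"
  have "card ?H = 0 \<or> card ?H = 1 \<or> card ?H = 2" using s(2) by linarith
  moreover have "card ?H \<noteq> 0" using ne[OF s(1)] finI unfolding eqon_def by auto
  moreover have "card ?H \<noteq> 1"
  proof
    assume "card ?H = 1"
    then obtain j where j: "?H = {j}" using card_1_singletonE by blast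
    then have jI: "j \<in> I" "s j \<noteq> v j" by auto
    have "fib P j (s j) \<subseteq> {s}"
    proof
      fix w assume "w \<in> fib P j (s j)"
      then have w: "w \<in> P" "w j = s j" unfolding fib_def by auto
      have "w = s"
      proof (rule ccontr)
        assume "w \<noteq> s"
        then obtain i where i: "i \<in> I" "w i = opp (s i)" using codeP s w unfolding code_def dich_def by metis
        then have "i \<noteq> j" using w by auto
        then have "w i = opp (v i)" using j i by auto
        then show False using not_opp[OF w(1) i(1)] by blast
      qed
      then show "w \<in> {s}" by simp
    qed
    then have "card (fib P j (s j)) \<le> 1" using card_mono[of "{s}"] by fastforce
    then show False using sz[OF jI(1) s(1) jI(2), of "s j"] by simp
  qed
  ultimately have "card ?H = 2" by blast
  then obtain i1 i2 where H: "?H = {i1, i2}" "i1 \<noteq> i2" using card_2_iff[of ?H] by blast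
  then have "i1 \<in> I" "i2 \<in> I" "s i1 \<noteq> v i1" "s i2 \<noteq> v i2" "\<forall>j\<in>I - {i1} - {i2}. s j = v j" by blast+
  then show ?thesis using H(2) s(1) by blast
qed

end

text \<open>The partition of a three-dimensional box into five boxes without a twin pair.\<close>

definition cyclic3 :: "'i set \<Rightarrow> ('i \<Rightarrow> 'k \<times> bool) \<Rightarrow> ('i \<Rightarrow> 'k \<times> bool) set \<Rightarrow> bool" where
  "cyclic3 I v P \<longleftrightarrow> (\<exists>i j e b c d. I = {i, j, e} \<and> i \<noteq> j \<and> i \<noteq> e \<and> j \<noteq> e
    \<and> (\<exists>w\<in>P. w i = b \<and> w j = c \<and> w e = v e) \<and> (\<exists>w\<in>P. w i = b \<and> w j = opp c \<and> w e = d)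
    \<and> (\<exists>w\<in>P. w i = v i \<and> w j = opp c \<and> w e = opp d) \<and> (\<exists>w\<in>P. w i = opp b \<and> w j = v j \<and> w e = d)
    \<and> (\<exists>w\<in>P. w i = opp b \<and> w j = c \<and> w e = opp d))"

section \<open>The quarters cut out by a word differing in two letters\<close>

locale box_partition2 = box_partition I v P for I :: "'i set" and v :: "'i \<Rightarrow> 'k \<times> bool" and P +
  fixes s :: "'i \<Rightarrow> 'k \<times> bool" and i1 i2 :: 'i
  assumes sP: "s \<in> P" and i1: "i1 \<in> I" "s i1 \<noteq> v i1" and i2: "i2 \<in> I" "s i2 \<noteq> v i2" and i12: "i1 \<noteq> i2"
    and sv: "\<And>j. j \<in> I - {i1} - {i2} \<Longrightarrow> s j = v j"
begin

lemma swap: "box_partition2 I v P s i2 i1"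
  by unfold_locales (use sP i1 i2 i12 sv in auto)

definition J where "J = I - {i1} - {i2}"

definition cls where "cls b c = {w \<in> P. w i1 = b \<and> w i2 = c}"

text \<open>The word \<open>s\<close> occupies a quarter of the box of \<open>v\<close>. The two adjacent quarters are tiled by \<open>D\<close> and \<open>B\<close>, and by
  \<open>E\<close> and \<open>A\<close>, and the opposite one by \<open>A\<close>, \<open>B\<close> and \<open>G\<close>.\<close>

definition A where "A = cls (opp (s i1)) (v i2)"
definition B where "B = cls (v i1) (opp (s i2))"
definition D where "D = cls (s i1) (opp (s i2))"
definition E where "E = cls (opp (s i1)) (s i2)"
definition G where "G = cls (opp (s i1)) (opp (s i2))"

lemmas cls_defs = A_def B_def D_def E_def G_def cls_def

lemma v12: "v i1 \<noteq> s i1" "v i1 \<noteq> opp (s i1)" "v i2 \<noteq> s i2" "v i2 \<noteq> opp (s i2)"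
  using i1 i2 not_opp[OF sP i1(1)] not_opp[OF sP i2(1)] opp_swap[of "v i1" "s i1"] opp_swap[of "v i2" "s i2"] by auto

lemma finJ: "finite J"
  unfolding J_def using finI by simp

text \<open>A word disjoint from \<open>s\<close> is complementary to it at \<open>i1\<close> or
  \<open>i2\<close>, because elsewhere \<open>s\<close> agrees with \<open>v\<close>;
  \<open>bin\<close> admits only three letters at each of these coordinates.\<close>

lemma classes: "P = insert s (A \<union> B \<union> D \<union> E \<union> G)"
proof
  show "P \<subseteq> insert s (A \<union> B \<union> D \<union> E \<union> G)"
  proof
    fix w assume w: "w \<in> P"
    show "w \<in> insert s (A \<union> B \<union> D \<union> E \<union> G)"
    proof (cases "w = s")
      case False
      then obtain j where j: "j \<in> I" "w j = opp (s j)" using codeP sP w unfolding code_def dich_def by metis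
      have "j = i1 \<or> j = i2"
      proof (rule ccontr)
        assume "\<not> ?thesis"
        then have "s j = v j" using sv j by blast
        then show False using not_opp[OF w j(1)] j by simp
      qed
      moreover have "w i1 = v i1 \<or> w i1 = s i1 \<or> w i1 = opp (s i1)" using bin[OF i1(1) sP w i1(2)] by blast
      moreover have "w i2 = v i2 \<or> w i2 = s i2 \<or> w i2 = opp (s i2)" using bin[OF i2(1) sP w i2(2)] by blast
      ultimately show ?thesis using w j unfolding cls_defs by blast
    qed simp
  qed
  show "insert s (A \<union> B \<union> D \<union> E \<union> G) \<subseteq> P" using sP unfolding cls_defs by blast
qed

lemma fin_cls: "finite A" "finite B" "finite D" "finite E" "finite G"
  unfolding cls_defs using finP by auto

lemma disj_cls: "s \<notin> A \<union> B \<union> D \<union> E \<union> G" "A \<inter> B = {}" "D \<inter> B = {}" "E \<inter> A = {}"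
    "(A \<union> B) \<inter> G = {}" "A \<inter> G = {}" "B \<inter> G = {}" "A \<inter> (E \<union> G) = {}" "E \<inter> G = {}" "B \<inter> (D \<union> G) = {}" "D \<inter> G = {}"
    "(A \<union> B) \<inter> (D \<union> E \<union> G) = {}" "D \<inter> (E \<union> G) = {}"
  unfolding cls_defs using v12 by auto

lemma card_P: "card P = 1 + card A + card B + card D + card E + card G"
proof -
  have "card P = 1 + card ((A \<union> B) \<union> (D \<union> (E \<union> G)))"
  proof -
    have "(A \<union> B) \<union> (D \<union> (E \<union> G)) = A \<union> B \<union> D \<union> E \<union> G" by blast
    then show ?thesis using arg_cong[OF classes, of card] disj_cls(1) fin_cls by simp
  qed
  also have "card ((A \<union> B) \<union> (D \<union> (E \<union> G))) = card (A \<union> B) + card (D \<union> (E \<union> G))"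
    using fin_cls disj_cls(12) by (intro card_Un_disjoint) (auto simp: Un_assoc)
  also have "card (A \<union> B) = card A + card B" using fin_cls disj_cls(2) by (intro card_Un_disjoint) auto
  also have "card (D \<union> (E \<union> G)) = card D + card (E \<union> G)" using fin_cls disj_cls(13) by (intro card_Un_disjoint) auto
  also have "card (E \<union> G) = card E + card G" using fin_cls disj_cls(9) by (intro card_Un_disjoint) auto
  finally show ?thesis by simp
qed

lemma card_cls1: "1 \<le> card D" "card D \<le> 3" "card A + card E + card G \<le> 4"
proof -
  have "fib P i1 (s i1) = insert s D"
    using classes disj_cls v12 unfolding fib_def cls_defs by auto
  moreover have "s \<notin> D" using disj_cls(1) by blast
  ultimately have "card (fib P i1 (s i1)) = 1 + card D" using fin_cls by simp
  then show "1 \<le> card D" "card D \<le> 3" using sz[OF i1(1) sP i1(2), of "s i1"] by auto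
  have "A \<union> (E \<union> G) \<subseteq> fib P i1 (opp (s i1))" unfolding fib_def cls_defs by auto
  then have "card (A \<union> (E \<union> G)) \<le> 4"
    using sz[OF i1(1) sP i1(2), of "opp (s i1)"] card_mono[of "fib P i1 (opp (s i1))" "A \<union> (E \<union> G)"] finP
    unfolding fib_def by auto
  moreover have "card (A \<union> (E \<union> G)) = card A + card (E \<union> G)" using fin_cls disj_cls(8) by (intro card_Un_disjoint) auto
  moreover have "card (E \<union> G) = card E + card G" using fin_cls disj_cls(9) by (intro card_Un_disjoint) auto
  ultimately show "card A + card E + card G \<le> 4" by simp
qed

text \<open>With at most one letter besides that of \<open>v\<close> at \<open>i1\<close> and at
  \<open>i2\<close>, no complementary letters occur there, so disjointness is decided on
  \<open>J\<close>.\<close>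

lemma code_J:
  assumes "X \<subseteq> P" and c: "c \<noteq> opp (v i1)" "d \<noteq> opp (v i2)"
    and X: "\<And>x. x \<in> X \<Longrightarrow> (x i1 = v i1 \<or> x i1 = c) \<and> (x i2 = v i2 \<or> x i2 = d)"
  shows "code J X"
proof -
  have c': "v i1 \<noteq> opp c" "v i2 \<noteq> opp d" using c opp_swap by blast+
  have "y i1 \<noteq> opp (x i1) \<and> y i2 \<noteq> opp (x i2)" if "x \<in> X" "y \<in> X" for x y
    using X[OF that(1)] X[OF that(2)] c c' by (elim conjE disjE) simp_all
  then show ?thesis
    unfolding J_def using code_subset[OF codeP assms(1)] by (intro code_remove) blast+
qed

lemma code_T: "code J (A \<union> B \<union> G)" "code J (D \<union> B)" "code J (E \<union> A)"
proof -
  show "code J (A \<union> B \<union> G)"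
    by (rule code_J[of _ "opp (s i1)" "opp (s i2)"]) (use v12 in \<open>auto simp: cls_defs\<close>)
  show "code J (D \<union> B)"
    by (rule code_J[of _ "s i1" "opp (s i2)"]) (use v12 in \<open>auto simp: cls_defs\<close>)
  show "code J (E \<union> A)"
    by (rule code_J[of _ "opp (s i1)" "s i2"]) (use v12 in \<open>auto simp: cls_defs\<close>)
qed

lemma twinfree_cls: "twinfree J A" "twinfree J B" "twinfree J D" "twinfree J E" "twinfree J G"
proof -
  have "twinfree J (cls b c)" for b c
    unfolding J_def
    by (rule twinfree_fiber[OF twinfree_fiber[OF tfP, of "cls b c" i1 b], of "cls b c" i2 c]) (auto simp: cls_def)
  then show "twinfree J A" "twinfree J B" "twinfree J D" "twinfree J E" "twinfree J G"
    unfolding A_def B_def D_def E_def G_def by auto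
qed

lemma meet_J: "w \<in> P \<Longrightarrow> \<not> dich J v w"
  using meet dich_mono[of J v w I] unfolding J_def by blast

lemma cover_J:
  assumes q: "inbox J q v" and f: "holds f (v i1)" and g: "holds g (v i2)"
  shows "\<exists>w\<in>P. inbox J q w \<and> holds f (w i1) \<and> holds g (w i2)"
proof -
  have i2': "i2 \<in> I - {i1}" using i2 i12 by auto
  have *: "inbox I (q(i1 := f, i2 := g)) w \<longleftrightarrow> holds f (w i1) \<and> holds g (w i2) \<and> inbox J q w" for w
    using i12 by (auto simp: inbox_remove[OF i1(1)] inbox_remove[OF i2'] J_def inbox_upd)
  then show ?thesis using cvP[of "q(i1 := f, i2 := g)"] q f g unfolding cov_def by auto
qed

lemma cover_T:
  assumes q: "inbox J q v"
  shows "cov J (A \<union> B \<union> G) q" "cov J (D \<union> B) q" "cov J (E \<union> A) q"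
proof -
  \<comment> \<open>Index 1 satisfies the letter of \<open>s\<close> and index 2 violates it, always
    within the box of \<open>v\<close>; pairs of these select the quarters.\<close>
  obtain f1 f2 g1 g2 where f: "holds f1 (v i1)" "holds f1 (s i1)" "holds f2 (v i1)" "\<not> holds f2 (s i1)"
      "holds g1 (v i2)" "holds g1 (s i2)" "holds g2 (v i2)" "\<not> holds g2 (s i2)"
    using v12 by (metis holds_avoid_iff holds_both_iff)
  have sel: "cov J X q" if "\<exists>w\<in>P. inbox J q w \<and> holds f' (w i1) \<and> holds g' (w i2)"
    "\<And>w. w \<in> P \<Longrightarrow> holds f' (w i1) \<Longrightarrow> holds g' (w i2) \<Longrightarrow> w \<in> X" for X f' g'
    using that unfolding cov_def by blast
  show "cov J (A \<union> B \<union> G) q"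
  proof (rule sel[OF cover_J[OF q f(3) f(7)]])
    fix w assume w: "w \<in> P" "holds f2 (w i1)" "holds g2 (w i2)"
    then have "w \<noteq> s" "w i1 \<noteq> s i1" "w i2 \<noteq> s i2" using f by auto
    then show "w \<in> A \<union> B \<union> G" using w equalityD1[OF classes] unfolding D_def E_def cls_def by blast
  qed
  show "cov J (D \<union> B) q"
  proof (rule sel[OF cover_J[OF q f(1) f(7)]])
    fix w assume w: "w \<in> P" "holds f1 (w i1)" "holds g2 (w i2)"
    then have "w \<noteq> s" "w i1 \<noteq> opp (s i1)" using f by auto
    then show "w \<in> D \<union> B" using w equalityD1[OF classes] unfolding A_def E_def G_def cls_def by blast
  qed
  show "cov J (E \<union> A) q"
  proof (rule sel[OF cover_J[OF q f(3) f(5)]])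
    fix w assume w: "w \<in> P" "holds f2 (w i1)" "holds g1 (w i2)"
    then have "w \<noteq> s" "w i2 \<noteq> opp (s i2)" using f by auto
    then show "w \<in> E \<union> A" using w equalityD1[OF classes] unfolding B_def D_def G_def cls_def by blast
  qed
qed

lemma swap_cls:
  shows "box_partition2.A v P s i2 i1 = B" "box_partition2.B v P s i2 i1 = A" "box_partition2.D P s i2 i1 = E"
    "box_partition2.E P s i2 i1 = D" "box_partition2.G P s i2 i1 = G" "box_partition2.J I i2 i1 = J"
proof -
  interpret w: box_partition2 I v P s i2 i1 by (rule swap)
  have c: "w.cls b c = cls c b" for b c unfolding w.cls_def cls_def by auto
  show "w.A = B" "w.B = A" "w.D = E" "w.E = D" "w.G = G"
    unfolding w.A_def w.B_def w.D_def w.E_def w.G_def A_def B_def D_def E_def G_def c by simp_all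
  show "w.J = J" unfolding w.J_def J_def by auto
qed

text \<open>Without \<open>B\<close>, the at most three words of \<open>D\<close> would cover the
  box of \<open>v\<close> on \<open>J\<close>. One of them would agree with \<open>v\<close> there
  and be a twin of \<open>s\<close>.\<close>

lemma B_nonempty: "1 \<le> card B"
proof (rule ccontr)
  assume "\<not> 1 \<le> card B"
  then have "B = {}" using fin_cls by (simp add: Suc_le_eq card_gt_0_iff)
  then have "\<exists>y\<in>D. eqon J v y"
    using small_cover[OF finJ _ twinfree_cls(3), of v] code_T(2) cover_T(2) card_cls1(2) by simp
  then obtain y where y: "y \<in> D" "eqon J v y" by blast
  have "eqon (I - {i2}) s y"
    using y sv unfolding eqon_def J_def D_def cls_def by (metis (mono_tags, lifting) Diff_iff insertCI mem_Collect_eq singletonD)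
  moreover have "y i2 = opp (s i2)" "y \<in> P" using y unfolding D_def cls_def by auto
  ultimately show False using twin_opp[OF i2(1), of s y] tfP sP unfolding twinfree_def by blast
qed

lemma A_nonempty: "1 \<le> card A"
  using box_partition2.B_nonempty[OF swap] unfolding swap_cls .

lemma card_cls2: "1 \<le> card E" "card E \<le> 3" "card B + card D + card G \<le> 4"
  using box_partition2.card_cls1[OF swap] unfolding swap_cls by blast+

lemma J_active: "j \<in> J \<Longrightarrow> \<exists>w\<in>A \<union> B \<union> D \<union> E \<union> G. w j \<noteq> v j"
proof -
  assume j: "j \<in> J"
  then obtain w where w: "w \<in> P" "w j \<noteq> v j" using act[of j] unfolding J_def by blast
  moreover have "w \<noteq> s" using w(2) sv j unfolding J_def by blast
  ultimately show ?thesis using equalityD1[OF classes] by blast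
qed

lemma card_I: "card I = card J + 2"
proof -
  have "card (I - {i1}) = card I - 1" using i1 by simp
  moreover have "card (I - {i1} - {i2}) = card (I - {i1}) - 1" using i2 i12 by simp
  moreover have "card {i1, i2} \<le> card I" using i1 i2 finI by (intro card_mono) auto
  ultimately show ?thesis using i12 unfolding J_def by simp
qed

lemma sub_P: "A \<subseteq> P" "B \<subseteq> P" "D \<subseteq> P" "E \<subseteq> P" "G \<subseteq> P"
  unfolding cls_defs by auto

text \<open>\<open>D\<close> and \<open>B\<close> halve their quarter in a direction
  \<open>e\<close>, and all words of \<open>A\<close> and \<open>G\<close> lie in the half opposite
  to \<open>\<beta>\<close>. If \<open>G\<close> is empty, \<open>A\<close> and \<open>E\<close> are
  halves too and the cyclic pattern appears. Otherwise the bound of seven fixes the sizes, and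
  \<open>E\<close> and \<open>A\<close> form a partition into three boxes.\<close>

lemma two_case:
  assumes "card D = 1" "card B = 1"
  shows "card I = 4 \<and> card P = 7 \<or> cyclic3 I v P"
proof -
  obtain \<delta> \<beta> where Dd: "D = {\<delta>}" and Bb: "B = {\<beta>}" using assms card_1_singletonE by metis
  have DB: "D \<union> B = {\<delta>, \<beta>}" using Dd Bb by blast
  have db: "\<delta> \<noteq> \<beta>" using Dd Bb disj_cls(3) by auto
  have inP: "\<delta> \<in> P" "\<beta> \<in> P" using Dd Bb sub_P by auto
  have "\<exists>e\<in>J. \<delta> e \<noteq> v e \<and> \<beta> e = opp (\<delta> e) \<and> (\<forall>j\<in>J - {e}. \<delta> j = v j \<and> \<beta> j = v j)"
    by (rule two_tile[OF code_T(2)[unfolded DB] db cover_T(2)[unfolded DB] meet_J[OF inP(1)] meet_J[OF inP(2)]])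
  then obtain e where e: "e \<in> J" "\<delta> e \<noteq> v e" "\<beta> e = opp (\<delta> e)" "\<And>j. j \<in> J - {e} \<Longrightarrow> \<delta> j = v j \<and> \<beta> j = v j"
    by blast
  have be: "\<beta> e \<noteq> v e" using opp_letter[OF meet_J[OF inP(1)] e(1), of \<beta>] e(3) by simp
  have Ae: "\<alpha> e = \<delta> e" if a: "\<alpha> \<in> A \<union> G" for \<alpha>
  proof -
    have "\<beta> \<noteq> \<alpha>" using a Bb disj_cls(2,7) by blast
    then have "dich J \<beta> \<alpha>" using codeD[OF code_T(1), of \<beta> \<alpha>] a Bb by auto
    then obtain j where j: "j \<in> J" "\<alpha> j = opp (\<beta> j)" unfolding dich_def by blast
    have "j = e"
    proof (rule ccontr)
      assume "j \<noteq> e"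
      then have "\<alpha> j = opp (v j)" using e(4)[of j] j by simp
      then show False using meet_J[of \<alpha>] a sub_P j unfolding dich_def by blast
    qed
    then show ?thesis using j e(3) by simp
  qed
  have tot: "card P = 3 + card A + card E + card G" using card_P assms by simp
  show ?thesis
  proof (cases "G = {}")
    case True
    have "\<exists>z. A = {z} \<and> z e = opp (\<beta> e) \<and> (\<forall>j\<in>J - {e}. z j = v j)"
    proof (rule half_cover[OF finJ])
      show "code J (insert \<beta> A)" "\<And>p. inbox J p v \<Longrightarrow> cov J (insert \<beta> A) p"
        using code_T(1) cover_T(1) True Bb by simp_all
      show "\<beta> \<notin> A" using Bb disj_cls by auto
      show "\<not> dich J v z" if "z \<in> insert \<beta> A" for z using that meet_J inP sub_P by blast
    qed (use twinfree_cls card_cls1 e be in auto)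
    then obtain \<alpha> where Aa: "A = {\<alpha>}" and \<alpha>: "\<alpha> e = opp (\<beta> e)" "\<And>j. j \<in> J - {e} \<Longrightarrow> \<alpha> j = v j" by blast
    have ae: "\<alpha> e = \<delta> e" using \<alpha>(1) e(3) by simp
    have "\<exists>z. E = {z} \<and> z e = opp (\<alpha> e) \<and> (\<forall>j\<in>J - {e}. z j = v j)"
    proof (rule half_cover[OF finJ])
      show "code J (insert \<alpha> E)" "\<And>p. inbox J p v \<Longrightarrow> cov J (insert \<alpha> E) p"
        using code_T(3) cover_T(3) Aa by simp_all
      show "\<alpha> \<notin> E" using Aa disj_cls by auto
      show "\<not> dich J v z" if "z \<in> insert \<alpha> E" for z using that meet_J Aa sub_P by blast
    qed (use twinfree_cls card_cls2 e ae \<alpha> in auto)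
    then obtain \<epsilon> where Ee: "E = {\<epsilon>}" and \<epsilon>: "\<epsilon> e = opp (\<alpha> e)" "\<And>j. j \<in> J - {e} \<Longrightarrow> \<epsilon> j = v j" by blast
    have "J \<subseteq> {e}"
    proof
      fix j assume j: "j \<in> J"
      show "j \<in> {e}"
      proof (rule ccontr)
        assume "j \<notin> {e}"
        then have "j \<in> J - {e}" using j by blast
        then show False using J_active[OF j] e(4) \<alpha>(2) \<epsilon>(2) Aa Bb Dd Ee True by auto
      qed
    qed
    then have "J = {e}" using e by blast
    then have I: "I = {i1, i2, e}" using i1 i2 unfolding J_def by blast
    have ne: "i1 \<noteq> e" "i2 \<noteq> e" using e unfolding J_def by auto
    have l: "\<delta> i1 = s i1" "\<delta> i2 = opp (s i2)" "\<beta> i1 = v i1" "\<beta> i2 = opp (s i2)" "\<alpha> i1 = opp (s i1)" "\<alpha> i2 = v i2"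
        "\<epsilon> i1 = opp (s i1)" "\<epsilon> i2 = s i2"
      using Aa Bb Dd Ee unfolding cls_defs by auto
    have m: "\<alpha> \<in> P" "\<epsilon> \<in> P" using Aa Ee sub_P by auto
    have "s e = v e" using sv e(1) unfolding J_def by blast
    then have "\<exists>w\<in>P. w i1 = s i1 \<and> w i2 = s i2 \<and> w e = v e" using sP by blast
    moreover have "\<exists>w\<in>P. w i1 = s i1 \<and> w i2 = opp (s i2) \<and> w e = \<delta> e" using l inP by blast
    moreover have "\<exists>w\<in>P. w i1 = v i1 \<and> w i2 = opp (s i2) \<and> w e = opp (\<delta> e)" using l inP e(3) by blast
    moreover have "\<exists>w\<in>P. w i1 = opp (s i1) \<and> w i2 = v i2 \<and> w e = \<delta> e" using l m ae by blast
    moreover have "\<exists>w\<in>P. w i1 = opp (s i1) \<and> w i2 = s i2 \<and> w e = opp (\<delta> e)" using l m ae \<epsilon>(1) by metis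
    ultimately have "cyclic3 I v P" unfolding cyclic3_def using I ne i12 by blast
    then show ?thesis ..
  next
    case False
    then have g1: "1 \<le> card G" using fin_cls by (simp add: Suc_le_eq card_gt_0_iff)
    \<comment> \<open>The single word of \<open>A\<close> would fill the half opposite to
      \<open>\<beta>\<close>, and a word of \<open>G\<close> in the same half could not be disjoint
      from it.\<close>
    have "\<not> card (E \<union> A) = 2"
    proof
      assume "card (E \<union> A) = 2"
      moreover have "card (E \<union> A) = card E + card A" using fin_cls disj_cls by (intro card_Un_disjoint) auto
      ultimately have "card E = 1" "card A = 1" using card_cls2(1) A_nonempty by linarith+
      then obtain \<epsilon> \<alpha> where Ee: "E = {\<epsilon>}" and Aa: "A = {\<alpha>}" using card_1_singletonE by metis
      have m: "\<alpha> \<in> P" "\<epsilon> \<in> P" using Aa Ee sub_P by auto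
      have EA: "E \<union> A = {\<epsilon>, \<alpha>}" using Aa Ee by blast
      have ea: "\<epsilon> \<noteq> \<alpha>" using Aa Ee disj_cls(4) by auto
      have "\<exists>f\<in>J. \<epsilon> f \<noteq> v f \<and> \<alpha> f = opp (\<epsilon> f) \<and> (\<forall>j\<in>J - {f}. \<epsilon> j = v j \<and> \<alpha> j = v j)"
        by (rule two_tile[OF code_T(3)[unfolded EA] ea cover_T(3)[unfolded EA] meet_J[OF m(2)] meet_J[OF m(1)]])
      then obtain f where f: "\<And>j. j \<in> J - {f} \<Longrightarrow> \<alpha> j = v j" by blast
      have ae: "\<alpha> e = \<delta> e" using Ae Aa by blast
      then have "e = f" using f[of e] e by auto
      obtain \<gamma> where g: "\<gamma> \<in> G" using False by blast
      have "\<alpha> \<noteq> \<gamma>" using Aa g disj_cls(6) by blast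
      then have "dich J \<alpha> \<gamma>" using codeD[OF code_T(1), of \<alpha> \<gamma>] Aa g by auto
      then obtain j where j: "j \<in> J" "\<gamma> j = opp (\<alpha> j)" unfolding dich_def by blast
      show False
      proof (cases "j = e")
        case True then show False using j Ae[of \<gamma>] ae g by auto
      next
        case False
        then have "\<gamma> j = opp (v j)" using f[of j] j \<open>e = f\<close> by simp
        then show False using meet_J[of \<gamma>] g sub_P j unfolding dich_def by blast
      qed
    qed
    moreover have cEA: "card (E \<union> A) = card E + card A" using fin_cls disj_cls by (intro card_Un_disjoint) auto
    ultimately have n3: "card (E \<union> A) = 3" and G1: "card G = 1" and P7: "card P = 7"
      using tot k7 g1 card_cls2(1) A_nonempty by linarith+
    obtain \<gamma> where Gg: "G = {\<gamma>}" using G1 card_1_singletonE by metis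
    have "\<exists>R\<subseteq>J. card R \<le> 2 \<and> (\<forall>t\<in>E \<union> A. \<forall>j\<in>J - R. t j = v j)"
      by (rule three_tile[OF n3 code_T(3) cover_T(3)]) (use meet_J sub_P in blast)+
    then obtain R where R: "R \<subseteq> J" "card R \<le> 2" "\<And>t j. t \<in> E \<union> A \<Longrightarrow> j \<in> J - R \<Longrightarrow> t j = v j" by blast
    have "A \<noteq> {}" using A_nonempty by auto
    then obtain \<alpha> where a: "\<alpha> \<in> A" by blast
    have eR: "e \<in> R" using R(3)[of \<alpha> e] a e(1,2) Ae[of \<alpha>] by auto
    \<comment> \<open>In any other coordinate only the word of \<open>G\<close> could differ from
      \<open>v\<close>, but then its complementary letter would have to occur as well.\<close>
    have "J \<subseteq> R"
    proof
      fix j assume j: "j \<in> J"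
      show "j \<in> R"
      proof (rule ccontr)
        assume jR: "j \<notin> R"
        have je: "j \<in> J - {e}" using j jR eR by blast
        have oth: "w j = v j" if wi: "w \<in> insert s (A \<union> B \<union> D \<union> E)" for w
        proof -
          consider "w = s" | "w \<in> E \<union> A" | "w = \<beta>" | "w = \<delta>" using wi Bb Dd by auto
          then show ?thesis using R(3)[of w j] j jR e(4)[OF je] sv[of j] unfolding J_def by cases auto
        qed
        obtain w where w: "w \<in> A \<union> B \<union> D \<union> E \<union> G" "w j \<noteq> v j" using J_active[OF j] by blast
        then have "w \<in> G" using oth[of w] by blast
        then have gj: "\<gamma> j \<noteq> v j" using w(2) Gg by simp
        have gP: "\<gamma> \<in> P" and jI: "j \<in> I" using Gg sub_P j unfolding J_def by auto
        have "1 \<le> card (fib P j (opp (\<gamma> j)))" using sz[OF jI gP gj, of "opp (\<gamma> j)"] by simp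
        then have "fib P j (opp (\<gamma> j)) \<noteq> {}" by auto
        then obtain z where z: "z \<in> P" "z j = opp (\<gamma> j)" unfolding fib_def by blast
        have "\<gamma> j = opp (z j)" using z(2) by simp
        then have "z j \<noteq> v j" using opp_letter[OF meet[OF gP] jI] by blast
        then have "z \<notin> insert s (A \<union> B \<union> D \<union> E)" using oth[of z] by blast
        then have "z = \<gamma>" using z(1) equalityD1[OF classes] Gg by blast
        then show False using z(2) by simp
      qed
    qed
    then have "J = R" using R by blast
    then have "card J \<le> 2" using R by simp
    \<comment> \<open>With one coordinate, three disjoint words would need three pairwise
      complementary letters.\<close>
    moreover have "card J \<noteq> 1"
    proof
      assume "card J = 1"
      then obtain e' where "J = {e'}" by (rule card_1_singletonE)
      then have Je: "J = {e}" using e(1) by simp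
      obtain p q r where T: "E \<union> A = {p, q, r}" and d: "p \<noteq> q" "p \<noteq> r" "q \<noteq> r"
        using iffD1[OF card_3_iff n3] by blast
      have "t' e = opp (t e)" if "t \<in> E \<union> A" "t' \<in> E \<union> A" "t \<noteq> t'" for t t'
      proof -
        have "dich J t t'" by (rule codeD[OF code_T(3) that])
        then obtain j where "j \<in> J" "t' j = opp (t j)" unfolding dich_def by blast
        moreover from this have "j = e" using Je by simp
        ultimately show ?thesis by simp
      qed
      then have "q e = opp (p e)" "r e = opp (p e)" "r e = opp (q e)" using T d by simp_all
      then show False by simp
    qed
    moreover have "card J \<noteq> 0" using e finJ by auto
    ultimately have "card I = 4" using card_I by linarith
    then show ?thesis using P7 by blast
  qed
qed

text \<open>On \<open>J\<close>, the word \<open>y\<close> occurs in two partitions into three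
  boxes, each using at most two coordinates. It differs from \<open>v\<close> in at least two, since
  half of the box would leave only one further word. So both partitions use the same two
  coordinates.\<close>

lemma single_case:
  assumes P7: "card P = 7" and G: "G = {}"
    and T1: "card (D \<union> B) = 3" and T2: "card (E \<union> A) = 3"
    and y: "E \<union> A = insert y Y" "y \<notin> Y" "card Y = 2" "twinfree J Y" and z: "z \<in> D \<union> B" "eqon J y z"
  shows "card I = 4 \<and> card P = 7"
proof -
  have "\<exists>R\<subseteq>J. card R \<le> 2 \<and> (\<forall>t\<in>E \<union> A. \<forall>j\<in>J - R. t j = v j)"
    by (rule three_tile[OF T2 code_T(3) cover_T(3)]) (use meet_J sub_P in blast)+
  then obtain R where R: "R \<subseteq> J" "card R \<le> 2" "\<And>t j. t \<in> E \<union> A \<Longrightarrow> j \<in> J - R \<Longrightarrow> t j = v j" by blast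
  have "\<exists>R\<subseteq>J. card R \<le> 2 \<and> (\<forall>t\<in>D \<union> B. \<forall>j\<in>J - R. t j = v j)"
    by (rule three_tile[OF T1 code_T(2) cover_T(2)]) (use meet_J sub_P in blast)+
  then obtain S where S: "S \<subseteq> J" "card S \<le> 2" "\<And>t j. t \<in> D \<union> B \<Longrightarrow> j \<in> J - S \<Longrightarrow> t j = v j" by blast
  define H where "H = {j \<in> J. y j \<noteq> v j}"
  have HR: "H \<subseteq> R" using R(3)[of y] y(1) unfolding H_def by blast
  have HS: "H \<subseteq> S" using S(3)[OF z(1)] z(2) unfolding H_def eqon_def by fastforce
  have fin: "finite R" "finite S" "finite H" using R(1) S(1) finJ finite_subset HR by metis+
  have mY: "\<not> dich J v t" if "t \<in> insert y Y" for t using that y(1) meet_J sub_P by blast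
  have yY: "dich J y t" if "t \<in> Y" for t using codeD[OF code_T(3), of y t] y that by auto
  have "card H \<noteq> 0"
  proof
    assume "card H = 0"
    then have "H = {}" using fin by simp
    then have "eqon J v y" unfolding H_def eqon_def by blast
    moreover obtain t where "t \<in> Y" using y(3) by fastforce
    ultimately show False using yY[of t] mY[of t] eqon_dich_cong by blast
  qed
  moreover have "card H \<noteq> 1"
  proof
    assume "card H = 1"
    then obtain e where e: "H = {e}" using card_1_singletonE by blast
    have "\<exists>z. Y = {z} \<and> z e = opp (y e) \<and> (\<forall>j\<in>J - {e}. z j = v j)"
    proof (rule half_cover[OF finJ])
      show "code J (insert y Y)" "\<And>p. inbox J p v \<Longrightarrow> cov J (insert y Y) p"
        using code_T(3) cover_T(3) y(1) by simp_all
      show "e \<in> J" "y e \<noteq> v e" "\<And>j. j \<in> J - {e} \<Longrightarrow> y j = v j" using e unfolding H_def by blast+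
    qed (use y mY in auto)
    then show False using y(3) by auto
  qed
  ultimately have H2: "2 \<le> card H" by linarith
  then have "H = R" "H = S" using card_seteq[OF fin(1) HR] card_seteq[OF fin(2) HS] R(2) S(2) by linarith+
  have "J \<subseteq> H"
  proof
    fix j assume j: "j \<in> J"
    show "j \<in> H"
    proof (rule ccontr)
      assume "j \<notin> H"
      then show False using J_active[OF j] R(3)[of _ j] S(3)[of _ j] j G \<open>H = R\<close> \<open>H = S\<close> by blast
    qed
  qed
  then have "J = H" unfolding H_def by blast
  then have "card J = 2" using H2 R(2) \<open>H = R\<close> by simp
  then show ?thesis using card_I P7 by simp
qed

text \<open>With \<open>G\<close> empty, \<open>A\<close> and \<open>D\<close> both complement
  \<open>B\<close> in the box of \<open>v\<close> on \<open>J\<close>, and \<open>E\<close> and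
  \<open>B\<close> both complement \<open>A\<close>. One of \<open>A\<close> and \<open>E\<close> is
  a single word; its box is covered by at most four words, so by \<open>small_cover\<close> it
  reappears among them.\<close>

lemma three_case:
  assumes P7: "card P = 7" and G: "G = {}" and T1: "card D + card B = 3" and T2: "card E + card A = 3"
  shows "card I = 4 \<and> card P = 7"
proof -
  have c1: "card (D \<union> B) = 3" using T1 fin_cls disj_cls(3) by (simp add: card_Un_disjoint)
  have c2: "card (E \<union> A) = 3" using T2 fin_cls disj_cls(4) by (simp add: card_Un_disjoint)
  have ex: "\<not> (cov J X p \<and> cov J Y p)" if "code J (X \<union> Y)" "X \<inter> Y = {}" for X Y p
    using that inbox_meet[of J p] codeD[OF that(1)] unfolding cov_def by blast
  have e1: "\<not> (cov J A p \<and> cov J B p)" for p using ex[of A B] code_T(1) disj_cls(2) G by simp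
  have e2: "\<not> (cov J D p \<and> cov J B p)" for p using ex[of D B] code_T(2) disj_cls(3) by simp
  have e3: "\<not> (cov J E p \<and> cov J A p)" for p using ex[of E A] code_T(3) disj_cls(4) by simp
  have cU: "cov J (X \<union> Y) p \<longleftrightarrow> cov J X p \<or> cov J Y p" for X Y p unfolding cov_def by blast
  have AD: "cov J A p \<longleftrightarrow> cov J D p" and EB: "cov J E p \<longleftrightarrow> cov J B p" if "inbox J p v" for p
    using cover_T[OF that] e1[of p] e2[of p] e3[of p] G unfolding cU by (auto simp: cov_def)
  have mm: "\<And>y. y \<in> X \<Longrightarrow> \<not> dich J y v" if "X \<subseteq> P" for X using that meet_J dich_sym[of J v] by blast
  have "card A = 1 \<or> card E = 1" using T2 A_nonempty card_cls2(1) by linarith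
  then show ?thesis
  proof
    assume "card A = 1"
    then obtain y where y: "A = {y}" using card_1_singletonE by blast
    have "\<exists>z\<in>D. eqon J y z"
    proof (rule small_cover[OF finJ _ twinfree_cls(3)])
      show "code J D" using code_T(2) code_subset by blast
      show "cov J D p" if "inbox J p y" for p
        by (rule single_cover[of D J v y, OF _ _ _ that])
          (use mm[OF sub_P(3)] mm[OF sub_P(1)] AD y in \<open>auto simp: cov_def\<close>)
    qed (use card_cls1 in simp)
    then obtain z where "z \<in> D" "eqon J y z" by blast
    then show ?thesis using single_case[OF P7 G c1 c2, of y E z] y disj_cls(4) T2 twinfree_cls by auto
  next
    assume "card E = 1"
    then obtain y where y: "E = {y}" using card_1_singletonE by blast
    have "\<exists>z\<in>B. eqon J y z"
    proof (rule small_cover[OF finJ _ twinfree_cls(2)])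
      show "code J B" using code_T(2) code_subset by blast
      show "cov J B p" if "inbox J p y" for p
        by (rule single_cover[of B J v y, OF _ _ _ that])
          (use mm[OF sub_P(2)] mm[OF sub_P(4)] EB y in \<open>auto simp: cov_def\<close>)
    qed (use card_cls2 in simp)
    then obtain z where "z \<in> B" "eqon J y z" by blast
    then show ?thesis using single_case[OF P7 G c1 c2, of y A z] y disj_cls(4) T2 twinfree_cls by auto
  qed
qed

lemma cyclic3_or_four: "card I = 4 \<and> card P = 7 \<or> cyclic3 I v P"
proof (cases "card D + card B = 2 \<or> card E + card A = 2")
  case True
  then show ?thesis
  proof
    assume "card D + card B = 2"
    then have "card D = 1" "card B = 1" using card_cls1(1) B_nonempty by linarith+
    then show ?thesis by (rule two_case)
  next
    assume "card E + card A = 2"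
    then have "card E = 1" "card A = 1" using card_cls2(1) A_nonempty by linarith+
    then show ?thesis using box_partition2.two_case[OF swap, unfolded swap_cls] by blast
  qed
next
  case False
  \<comment> \<open>Besides \<open>s\<close> there are at least three words in each of the two sums,
    and seven words in all.\<close>
  then have "card P = 7" "card G = 0" "card D + card B = 3" "card E + card A = 3"
    using card_P k7 card_cls1(1) card_cls2(1) A_nonempty B_nonempty by linarith+
  then show ?thesis using three_case fin_cls by auto
qed

end

lemma (in box_partition) cyclic3_or_four: "card I = 4 \<and> card P = 7 \<or> cyclic3 I v P"
proof -
  obtain s i1 i2 where "s \<in> P" "i1 \<in> I" "i2 \<in> I" "i1 \<noteq> i2" "s i1 \<noteq> v i1" "s i2 \<noteq> v i2"
    "\<forall>j\<in>I - {i1} - {i2}. s j = v j" using ex_two by blast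
  then interpret box_partition2 I v P s i1 i2 by unfold_locales auto
  show ?thesis by (rule cyclic3_or_four)
qed

section \<open>Equivalent codes have at least eleven words\<close>

lemma card_pos_ex: "0 < card S \<Longrightarrow> \<exists>x. x \<in> S"
  by (metis card_gt_0_iff ex_in_conv)

context small_equiv_codes
begin

lemma letter_keys:
  assumes i: "i \<in> I" and x: "x \<in> V \<union> W" "fst l = fst (x i)"
  shows "\<exists>m. fst l \<noteq> fst m \<and> hit I V W i l \<and> hit I W V i l \<and> hit I V W i m \<and> hit I W V i m
    \<and> (\<forall>v\<in>V \<union> W. fst (v i) = fst l \<or> fst (v i) = fst m)"
proof -
  obtain l0 m0 where k: "fst l0 \<noteq> fst m0" "hit I V W i l0" "hit I W V i l0" "hit I V W i m0" "hit I W V i m0"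
    "\<forall>v\<in>V \<union> W. fst (v i) = fst l0 \<or> fst (v i) = fst m0" using two_keys[OF i] by blast
  have tr: "hit I V W i n' \<and> hit I W V i n'" if "hit I V W i n" "hit I W V i n" "fst n' = fst n" for n n'
    using that hit_sizes(5)[OF i that(1)] equiv_codes.hit_sizes(5)[OF swap i that(2)] same_key[of n' n] by auto
  have "fst l = fst l0 \<or> fst l = fst m0" using k(6) x by metis
  then show ?thesis
  proof
    assume a: "fst l = fst l0"
    then show ?thesis using k tr[OF k(2,3) a] by (intro exI[of _ m0]) auto
  next
    assume a: "fst l = fst m0"
    then show ?thesis using k tr[OF k(4,5) a] by (intro exI[of _ l0]) auto
  qed
qed

text \<open>A single word needs five with the complementary letter, and the other key takes at least
  four. Ten words then leave only the pattern excluded by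
  \<open>exceptional_impossible\<close>.\<close>

lemma not_single:
  assumes i: "i \<in> I" and lm: "fst l \<noteq> fst m" and h: "hit I V W i l" "hit I W V i l" "hit I V W i m" "hit I W V i m"
    and all: "\<forall>v\<in>V \<union> W. fst (v i) = fst l \<or> fst (v i) = fst m"
  shows "card (fib V i l) \<noteq> 1"
proof
  assume 1: "card (fib V i l) = 1"
  interpret s: small_equiv_codes I W V by (rule swap_small)
  have tot: "card (fib V i l) + card (fib V i (opp l)) + card (fib V i m) + card (fib V i (opp m)) = card V"
    "card (fib W i l) + card (fib W i (opp l)) + card (fib W i m) + card (fib W i (opp m)) = card W"
    using card_keys2(2)[OF lm] s.card_keys2(2)[OF lm] all by blast+
  note sl = twosided_sizes[OF i h(1,2)] and sm = twosided_sizes[OF i h(3,4)]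
  have num: "card (fib V i (opp l)) \<le> 5" "card (fib W i l) = 1" "card (fib W i (opp l)) \<le> 5"
    "card (fib W i m) + card (fib W i (opp m)) \<le> 4"
    using tot small s.small sl(5)[OF 1] sl(3,11) sm(9,10) 1 by linarith+
  obtain a c where ac: "fib V i l = {a}" "fib W i l = {c}" using 1 num(2) card_1_singletonE by metis
  have "{w \<in> W. fst (w i) \<noteq> fst l} = {w \<in> W. fst (w i) = fst m}" using all lm by auto
  then have "card {w \<in> W. fst (w i) \<noteq> fst l} \<le> 4" using s.card_fibs_key[of i m] num(4) by simp
  then show False using exceptional_impossible[OF i h(1,2) ac num(1,3)] by blast
qed

lemma letter_sizes:
  assumes i: "i \<in> I" and x: "x \<in> V \<union> W" "fst l = fst (x i)"
  shows "2 \<le> card (fib V i l)" "card (fib V i l) \<le> 4" "2 \<le> card (fib W i l)" "card (fib W i l) \<le> 4"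
proof -
  interpret s: small_equiv_codes I W V by (rule swap_small)
  obtain m where lm: "fst l \<noteq> fst m" and h: "hit I V W i l" "hit I W V i l" "hit I V W i m" "hit I W V i m"
    and all: "\<forall>v\<in>V \<union> W. fst (v i) = fst l \<or> fst (v i) = fst m"
    using letter_keys[OF assms] by blast
  have h': "hit I V W i (opp l)" "hit I W V i (opp l)" using hit_sizes(5)[OF i h(1)] s.hit_sizes(5)[OF i h(2)] by auto
  have all': "\<forall>v\<in>W \<union> V. fst (v i) = fst l \<or> fst (v i) = fst m" using all by blast
  have ns: "card (fib V i l) \<noteq> 1" "card (fib W i l) \<noteq> 1" "card (fib V i (opp l)) \<noteq> 1" "card (fib W i (opp l)) \<noteq> 1"
    using not_single[OF i lm h all] s.not_single[OF i lm h(2,1,4,3) all'] not_single[OF i _ h' h(3,4)]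
      s.not_single[OF i _ h'(2,1) h(4,3)] lm all all' by simp_all
  have tot: "card (fib V i l) + card (fib V i (opp l)) + card (fib V i m) + card (fib V i (opp m)) = card V"
    "card (fib W i l) + card (fib W i (opp l)) + card (fib W i m) + card (fib W i (opp m)) = card W"
    using card_keys2(2)[OF lm] s.card_keys2(2)[OF lm] all by blast+
  note sl = twosided_sizes[OF i h(1,2)] and sm = twosided_sizes[OF i h(3,4)]
  show "2 \<le> card (fib V i l)" "2 \<le> card (fib W i l)" using ns sl(1,3) by linarith+
  \<comment> \<open>Of at most ten words, at least two carry \<open>opp l\<close> and at least four
    the other key.\<close>
  show "card (fib V i l) \<le> 4" "card (fib W i l) \<le> 4"
    using ns sl(1,2,3,4,11) sm(9,10) tot small s.small by linarith+
qed

section \<open>The words of \<open>W\<close> meeting a word of \<open>V\<close>\<close>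

definition near where "near v = {w \<in> W. \<not> dich I v w}"

lemma I_nonempty: "I \<noteq> {}"
proof
  assume I: "I = {}"
  obtain v where "v \<in> V" using nonempty by blast
  moreover obtain w where "w \<in> W" using nonempty card_V_W finV finW by fastforce
  ultimately show False using disj I unfolding eqon_def by blast
qed

lemma far_opp: "i \<in> I \<Longrightarrow> fib W i (opp (v i)) \<subseteq> W - near v"
  unfolding fib_def near_def dich_def by blast

text \<open>In each coordinate at least two words of \<open>W\<close> carry the letter complementary
  to that of \<open>v\<close>. If only two words missed \<open>v\<close>, both would be
  complementary to \<open>v\<close> everywhere and could not be disjoint.\<close>

lemma card_far:
  assumes v: "v \<in> V"
  shows "3 \<le> card (W - near v)"
proof (rule ccontr)
  assume n: "\<not> ?thesis"
  have 2: "2 \<le> card (fib W i (opp (v i)))" if "i \<in> I" for i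
    using letter_sizes(3)[OF that, of v "opp (v i)"] v by simp
  have fin: "finite (W - near v)" using finW by simp
  have eq: "fib W i (opp (v i)) = W - near v" if i: "i \<in> I" for i
    using 2[OF i] card_seteq[OF fin far_opp[OF i]] n by simp
  obtain i0 where i0: "i0 \<in> I" using I_nonempty by blast
  have "2 \<le> card (W - near v)" using 2[OF i0] eq[OF i0] by simp
  then obtain u where u: "u \<in> W - near v" using card_pos_ex[of "W - near v"] by auto
  have "0 < card (W - near v - {u})" using \<open>2 \<le> card (W - near v)\<close> u fin by simp
  then obtain w where w: "w \<in> W - near v" "w \<noteq> u" using card_pos_ex by blast
  have "u i = opp (v i)" "w i = opp (v i)" if "i \<in> I" for i using eq[OF that] u w unfolding fib_def by auto
  then have "\<not> dich I u w" unfolding dich_def by simp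
  then show False using codeD[OF codeW, of u w] u w by blast
qed

lemma near_sub: "near v \<subseteq> W"
  unfolding near_def by blast

lemma card_near: "card (near v) + card (W - near v) = card W"
  using card_Diff_subset[of "near v" W] finite_subset[OF near_sub finW] card_mono[OF finW near_sub] near_sub by auto

lemma cov_near:
  assumes v: "v \<in> V" and p: "inbox I p v"
  shows "cov I (near v) p"
proof -
  obtain w where w: "w \<in> W" "inbox I p w" using cov_V_box(2)[OF v p] unfolding cov_def by blast
  then show ?thesis using inbox_meet[OF p w(2)] unfolding near_def cov_def by blast
qed

lemma near_partition:
  assumes v: "v \<in> V"
  shows "box_partition I v (near v)"
proof
  have k10: "card W \<le> 10" using small card_V_W by simp
  show "card (near v) \<le> 7" using card_near[of v] card_far[OF v] k10 by linarith
  show fI: "finite I" by (rule finI)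
  show c: "code I (near v)" and t: "twinfree I (near v)"
    using code_subset[OF codeW near_sub] twinfree_subset[OF tfW near_sub] .
  show cv: "cov I (near v) p" if "inbox I p v" for p using cov_near[OF v that] .
  show meet: "\<not> dich I v w" if "w \<in> near v" for w using that unfolding near_def by blast
  show ne: "\<not> eqon I v w" if "w \<in> near v" for w using disj[OF v] that near_sub by blast
  have lo: "w j \<noteq> opp (v j)" if "j \<in> I" "w \<in> near v" for w j using that meet unfolding dich_def by blast
  have key: "fst (w j) \<noteq> fst (v j)" if "j \<in> I" "w \<in> near v" "w j \<noteq> v j" for w j
    using lo[OF that(1,2)] that(3) same_key[of "w j" "v j"] by blast
  show "\<exists>w\<in>near v. w j \<noteq> v j" if j: "j \<in> I" for j
  proof (rule ccontr)
    assume "\<not> ?thesis"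
    \<comment> \<open>At least five words meet \<open>v\<close>, but a letter occurs at most four
      times, so they cannot all share \<open>v j\<close>.\<close>
    then have "near v \<subseteq> fib W j (v j)" using near_sub unfolding fib_def by blast
    then have "card (near v) \<le> card (fib W j (v j))" by (intro card_mono) auto
    also have "\<dots> \<le> 4" using letter_sizes(4)[OF j, of v "v j"] v by simp
    finally show False using cover_ge_5[OF fI c t cv ne] by simp
  qed
  show "z j = w j \<or> z j = opp (w j)"
    if jw: "j \<in> I" "w \<in> near v" "z \<in> near v" "w j \<noteq> v j" "z j \<noteq> v j" for j w z
  proof -
    obtain m :: "'k \<times> bool" where "\<forall>x\<in>V \<union> W. fst (x j) = fst (v j) \<or> fst (x j) = fst m"
      using letter_keys[OF jw(1) UnI1[OF v] refl] by blast
    moreover have "w \<in> V \<union> W" "z \<in> V \<union> W" using near_sub jw(2,3) by blast+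
    ultimately have "fst (z j) = fst (w j)" using key[OF jw(1,2,4)] key[OF jw(1,3,5)] by metis
    then show ?thesis by (simp add: same_key)
  qed
  show "2 \<le> card (fib (near v) j l) \<and> card (fib (near v) j l) \<le> 4"
    if jw: "j \<in> I" "w \<in> near v" "w j \<noteq> v j" "l = w j \<or> l = opp (w j)" for j w l
  proof -
    have wW: "w \<in> W" "\<not> dich I v w" using jw(2) unfolding near_def by auto
    have f: "{y \<in> W. \<not> dich I v y \<and> y j = b} = fib (near v) j b" for b unfolding fib_def near_def by blast
    have s: "1 \<le> card (fib (near v) j (w j)) \<and> 1 \<le> card (fib (near v) j (opp (w j)))
        \<and> (card (fib (near v) j (w j)) = 1 \<longrightarrow> 5 \<le> card (fib (near v) j (opp (w j))))
        \<and> (card (fib (near v) j (opp (w j))) = 1 \<longrightarrow> 5 \<le> card (fib (near v) j (w j)))"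
      using fiber_sizes(1)[OF finI jw(1) codeW tfW cov_V_box(2)[OF v] wW refl jw(3)] unfolding f by blast
    have u: "card (fib (near v) j b) \<le> 4" if "b = w j \<or> b = opp (w j)" for b
    proof -
      have "fib (near v) j b \<subseteq> fib W j b" using near_sub unfolding fib_def by blast
      then have "card (fib (near v) j b) \<le> card (fib W j b)" by (intro card_mono) auto
      also have "\<dots> \<le> 4" using letter_sizes(4)[OF jw(1), of w b] wW that by auto
      finally show ?thesis .
    qed
    show ?thesis using s u[of "w j"] u[of "opp (w j)"] jw(4) by auto
  qed
qed

text \<open>A further word \<open>u\<close> of \<open>W\<close> is complementary to \<open>v\<close>
  at one of the three coordinates. Disjointness from the five words forces it to be the twin of the
  one carrying the letter of \<open>v\<close> at that coordinate.\<close>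

lemma not_cyclic3:
  assumes v: "v \<in> V"
  shows "\<not> cyclic3 I v (near v)"
proof
  assume "cyclic3 I v (near v)"
  then obtain i j e b c d w1 w2 w3 w4 w5 where I: "I = {i, j, e}" "i \<noteq> j" "i \<noteq> e" "j \<noteq> e"
    and w: "w1 \<in> near v" "w1 i = b" "w1 j = c" "w1 e = v e" "w2 \<in> near v" "w2 i = b" "w2 j = opp c" "w2 e = d"
      "w3 \<in> near v" "w3 i = v i" "w3 j = opp c" "w3 e = opp d" "w4 \<in> near v" "w4 i = opp b" "w4 j = v j" "w4 e = d"
      "w5 \<in> near v" "w5 i = opp b" "w5 j = c" "w5 e = opp d" unfolding cyclic3_def by blast
  have lo: "x k \<noteq> opp (v k)" if "x \<in> near v" "k \<in> I" for x k using that unfolding near_def dich_def by blast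
  have b: "opp b \<noteq> opp (v i)" "opp c \<noteq> opp (v j)" "opp d \<noteq> opp (v e)" "d \<noteq> opp (v e)"
    using lo[OF w(17), of i] lo[OF w(5), of j] lo[OF w(9), of e] lo[OF w(5), of e] w I by auto
  have b': "b \<noteq> opp (v i)" "c \<noteq> opp (v j)" using lo[OF w(1), of i] lo[OF w(1), of j] w I by auto
  obtain u where u: "u \<in> W" "u \<notin> near v" using card_pos_ex[of "W - near v"] card_far[OF v] by auto
  then have "dich I v u" unfolding near_def by blast
  then have uv: "u i = opp (v i) \<or> u j = opp (v j) \<or> u e = opp (v e)" using I unfolding dich_def by blast
  have dx: "u i = opp (x i) \<or> u j = opp (x j) \<or> u e = opp (x e)" if "x \<in> near v" for x
    using codeD[OF codeW, of x u] that u near_sub[of v] I unfolding dich_def by blast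
  have tx: "\<not> (u i = x i \<and> u j = x j \<and> u e = opp (x e))" "\<not> (u i = x i \<and> u j = opp (x j) \<and> u e = x e)"
    "\<not> (u i = opp (x i) \<and> u j = x j \<and> u e = x e)" if "x \<in> near v" for x
  proof -
    have "\<not> twin I x u" using tfW that u near_sub[of v] unfolding twinfree_def by blast
    then show "\<not> (u i = x i \<and> u j = x j \<and> u e = opp (x e))" "\<not> (u i = x i \<and> u j = opp (x j) \<and> u e = x e)"
      "\<not> (u i = opp (x i) \<and> u j = x j \<and> u e = x e)"
      using I unfolding twin_def by auto
  qed
  have d: "u i = opp b \<or> u j = opp c \<or> u e = opp (v e)" "u i = opp b \<or> u j = c \<or> u e = opp d"
    "u i = opp (v i) \<or> u j = c \<or> u e = d" "u i = b \<or> u j = opp (v j) \<or> u e = opp d"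
    "u i = b \<or> u j = opp c \<or> u e = d"
    using dx[OF w(1)] dx[OF w(5)] dx[OF w(9)] dx[OF w(13)] dx[OF w(17)] unfolding w opp_opp .
  have t: "\<not> (u i = b \<and> u j = c \<and> u e = opp (v e))" "\<not> (u i = opp (v i) \<and> u j = opp c \<and> u e = opp d)"
    "\<not> (u i = opp b \<and> u j = opp (v j) \<and> u e = d)"
    using tx(1)[OF w(1)] tx(3)[OF w(9)] tx(2)[OF w(13)] unfolding w .
  have e1: "u e \<noteq> opp (v e)"
  proof
    assume "u e = opp (v e)"
    then have "u e \<noteq> d" "u e \<noteq> opp d" using b by auto
    then have "u i = opp b \<or> u j = c" "u i = b \<or> u j = opp c" "\<not> (u i = b \<and> u j = c)"
      "u i = opp (v i) \<or> u j = c" using d t \<open>u e = opp (v e)\<close> by blast+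
    then show False using b(1) opp_neq by metis
  qed
  have e2: "u i \<noteq> opp (v i)"
  proof
    assume a: "u i = opp (v i)"
    then have i: "u i \<noteq> opp b" "u i \<noteq> b" using b b' by auto
    then have "u j = opp c" using d(1) e1 by blast
    then have "u j \<noteq> c" by simp
    then have "u e = opp d" using d(2) i by blast
    then show False using t(2) a \<open>u j = opp c\<close> by blast
  qed
  have "u j = opp (v j)" using uv e1 e2 by blast
  then have j: "u j \<noteq> opp c" "u j \<noteq> c" using b b' by auto
  then have "u i = opp b" using d(1) e1 by blast
  moreover from this have "u i \<noteq> b" by simp
  then have "u e = d" using d(5) j by blast
  ultimately show False using t(3) \<open>u j = opp (v j)\<close> by blast
qed

lemma shape: "card I = 4 \<and> card (near v) = 7" if "v \<in> V"
  using box_partition.cyclic3_or_four[OF near_partition[OF that]] not_cyclic3[OF that] by blast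

lemma card_V_10: "card V = 10" and card_W_10: "card W = 10"
proof -
  obtain v where v: "v \<in> V" using nonempty by blast
  then have "10 \<le> card W" using shape card_near[of v] card_far by fastforce
  then show "card V = 10" "card W = 10" using small card_V_W by auto
qed

lemma card_far_3: "v \<in> V \<Longrightarrow> card (W - near v) = 3"
  using shape[of v] card_near[of v] card_W_10 by simp

section \<open>Counting complementary letters between \<open>V\<close> and \<open>W\<close>\<close>

lemma sum_card_flip:
  assumes "finite X" "finite Y"
  shows "(\<Sum>x\<in>X. card {y \<in> Y. Q x y}) = (\<Sum>y\<in>Y. card {x \<in> X. Q x y})"
proof -
  have "(\<Sum>x\<in>X. card {y \<in> Y. Q x y}) = (\<Sum>x\<in>X. \<Sum>y\<in>Y. if Q x y then 1 else 0)"
    using assms by (simp add: sum.If_cases Int_def)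
  also have "\<dots> = (\<Sum>y\<in>Y. \<Sum>x\<in>X. if Q x y then 1 else 0)" by (rule sum.swap)
  also have "\<dots> = (\<Sum>y\<in>Y. card {x \<in> X. Q x y})" using assms by (simp add: sum.If_cases Int_def)
  finally show ?thesis .
qed

text \<open>Only the three words missing \<open>v\<close> count. If one of them is complementary to
  \<open>v\<close> in all four coordinates, each other one loses the coordinate separating it from
  that word and, not being its twin, a second one. The total is then at most 4 + 2 + 2.\<close>

lemma sum_opp_le_9:
  assumes v: "v \<in> V"
  shows "(\<Sum>i\<in>I. card (fib W i (opp (v i)))) \<le> 9"
proof -
  let ?U = "W - near v"
  define c where "c u = card {i \<in> I. u i = opp (v i)}" for u
  have finU: "finite ?U" using finW by simp
  have "fib W i (opp (v i)) = {u \<in> ?U. u i = opp (v i)}" if "i \<in> I" for i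
    using far_opp[OF that, of v] unfolding fib_def by blast
  then have "(\<Sum>i\<in>I. card (fib W i (opp (v i)))) = (\<Sum>i\<in>I. card {u \<in> ?U. u i = opp (v i)})" by simp
  also have "\<dots> = (\<Sum>u\<in>?U. c u)" unfolding c_def by (rule sum_card_flip[OF finI finU])
  also have "\<dots> \<le> 9"
  proof (cases "\<forall>u\<in>?U. c u \<le> 3")
    case True
    then have "(\<Sum>u\<in>?U. c u) \<le> (\<Sum>u\<in>?U. 3)" by (intro sum_mono) auto
    then show ?thesis using card_far_3[OF v] by simp
  next
    case False
    then obtain u0 where u0: "u0 \<in> ?U" "\<not> c u0 \<le> 3" by blast
    have cI: "card I = 4" using shape[OF v] by blast
    have le4: "c u \<le> 4" for u unfolding c_def using card_mono[of I "{i \<in> I. u i = opp (v i)}"] finI cI by auto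
    then have "c u0 = card I" using u0(2) cI le4[of u0] by linarith
    then have "{i \<in> I. u0 i = opp (v i)} = I" unfolding c_def using finI by (intro card_subset_eq) auto
    then have u0v: "u0 i = opp (v i)" if "i \<in> I" for i using that by blast
    have le2: "c u \<le> 2" if u: "u \<in> ?U - {u0}" for u
    proof -
      have "dich I u0 u" using codeD[OF codeW, of u0 u] u u0 by blast
      then obtain i where i: "i \<in> I" "u i = opp (u0 i)" unfolding dich_def by blast
      have "\<not> twin I u0 u" using tfW u u0 unfolding twinfree_def by blast
      then obtain j where j: "j \<in> I - {i}" "u j \<noteq> u0 j" using i unfolding twin_def by blast
      have ui: "u i \<noteq> opp (v i)" using i u0v[OF i(1)] by simp
      have uj: "u j \<noteq> opp (v j)" using j u0v by auto
      have "{k \<in> I. u k = opp (v k)} \<subseteq> I - {i, j}" using ui uj by blast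
      then have "c u \<le> card (I - {i, j})" unfolding c_def using finI by (intro card_mono) auto
      also have "\<dots> = 2" using i j cI finI by (subst card_Diff_subset) auto
      finally show ?thesis .
    qed
    have "(\<Sum>u\<in>?U. c u) = c u0 + (\<Sum>u\<in>?U - {u0}. c u)" using finU u0 by (simp add: sum.remove)
    also have "(\<Sum>u\<in>?U - {u0}. c u) \<le> (\<Sum>u\<in>?U - {u0}. 2)" using le2 by (rule sum_mono)
    also have "\<dots> = 4" using card_far_3[OF v] u0 finU by simp
    finally show ?thesis using le4[of u0] by simp
  qed
  finally show ?thesis .
qed

text \<open>Each of the four letters contributes a product of fiber sizes p, q >= 2, and p q >= 2 p
  + 2 q - 4. Both codes have ten words, so the sum is at least 20 + 20 - 16.\<close>

lemma sum_opp_ge_24: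
  assumes i: "i \<in> I"
  shows "24 \<le> (\<Sum>v\<in>V. card (fib W i (opp (v i))))"
proof -
  interpret s: small_equiv_codes I W V by (rule swap_small)
  obtain x where x: "x \<in> V" using nonempty by blast
  obtain m where lm: "fst (x i) \<noteq> fst m" and h: "hit I V W i m"
    and all: "\<forall>v\<in>V \<union> W. fst (v i) = fst (x i) \<or> fst (v i) = fst m"
    using letter_keys[OF i, of x "x i"] x by blast
  define l where "l = x i"
  obtain y where y: "y \<in> V" "y i = m" using h unfolding hit_def by blast
  have key: "\<exists>z\<in>V \<union> W. fst b = fst (z i)" if "b \<in> {l, opp l, m, opp m}" for b
    using that x y unfolding l_def by auto
  have ge2: "2 \<le> card (fib V i b)" "2 \<le> card (fib W i b)" if "b \<in> {l, opp l, m, opp m}" for b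
    using key[OF that] letter_sizes(1,3)[OF i] by blast+
  define f where "f b = (\<Sum>v\<in>fib V i b. card (fib W i (opp (v i))))" for b
  have f: "2 * card (fib V i b) + 2 * card (fib W i (opp b)) \<le> f b + 4" if b: "b \<in> {l, opp l, m, opp m}" for b
  proof -
    have "f b = card (fib V i b) * card (fib W i (opp b))" unfolding f_def by (simp add: fib_def)
    moreover have "2 * p + 2 * q \<le> p * q + 4" if pq: "2 \<le> p" "2 \<le> q" for p q :: nat
    proof -
      obtain p' q' where "p = 2 + p'" "q = 2 + q'" using le_Suc_ex[OF pq(1)] le_Suc_ex[OF pq(2)] by blast
      then show ?thesis by (simp add: algebra_simps)
    qed
    moreover have "opp b \<in> {l, opp l, m, opp m}" using b by auto
    ultimately show ?thesis using ge2[OF b] ge2(2)[of "opp b"] by simp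
  qed
  have V: "V = (fib V i l \<union> fib V i (opp l)) \<union> (fib V i m \<union> fib V i (opp m))"
  proof -
    have "v i = l \<or> v i = opp l \<or> v i = m \<or> v i = opp m" if "v \<in> V" for v
      using all that same_key[of "v i" l] same_key[of "v i" m] unfolding l_def by blast
    then show ?thesis unfolding fib_def by blast
  qed
  have lm': "l \<noteq> m" "l \<noteq> opp m" "opp l \<noteq> m" "opp l \<noteq> opp m"
  proof -
    have "fst l \<noteq> fst m" using lm unfolding l_def .
    then show "l \<noteq> m" "l \<noteq> opp m" "opp l \<noteq> m" "opp l \<noteq> opp m" by auto
  qed
  have dj: "fib V i a \<inter> fib V i b = {}" if "a \<noteq> b" for a b using that unfolding fib_def by auto
  have "(\<Sum>v\<in>V. card (fib W i (opp (v i)))) = f l + f (opp l) + (f m + f (opp m))"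
  proof -
    have "(\<Sum>v\<in>(fib V i l \<union> fib V i (opp l)) \<union> (fib V i m \<union> fib V i (opp m)). card (fib W i (opp (v i))))
      = (\<Sum>v\<in>fib V i l \<union> fib V i (opp l). card (fib W i (opp (v i))))
        + (\<Sum>v\<in>fib V i m \<union> fib V i (opp m). card (fib W i (opp (v i))))"
      using dj lm' by (intro sum.union_disjoint) (auto simp: Int_Un_distrib Int_Un_distrib2)
    also have "(\<Sum>v\<in>fib V i l \<union> fib V i (opp l). card (fib W i (opp (v i)))) = f l + f (opp l)"
      unfolding f_def using dj by (intro sum.union_disjoint) auto
    also have "(\<Sum>v\<in>fib V i m \<union> fib V i (opp m). card (fib W i (opp (v i)))) = f m + f (opp m)"
      unfolding f_def using dj by (intro sum.union_disjoint) auto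
    finally show ?thesis using V by simp
  qed
  moreover have "card (fib V i l) + card (fib V i (opp l)) + card (fib V i m) + card (fib V i (opp m)) = 10"
    using card_keys2(2)[of l m i] all lm card_V_10 unfolding l_def by auto
  moreover have "card (fib W i l) + card (fib W i (opp l)) + card (fib W i m) + card (fib W i (opp m)) = 10"
    using s.card_keys2(2)[of l m i] all lm card_W_10 unfolding l_def by auto
  ultimately show ?thesis using f[of l] f[of "opp l"] f[of m] f[of "opp m"] by simp
qed

lemma contradiction: False
proof -
  obtain v where "v \<in> V" using nonempty by blast
  then have cI: "card I = 4" using shape by blast
  have "(96 :: nat) = (\<Sum>i\<in>I. 24)" using cI by simp
  also have "\<dots> \<le> (\<Sum>i\<in>I. \<Sum>v\<in>V. card (fib W i (opp (v i))))" by (rule sum_mono[OF sum_opp_ge_24])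
  also have "\<dots> = (\<Sum>v\<in>V. \<Sum>i\<in>I. card (fib W i (opp (v i))))" by (rule sum.swap)
  also have "\<dots> \<le> (\<Sum>v\<in>V. 9)" by (rule sum_mono[OF sum_opp_le_9])
  also have "\<dots> = 90" using card_V_10 by simp
  finally show False by simp
qed

end

theorem equiv_codes_ge_11:
  assumes "equiv_codes I V W" "V \<noteq> {}"
  shows "11 \<le> card V"
  using assms
proof (induction "card I" arbitrary: I V W rule: less_induct)
  case less
  show ?case
  proof (rule ccontr)
    assume "\<not> 11 \<le> card V"
    interpret equiv_codes I V W by (rule less.prems(1))
    interpret small_equiv_codes I V W
    proof
      fix i X Y assume "i \<in> I" "equiv_codes (I - {i}) X (Y :: ('a \<Rightarrow> 'b \<times> bool) set)" "X \<noteq> {}"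
      then show "11 \<le> card X" using less.hyps[of "I - {i}" X Y] card_Diff1_less[OF finI] by blast
    qed (use \<open>\<not> 11 \<le> card V\<close> less.prems(2) in auto)
    show False by (rule contradiction)
  qed
qed

section \<open>From tilings to codes\<close>

lemma mem_cube_at: "y \<in> cube_at t \<longleftrightarrow> (\<forall>i. t $ i \<le> y $ i \<and> y $ i < t $ i + 1)"
proof -
  have "y \<in> cube_at t \<longleftrightarrow> y - t \<in> unit_cube"
    unfolding cube_at_def by (metis (no_types, lifting) add.commute add_diff_cancel_left' diff_add_cancel image_iff)
  then show ?thesis unfolding unit_cube_def by (auto simp: algebra_simps)
qed

lemma mem_closed_cube_at: "y \<in> closed_cube_at x \<longleftrightarrow> (\<forall>i. x $ i \<le> y $ i \<and> y $ i \<le> x $ i + 1)"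
proof -
  have "y \<in> closed_cube_at x \<longleftrightarrow> y - x \<in> closed_unit_cube"
    unfolding closed_cube_at_def by (metis (no_types, lifting) add.commute add_diff_cancel_left' diff_add_cancel image_iff)
  then show ?thesis unfolding closed_unit_cube_def by (auto simp: algebra_simps)
qed

definition touching :: "(real ^ 'n) set \<Rightarrow> real ^ 'n \<Rightarrow> (real ^ 'n) set" where
  "touching T x = {t \<in> T. \<forall>i. x $ i - 1 < t $ i \<and> t $ i \<le> x $ i + 1}"

lemma cube_meets_closed_cube:
  "cube_at t \<inter> closed_cube_at x \<noteq> {} \<longleftrightarrow> (\<forall>i. x $ i - 1 < t $ i \<and> t $ i \<le> x $ i + 1)"
proof
  assume "cube_at t \<inter> closed_cube_at x \<noteq> {}"
  then obtain y where "y \<in> cube_at t" "y \<in> closed_cube_at x" by blast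
  then show "\<forall>i. x $ i - 1 < t $ i \<and> t $ i \<le> x $ i + 1"
    unfolding mem_cube_at mem_closed_cube_at by (smt (verit))
next
  assume a: "\<forall>i. x $ i - 1 < t $ i \<and> t $ i \<le> x $ i + 1"
  have "(\<chi> i. max (t $ i) (x $ i)) \<in> cube_at t \<inter> closed_cube_at x"
    unfolding Int_iff mem_cube_at mem_closed_cube_at using a by (auto simp: max_def) (smt (verit))+
  then show "cube_at t \<inter> closed_cube_at x \<noteq> {}" by blast
qed

text \<open>The trace on the \<open>i\<close>-th edge of \<open>[0,1]\<^sup>d + x\<close> of a cube touching it is a set \<open>{y. y < a}\<close> (letter
  \<open>(a, True)\<close>) or \<open>{y. a \<le> y}\<close> (letter \<open>(a, False)\<close>).\<close>

definition word :: "real ^ 'n \<Rightarrow> real ^ 'n \<Rightarrow> 'n \<Rightarrow> real \<times> bool" where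
  "word x t i = (if t $ i \<le> x $ i then (t $ i + 1, True) else (t $ i, False))"

text \<open>A real point becomes the assignment telling which keys lie above its coordinate. On each
  edge, touching makes one of the two inequalities defining the cube automatic.\<close>

lemma inbox_word:
  assumes "t \<in> touching T x" "y \<in> closed_cube_at x"
  shows "inbox UNIV (\<lambda>i a. y $ i < a) (word x t) \<longleftrightarrow> y \<in> cube_at t"
proof -
  have "holds (\<lambda>a. y $ i < a) (word x t i) \<longleftrightarrow> t $ i \<le> y $ i \<and> y $ i < t $ i + 1" for i
  proof -
    have "x $ i - 1 < t $ i" "t $ i \<le> x $ i + 1" "x $ i \<le> y $ i" "y $ i \<le> x $ i + 1"
      using assms unfolding touching_def mem_closed_cube_at by auto
    then show ?thesis unfolding holds_def word_def by auto
  qed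
  then show ?thesis unfolding inbox_def mem_cube_at by simp
qed

lemma tiling_unique:
  assumes "cube_tiling T"
  shows "\<exists>!t. t \<in> T \<and> y \<in> cube_at t"
proof -
  have "y \<in> (\<Union>t\<in>T. cube_at t)" using assms unfolding cube_tiling_def by simp
  then show ?thesis using assms unfolding cube_tiling_def disjoint_family_on_def by blast
qed

text \<open>A touching cube contains the vertex of the closed cube determined by the coordinates
  with \<open>t $ j \<le> x $ j\<close>; cubes with the same set of coordinates share a vertex and
  coincide.\<close>

lemma finite_touching:
  fixes T :: "(real ^ 'n) set"
  assumes T: "cube_tiling T"
  shows "finite (touching T x)"
    and "card {t \<in> touching T x. t $ i \<le> x $ i} \<le> 2 ^ (CARD('n) - 1)"
proof -
  let ?S = "\<lambda>t :: real ^ 'n. {j. t $ j \<le> x $ j}"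
  have inj: "inj_on ?S (touching T x)"
  proof (rule inj_onI)
    fix t s assume ts: "t \<in> touching T x" "s \<in> touching T x" "?S t = ?S s"
    define y where "y = (\<chi> j. if t $ j \<le> x $ j then x $ j else x $ j + 1)"
    have "y \<in> cube_at t" using ts(1) unfolding mem_cube_at touching_def y_def by (auto simp: diff_less_eq)
    moreover have "y \<in> cube_at s"
    proof -
      have "t $ j \<le> x $ j \<longleftrightarrow> s $ j \<le> x $ j" for j using ts(3) by blast
      then show ?thesis using ts(2) unfolding mem_cube_at touching_def y_def by (auto simp: diff_less_eq)
    qed
    ultimately show "t = s" using tiling_unique[OF T, of y] ts unfolding touching_def by blast
  qed
  show "finite (touching T x)" by (rule finite_imageD[OF _ inj]) simp
  have "?S ` {t \<in> touching T x. t $ i \<le> x $ i} \<subseteq> insert i ` Pow (UNIV - {i})"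
  proof
    fix A assume "A \<in> ?S ` {t \<in> touching T x. t $ i \<le> x $ i}"
    then have "i \<in> A" by blast
    then have "A = insert i (A - {i})" by blast
    then show "A \<in> insert i ` Pow (UNIV - {i})" by blast
  qed
  then have "card {t \<in> touching T x. t $ i \<le> x $ i} \<le> card (insert i ` Pow (UNIV - {i}))"
    by (intro card_inj_on_le[of ?S]) (auto intro: inj_on_subset[OF inj])
  also have "\<dots> \<le> card (Pow (UNIV - {i}))" by (rule card_image_le) simp
  also have "\<dots> = 2 ^ (CARD('n) - 1)" by (simp add: card_Pow)
  finally show "card {t \<in> touching T x. t $ i \<le> x $ i} \<le> 2 ^ (CARD('n) - 1)" .
qed

text \<open>The functions \<open>y \<mapsto> of_bool (y < a)\<close> for \<open>lo < a \<le> hi\<close> are linearly independent modulo constants on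
  \<open>[lo, hi]\<close>, so an affine relation between them remains true when their values are prescribed arbitrarily.\<close>

lemma affine_extension:
  fixes c :: "'t \<Rightarrow> real" and l :: "'t \<Rightarrow> real \<times> bool"
  assumes Q: "finite Q" and lh: "lo \<le> hi" and keys: "\<And>t. t \<in> Q \<Longrightarrow> lo < fst (l t) \<and> fst (l t) \<le> hi"
    and eq: "\<And>y. lo \<le> y \<Longrightarrow> y \<le> hi \<Longrightarrow> (\<Sum>t\<in>Q. c t * of_bool (holds (\<lambda>a. y < a) (l t))) = C"
  shows "(\<Sum>t\<in>Q. c t * of_bool (holds f (l t))) = C"
proof -
  define A where "A = fst ` l ` Q"
  have finA: "finite A" unfolding A_def using Q by simp
  \<comment> \<open>The letter \<open>(a, False)\<close> is one minus \<open>(a, True)\<close>: it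
    adds to the constant \<open>C0\<close> and has a jump of opposite sign at
    \<open>a\<close>.\<close>
  define sg where "sg t = c t * (if snd (l t) then 1 else - 1)" for t
  define \<alpha> where "\<alpha> a = (\<Sum>t\<in>{t \<in> Q. fst (l t) = a}. sg t)" for a
  define C0 where "C0 = (\<Sum>t\<in>Q. c t * of_bool (\<not> snd (l t)))"
  have expand: "(\<Sum>t\<in>Q. c t * of_bool (holds g (l t))) = C0 + (\<Sum>a\<in>{a \<in> A. g a}. \<alpha> a)" for g
  proof -
    have "c t * of_bool (holds g (l t)) = c t * of_bool (\<not> snd (l t)) + (if g (fst (l t)) then sg t else 0)" for t
      unfolding holds_def sg_def by (auto simp: of_bool_def)
    then have "(\<Sum>t\<in>Q. c t * of_bool (holds g (l t))) = C0 + (\<Sum>t\<in>Q. if g (fst (l t)) then sg t else 0)"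
      unfolding C0_def by (simp add: sum.distrib)
    also have "(\<Sum>t\<in>Q. if g (fst (l t)) then sg t else 0)
      = (\<Sum>a\<in>A. \<Sum>t\<in>{t \<in> Q. fst (l t) = a}. if g (fst (l t)) then sg t else 0)"
      using sum.group[OF Q finA, of "\<lambda>t. fst (l t)" "\<lambda>t. if g (fst (l t)) then sg t else 0"]
      unfolding A_def by force
    also have "\<dots> = (\<Sum>a\<in>A. if g a then \<alpha> a else 0)"
      unfolding \<alpha>_def by (intro sum.cong) auto
    also have "\<dots> = (\<Sum>a\<in>{a \<in> A. g a}. \<alpha> a)" using finA by (simp add: sum.inter_filter)
    finally show ?thesis .
  qed
  have Ak: "lo < a \<and> a \<le> hi" if "a \<in> A" for a using that keys unfolding A_def by auto
  \<comment> \<open>Evaluation at \<open>hi\<close> isolates the constant, since no key lies above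
    it.\<close>
  have "{a \<in> A. hi < a} = {}" using Ak by fastforce
  then have "(\<Sum>a\<in>{a \<in> A. hi < a}. \<alpha> a) = 0" by (simp only: sum.empty)
  then have C0: "C0 = C" using eq[of hi] lh expand[of "\<lambda>a. hi < a"] by simp
  have S0: "(\<Sum>a\<in>{a \<in> A. y < a}. \<alpha> a) = 0" if "lo \<le> y" "y \<le> hi" for y
    using eq[OF that] expand[of "\<lambda>a. y < a"] C0 by simp
  have "\<alpha> a = 0" if a: "a \<in> A" for a
  proof -
    \<comment> \<open>No key lies strictly between \<open>y\<close> and \<open>a\<close>, so the
      relations at \<open>y\<close> and at \<open>a\<close> differ by the single term of
      \<open>a\<close>.\<close>
    define y where "y = Max (insert lo {b \<in> A. b < a})"
    have fin: "finite (insert lo {b \<in> A. b < a})" using finA by simp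
    have y: "y \<in> insert lo {b \<in> A. b < a}" unfolding y_def by (rule Max_in[OF fin]) simp
    have yge: "b \<le> y" if "b \<in> insert lo {b \<in> A. b < a}" for b unfolding y_def using Max_ge[OF fin that] .
    have ya: "y < a" "lo \<le> y" using y Ak[OF a] yge[of lo] by auto
    have "{b \<in> A. y < b} = insert a {b \<in> A. a < b}" using a ya yge by force
    then have "(\<Sum>b\<in>{b \<in> A. y < b}. \<alpha> b) = \<alpha> a + (\<Sum>b\<in>{b \<in> A. a < b}. \<alpha> b)" using finA by simp
    then show ?thesis using S0[of y] S0[of a] ya Ak[OF a] by simp
  qed
  then have "(\<Sum>a\<in>{a \<in> A. f a}. \<alpha> a) = 0" by (intro sum.neutral) auto
  then show ?thesis using expand[of f] C0 by simp
qed

lemma word_key: "t \<in> touching T x \<Longrightarrow> x $ i < fst (word x t i) \<and> fst (word x t i) \<le> x $ i + 1"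
  unfolding touching_def word_def by (auto simp: less_diff_eq) (smt (verit))+

text \<open>For assignments coming from points of the closed cube this is the tiling property. The
  set \<open>J\<close> collects the coordinates with arbitrary assignments; each is released by
  \<open>affine_extension\<close> with the others fixed.\<close>

lemma words_cover_once:
  fixes T :: "(real ^ 'n) set"
  assumes T: "cube_tiling T"
  shows "(\<Sum>t\<in>touching T x. of_bool (inbox UNIV p (word x t))) = (1 :: real)"
proof -
  let ?Q = "touching T x"
  have finQ: "finite ?Q" by (rule finite_touching(1)[OF T])
  have "(\<Sum>t\<in>?Q. of_bool (inbox UNIV p (word x t))) = (1 :: real)"
    if "\<And>j. j \<notin> J \<Longrightarrow> \<exists>y. x $ j \<le> y \<and> y \<le> x $ j + 1 \<and> p j = (\<lambda>a. y < a)" for J p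
    using finite[of J] that
  proof (induction J arbitrary: p rule: finite_induct)
    case empty
    then have "\<exists>z. \<forall>j. x $ j \<le> z j \<and> z j \<le> x $ j + 1 \<and> p j = (\<lambda>a. z j < a)" by (intro choice) auto
    then obtain z where z: "\<And>j. x $ j \<le> z j \<and> z j \<le> x $ j + 1 \<and> p j = (\<lambda>a. z j < a)" by blast
    define y where "y = (\<chi> j. z j)"
    have yc: "y \<in> closed_cube_at x" unfolding mem_closed_cube_at y_def using z by simp
    have p: "p = (\<lambda>i a. y $ i < a)" unfolding y_def using z by auto
    obtain t0 where t0: "t0 \<in> T" "y \<in> cube_at t0" "\<And>t. t \<in> T \<Longrightarrow> y \<in> cube_at t \<Longrightarrow> t = t0"
      using tiling_unique[OF T, of y] by blast
    have "cube_at t0 \<inter> closed_cube_at x \<noteq> {}" using t0 yc by blast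
    then have tQ: "t0 \<in> ?Q" using t0(1) unfolding cube_meets_closed_cube touching_def by blast
    have "inbox UNIV p (word x t) \<longleftrightarrow> t = t0" if "t \<in> ?Q" for t
      using inbox_word[OF that yc] t0 that unfolding p touching_def by blast
    then have "(\<Sum>t\<in>?Q. of_bool (inbox UNIV p (word x t))) = (\<Sum>t\<in>?Q. of_bool (t = t0) :: real)"
      by (intro sum.cong) auto
    also have "\<dots> = 1" using tQ finQ by simp
    finally show ?case .
  next
    case (insert j J)
    define c where "c t = (of_bool (inbox (UNIV - {j}) p (word x t)) :: real)" for t
    have split: "of_bool (inbox UNIV (p(j := f)) (word x t)) = c t * of_bool (holds f (word x t j))" for f t
    proof -
      have "inbox UNIV (p(j := f)) (word x t) \<longleftrightarrow> inbox (UNIV - {j}) p (word x t) \<and> holds f (word x t j)"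
        by (auto simp: inbox_remove[of j UNIV] inbox_upd)
      then show ?thesis unfolding c_def by simp
    qed
    have "(\<Sum>t\<in>?Q. c t * of_bool (holds (p j) (word x t j))) = 1"
    proof (rule affine_extension[OF finQ, of "x $ j" "x $ j + 1"])
      fix y assume y: "x $ j \<le> y" "y \<le> x $ j + 1"
      have "(\<Sum>t\<in>?Q. of_bool (inbox UNIV (p(j := (\<lambda>a. y < a))) (word x t))) = (1 :: real)"
        by (rule insert.IH) (use insert.prems y in \<open>auto split: if_splits\<close>)
      then show "(\<Sum>t\<in>?Q. c t * of_bool (holds (\<lambda>a. y < a) (word x t j))) = 1" unfolding split .
    qed (use word_key in auto)
    then show ?case unfolding split[symmetric] by simp
  qed
  from this[of UNIV p] show ?thesis by simp
qed

text \<open>Multiplicity one gives all claims: a common point of two words would be counted twice,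
  an uncovered point not at all.\<close>

lemma words_code:
  fixes T :: "(real ^ 'n) set"
  assumes T: "cube_tiling T"
  shows "code UNIV (word x ` touching T x)" and "cov UNIV (word x ` touching T x) p" and "inj_on (word x) (touching T x)"
proof -
  let ?Q = "touching T x"
  note fin = finite_touching(1)[OF T] and once = words_cover_once[OF T]
  have d: "dich UNIV (word x t) (word x s)" if "t \<in> ?Q" "s \<in> ?Q" "t \<noteq> s" for t s
  proof (rule ccontr)
    assume "\<not> ?thesis"
    then obtain q where q: "inbox UNIV q (word x t)" "inbox UNIV q (word x s)" using meet_point by blast
    have "(2 :: real) = (\<Sum>r\<in>{t, s}. of_bool (inbox UNIV q (word x r)))" using q that by simp
    also have "\<dots> \<le> (\<Sum>r\<in>?Q. of_bool (inbox UNIV q (word x r)))" using that fin by (intro sum_mono2) auto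
    finally show False using once[where x = x and p = q] by simp
  qed
  show "inj_on (word x) ?Q" using d dich_irrefl unfolding inj_on_def by metis
  show "code UNIV (word x ` ?Q)" unfolding code_def using d fin by auto
  show "cov UNIV (word x ` ?Q) p"
  proof (rule ccontr)
    assume "\<not> ?thesis"
    then have "(\<Sum>t\<in>?Q. of_bool (inbox UNIV p (word x t))) = (\<Sum>t\<in>?Q. 0 :: real)"
      unfolding cov_def by (intro sum.cong) auto
    then show False using once[where x = x and p = p] by simp
  qed
qed

lemma words_twinfree:
  assumes "\<not> (\<exists>t\<in>T. \<exists>s\<in>T. twin_pair t s)"
  shows "twinfree UNIV (word x ` touching T x)"
proof -
  have "\<not> twin UNIV (word x t) (word x s)" if "t \<in> T" "s \<in> T" for t s
  proof
    assume "twin UNIV (word x t) (word x s)"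
    then obtain i where i: "word x s i = opp (word x t i)" "\<And>j. j \<noteq> i \<Longrightarrow> word x s j = word x t j"
      unfolding twin_def by auto
    have "\<bar>t $ i - s $ i\<bar> = 1" using i(1) unfolding word_def opp_def by (auto split: if_splits)
    moreover have "t $ j = s $ j" if "j \<noteq> i" for j using i(2)[OF that] unfolding word_def by (auto split: if_splits)
    ultimately show False using assms \<open>t \<in> T\<close> \<open>s \<in> T\<close> unfolding twin_pair_def by blast
  qed
  then show ?thesis unfolding twinfree_def touching_def by auto
qed

text \<open>The line through \<open>q\<close> in direction \<open>i\<close> is covered entirely. A
  word reaching the half \<open>opp l\<close> is disjoint from the given one and, both containing
  \<open>q\<close>, can only be separated from it at \<open>i\<close>.\<close>

lemma fib_opp_cov:
  assumes c: "code UNIV X" and cv: "\<And>p. cov UNIV X p" and v: "cov (UNIV - {i}) (fib X i l) q"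
  shows "cov (UNIV - {i}) (fib X i (opp l)) q"
proof -
  obtain w where w: "w \<in> X" "w i = l" "inbox (UNIV - {i}) q w" using v unfolding cov_def fib_def by blast
  obtain f where f: "holds f (opp l)" using holds_exists1 by blast
  obtain u where u: "u \<in> X" "inbox UNIV (q(i := f)) u" using cv unfolding cov_def by blast
  have uq: "holds f (u i)" "inbox (UNIV - {i}) q u" using u(2) by (simp_all add: inbox_remove[of i UNIV] inbox_upd)
  have "u \<noteq> w" using uq(1) f w(2) by auto
  then have "dich UNIV w u" using codeD[OF c w(1) u(1)] by simp
  then have "u i = opp (w i)" using dich_remove[of UNIV w u i] dich_disjoint[OF _ w(3) uq(2)] by blast
  then show ?thesis using u(1) uq(2) w(2) unfolding cov_def fib_def by auto
qed

text \<open>A value \<mu> in \<open>L_set T x i\<close> belongs to the letter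
  \<open>(\<mu> + 1, True)\<close>, whose fiber and complementary fiber are equivalent codes. So
  each value takes eleven of the touching cubes with \<open>t $ i \<le> x $ i\<close>.\<close>

lemma card_L_set:
  fixes T :: "(real ^ 'n) set"
  assumes T: "cube_tiling T" and nt: "\<not> (\<exists>t\<in>T. \<exists>s\<in>T. twin_pair t s)"
  shows "11 * card (L_set T x i) \<le> 2 ^ (CARD('n) - 1)"
proof -
  let ?Q = "touching T x" and ?X = "word x ` touching T x"
  note c = words_code(1)[OF T, of x] and cv = words_code(2)[OF T, of x] and tf = words_twinfree[OF nt, of x]
  define F where "F \<mu> = fib ?X i (\<mu> + 1, True)" for \<mu>
  have L: "L_set T x i = (\<lambda>t. t $ i) ` {t \<in> ?Q. t $ i \<le> x $ i}"
    unfolding L_set_def cube_meets_closed_cube touching_def by auto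
  have finL: "finite (L_set T x i)" unfolding L using finite_touching(1)[OF T] by simp
  have F11: "11 \<le> card (F \<mu>)" if \<mu>: "\<mu> \<in> L_set T x i" for \<mu>
  proof -
    let ?l = "(\<mu> + 1, True)"
    have "equiv_codes (UNIV - {i}) (F \<mu>) (fib ?X i (opp ?l))"
    proof
      have fc: "code (UNIV - {i}) (fib ?X i b)" "twinfree (UNIV - {i}) (fib ?X i b)" for b
        by (rule code_fiber[OF c, of _ i b] twinfree_fiber[OF tf, of _ i b]; simp add: fib_def)+
      show "code (UNIV - {i}) (F \<mu>)" "code (UNIV - {i}) (fib ?X i (opp ?l))"
        "twinfree (UNIV - {i}) (F \<mu>)" "twinfree (UNIV - {i}) (fib ?X i (opp ?l))"
        unfolding F_def by (rule fc)+
      show "cov (UNIV - {i}) (F \<mu>) p \<longleftrightarrow> cov (UNIV - {i}) (fib ?X i (opp ?l)) p" for p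
        using fib_opp_cov[OF c cv, of i ?l p] fib_opp_cov[OF c cv, of i "opp ?l" p] unfolding F_def by auto
      fix v w assume "v \<in> F \<mu>" "w \<in> fib ?X i (opp ?l)"
      then have vw: "v \<in> ?X" "w \<in> ?X" "w i = opp (v i)" unfolding F_def fib_def by auto
      show "\<not> eqon (UNIV - {i}) v w" using twin_opp[of i UNIV v w] vw tf unfolding twinfree_def by blast
    qed simp
    moreover have "F \<mu> \<noteq> {}" using \<mu> unfolding L F_def fib_def word_def by auto
    ultimately show ?thesis by (rule equiv_codes_ge_11)
  qed
  have finF: "finite (F \<mu>)" for \<mu> unfolding F_def fib_def using finite_touching(1)[OF T] by simp
  have "11 * card (L_set T x i) = (\<Sum>\<mu>\<in>L_set T x i. 11)" by simp
  also have "\<dots> \<le> (\<Sum>\<mu>\<in>L_set T x i. card (F \<mu>))" by (rule sum_mono[OF F11])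
  also have "\<dots> = card (\<Union>\<mu>\<in>L_set T x i. F \<mu>)"
    by (rule card_UN_disjoint[symmetric]) (use finL finF in \<open>auto simp: F_def fib_def\<close>)
  also have "\<dots> \<le> card (word x ` {t \<in> ?Q. t $ i \<le> x $ i})"
  proof (rule card_mono)
    show "(\<Union>\<mu>\<in>L_set T x i. F \<mu>) \<subseteq> word x ` {t \<in> ?Q. t $ i \<le> x $ i}"
      unfolding F_def fib_def by (auto simp: word_def split: if_splits)
  qed (use finite_touching(1)[OF T] in simp)
  also have "\<dots> \<le> card {t \<in> ?Q. t $ i \<le> x $ i}" using finite_touching(1)[OF T] by (intro card_image_le) simp
  also have "\<dots> \<le> 2 ^ (CARD('n) - 1)" by (rule finite_touching(2)[OF T])
  finally show ?thesis .
qed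

theorem theorem1p1:
  fixes T :: "(real ^ 7) set"
  assumes "cube_tiling T"
    and "r_plus T \<ge> 6"
  shows "\<exists>t\<in>T. \<exists>s\<in>T. twin_pair t s"
proof (rule ccontr)
  assume nt: "\<not> ?thesis"
  \<comment> \<open>In dimension 7 there are at most 64 cubes available, and 11 times 6 is
    66.\<close>
  have "card (L_set T x i) \<le> 5" for x i using card_L_set[OF assms(1) nt, of x i] by simp
  moreover define g where "g x = (MAX i. card (L_set T x i))" for x
  ultimately have g: "g x \<le> 5" for x unfolding g_def by (intro Max.boundedI) auto
  then have "range g \<subseteq> {..5}" by blast
  \<comment> \<open>The bound makes the range finite, so the outer maximum is a genuine one.\<close>
  then have "finite (range g)" by (rule finite_subset) simp
  then have "Max (range g) \<le> 5" by (rule Max.boundedI) (use g in auto)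
  then have "r_plus T \<le> 5" unfolding r_plus_def g_def .
  then show False using assms(2) by simp
qed

end
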